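(* Let $f:\mathbb{R}^n\to\mathbb{R}$ be definable, locally Lipschitz, and invariant under the natural action of a Lie subgroup $G$ of $\mathrm{GL}(n,\mathbb{R})$ (i.e. $f(gx)=f(x)$ for all $g\in G$, $x\in\mathbb{R}^n$), and let $C(x)=P_{\mathrm{s}(\mathfrak{g})}(xx^T)$ for $x\in\mathbb{R}^n$. Fix a point $\overline{x}\in\mathbb{R}^n$. Suppose that $[f=f(\overline{x})]_{\overline{x}}=G\overline{x}$ and that $\partial f$ is metrically $\eta$-subregular at $(\overline{x},0)$ with $\eta>1$. If $$\forall u\in\partial f(x),\ \forall v\in\partial f(y),\quad\langle C(u),C(v)\rangle>0$$ for all $x,y\in\mathbb{R}^n\setminus G\overline{x}$ near $\overline{x}$, then $\overline{x}$ is strongly unstable for $f$.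
   Context: An o-minimal structure on the real field is fixed; a function is definable if its graph belongs to it. The natural action is $(g,x)\mapsto gx$ (matrix-vector product) and $G\overline{x}=\{g\overline{x}:g\in G\}$. $\mathfrak{g}=T_{I_n}G\subseteq\mathbb{R}^{n\times n}$ is the Lie algebra, $\mathrm{s}(\mathfrak{g})$ the subspace of its symmetric elements, $P_{\mathrm{s}(\mathfrak{g})}$ the orthogonal projection onto it for the Frobenius inner product, and $\langle C(u),C(v)\rangle$ is the Frobenius inner product. $[f=f(\overline{x})]_{\overline{x}}$ is the connected component containing $\overline{x}$ of the level set $\{x\in\mathbb{R}^n:f(x)=f(\overline{x})\}$. Subdifferential: $\widehat\partial f(\overline{x})=\{v: f(x)\ge f(\overline{x})+\langle v,x-\overline{x}\rangle+o(|x-\overline{x}|)\text{ near }\overline{x}\}$; $\partial f(\overline{x})$ is the set of $v$ for which there are $x_k$ and $v_k\in\widehat\partial f(x_k)$ with $(x_k,f(x_k),v_k)\to(\overline{x},f(\overline{x}),v)$. A set-valued mapping $F:\mathbb{R}^n\rightrightarrows\mathbb{R}^m$ is metrically $\eta$-subregular at $(\overline{x},\overline{y})$ with $\overline{y}\in F(\overline{x})$, $\eta>0$, if there exist $\kappa,r>0$ such that $d(x,F^{-1}(\overline{y}))\le\kappa\, d(\overline{y},F(x))^\eta$ for all $x\in B_r(\overline{x})$, where $F^{-1}(\overline{y})=\{x:\overline{y}\in F(x)\}$, $d$ denotes distance to a set, and $B_r(\overline{x})$ is the closed ball. The subgradient method with constant step size $\alpha>0$ consists of choosing $x_0\in\mathbb{R}^n$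 and generating a sequence with $x_{k+1}\in x_k-\alpha\,\partial f(x_k)$ for all $k\in\mathbb{N}$. A point $\overline{x}$ is strongly unstable for $f$ if there exists $\epsilon>0$ such that for all but finitely many constant step sizes $\alpha>0$ and for almost every initial point in $B_\epsilon(\overline{x})$, at least one of the iterates of the subgradient method does not belong to $B_\epsilon(\overline{x})$. *)

theory Defs
  imports "HOL-Analysis.Analysis" "HOL-Library.Landau_Symbols"
begin

section \<open>O-minimal structures on the real field\<close>

text \<open>
  A point of the \<open>k\<close>-dimensional real space is a list of length \<open>k\<close>, since the dimension
  has to vary inside a structure. The last axiom (the one-dimensional definable sets are exactly
  the finite unions of points and open intervals) makes all real constants definable. Open
  intervals may be unbounded.
\<close>

definition ominimal_structure :: "(nat \<Rightarrow> real list set set) \<Rightarrow> bool" where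
  "ominimal_structure S \<longleftrightarrow>
     (\<forall>k. S k \<subseteq> Pow {xs. length xs = k}) \<and>
     (\<forall>k. {xs. length xs = k} \<in> S k) \<and>
     (\<forall>k. \<forall>A\<in>S k. {xs. length xs = k} - A \<in> S k) \<and>
     (\<forall>k. \<forall>A\<in>S k. \<forall>B\<in>S k. A \<union> B \<in> S k) \<and>
     (\<forall>k i j. i < k \<and> j < k \<longrightarrow> {xs. length xs = k \<and> xs ! i = xs ! j} \<in> S k) \<and>
     (\<forall>k. \<forall>A\<in>S k. {xs @ [t] |xs t. xs \<in> A} \<in> S (Suc k)) \<and>
     (\<forall>k. \<forall>A\<in>S k. {t # xs |xs t. xs \<in> A} \<in> S (Suc k)) \<and>
     (\<forall>k. \<forall>A\<in>S (Suc k). butlast ` A \<in> S k) \<and>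
     {[a, b, a + b] |a b. True} \<in> S 3 \<and>
     {[a, b, a * b] |a b. True} \<in> S 3 \<and>
     S 1 = {(\<lambda>t. [t]) ` \<Union>\<I> |\<I>. finite \<I> \<and>
                (\<forall>I\<in>\<I>. (\<exists>a. I = {a}) \<or> (open I \<and> is_interval I))}"

text \<open>
  The graph is read as a set of lists through an enumeration of the coordinates. The choice of
  the enumeration is immaterial, because an o-minimal structure is closed under permutations of
  the coordinates.
\<close>

definition definable_fun :: "(nat \<Rightarrow> real list set set) \<Rightarrow> (real ^ 'n \<Rightarrow> real) \<Rightarrow> bool" where
  "definable_fun S f \<longleftrightarrow>
     (\<exists>e. bij_betw e {..<CARD('n)} (UNIV :: 'n set) \<and>
        {map (\<lambda>i. x $ e i) [0..<CARD('n)] @ [f x] |x. True} \<in> S (Suc CARD('n)))"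


section \<open>Lie subgroups of the general linear group\<close>

text \<open>Meaningful on open sets; all iterated directional derivatives exist and are differentiable.\<close>

primrec differentiable_upto ::
    "nat \<Rightarrow> ('a::real_normed_vector \<Rightarrow> 'b::real_normed_vector) \<Rightarrow> 'a set \<Rightarrow> bool" where
  "differentiable_upto 0 h U \<longleftrightarrow> continuous_on U h"
| "differentiable_upto (Suc k) h U \<longleftrightarrow>
     (\<forall>x\<in>U. h differentiable at x) \<and>
     (\<forall>d. differentiable_upto k (\<lambda>x. frechet_derivative h (at x) d) U)"

definition smooth_on :: "('a::real_normed_vector \<Rightarrow> 'b::real_normed_vector) \<Rightarrow> 'a set \<Rightarrow> bool" where
  "smooth_on h U \<longleftrightarrow> (\<forall>k. differentiable_upto k h U)"

text \<open>
  A local parametrization of an immersed submanifold (with its own topology \<open>T\<close>, possibly finer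
  than the subspace topology). The model space is a linear subspace \<open>V\<close> of the matrix space, so
  that every dimension, including 0, is covered; the parameter domain is \<open>W \<inter> V\<close>, relatively open
  in \<open>V\<close>, and smoothness on it is expressed through a smooth extension to the open set \<open>W\<close>.
\<close>

definition immersed_param ::
    "(real ^ 'n ^ 'n) topology \<Rightarrow> (real ^ 'n ^ 'n) set \<Rightarrow> (real ^ 'n ^ 'n) set
      \<Rightarrow> (real ^ 'n ^ 'n \<Rightarrow> real ^ 'n ^ 'n) \<Rightarrow> bool" where
  "immersed_param T V W \<phi> \<longleftrightarrow>
     subspace V \<and> open W \<and> smooth_on \<phi> W \<and>
     (\<forall>p\<in>W \<inter> V. inj_on (frechet_derivative \<phi> (at p)) V) \<and>
     openin T (\<phi> ` (W \<inter> V)) \<and>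
     homeomorphic_map (top_of_set (W \<inter> V)) (subtopology T (\<phi> ` (W \<inter> V))) \<phi>"

text \<open>
  Any two such parametrizations are automatically smoothly compatible, hence the smooth structure
  is determined by \<open>T\<close> and the atlas consists of all of them. The next definition is smoothness,
  in coordinates, of a map from a subset of a Euclidean space into this manifold.
\<close>

definition smooth_into ::
    "(real ^ 'n ^ 'n) topology \<Rightarrow> 'a::euclidean_space set \<Rightarrow> ('a \<Rightarrow> real ^ 'n ^ 'n) \<Rightarrow> bool" where
  "smooth_into T D h \<longleftrightarrow>
     (\<forall>x\<in>D. \<exists>V W \<phi> N \<sigma>. immersed_param T V W \<phi> \<and> open N \<and> x \<in> N \<and> smooth_on \<sigma> N \<and>
        (\<forall>y\<in>D \<inter> N. \<sigma> y \<in> W \<inter> V \<and> h y = \<phi> (\<sigma> y)))"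

text \<open>
  A Lie subgroup is a subgroup carrying a topology and a smooth structure that make it a Lie group
  and an immersed submanifold (of some dimension \<open>d\<close>). Closed (embedded) subgroups are the case
  where \<open>T\<close> is the subspace topology.
\<close>

definition lie_subgroup_GL :: "(real ^ 'n ^ 'n) set \<Rightarrow> (real ^ 'n ^ 'n) topology \<Rightarrow> bool" where
  "lie_subgroup_GL G T \<longleftrightarrow>
     G \<subseteq> {A. invertible A} \<and> mat 1 \<in> G \<and>
     (\<forall>A\<in>G. \<forall>B\<in>G. A ** B \<in> G) \<and> (\<forall>A\<in>G. matrix_inv A \<in> G) \<and>
     topspace T = G \<and> Hausdorff_space T \<and> second_countable T \<and>
     (\<exists>d. \<forall>A\<in>G. \<exists>V W \<phi>. immersed_param T V W \<phi> \<and> dim V = d \<and> A \<in> \<phi> ` (W \<inter> V)) \<and>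
     (\<forall>V W \<phi> V' W' \<psi>. immersed_param T V W \<phi> \<and> immersed_param T V' W' \<psi> \<longrightarrow>
        smooth_into T ((W \<inter> V) \<times> (W' \<inter> V')) (\<lambda>(p, q). \<phi> p ** \<psi> q)) \<and>
     (\<forall>V W \<phi>. immersed_param T V W \<phi> \<longrightarrow>
        smooth_into T (W \<inter> V) (\<lambda>p. matrix_inv (\<phi> p)))"

text \<open>The tangent space at the identity, as a subspace of the matrix space; the image of \<open>V\<close> under
  the derivative does not depend on the parametrization.\<close>

definition lie_algebra :: "(real ^ 'n ^ 'n) topology \<Rightarrow> (real ^ 'n ^ 'n) set" where
  "lie_algebra T = {X. \<exists>V W \<phi> p. immersed_param T V W \<phi> \<and> p \<in> W \<inter> V \<and> \<phi> p = mat 1 \<and>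
                        X \<in> frechet_derivative \<phi> (at p) ` V}"

definition symmetric_part :: "(real ^ 'n ^ 'n) set \<Rightarrow> (real ^ 'n ^ 'n) set" where
  "symmetric_part \<gg> = {X \<in> \<gg>. transpose X = X}"

definition orthogonal_projection :: "'a::euclidean_space set \<Rightarrow> 'a \<Rightarrow> 'a" where
  "orthogonal_projection V x = (THE p. p \<in> V \<and> (\<forall>v\<in>V. orthogonal (x - p) v))"

text \<open>On \<^typ>\<open>real ^ 'n ^ 'n\<close> the library's inner product is the Frobenius inner product.\<close>

definition conserved_C :: "(real ^ 'n ^ 'n) topology \<Rightarrow> real ^ 'n \<Rightarrow> real ^ 'n ^ 'n" where
  "conserved_C T x =
     orthogonal_projection (symmetric_part (lie_algebra T)) (\<chi> i j. x $ i * x $ j)"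


section \<open>Variational analysis\<close>

definition locally_Lipschitz ::
    "('a::metric_space \<Rightarrow> 'b::metric_space) \<Rightarrow> bool" where
  "locally_Lipschitz f \<longleftrightarrow> (\<forall>x. \<exists>\<epsilon>>0. \<exists>L. L-lipschitz_on (ball x \<epsilon>) f)"

definition regular_subdifferential :: "('a::euclidean_space \<Rightarrow> real) \<Rightarrow> 'a \<Rightarrow> 'a set" where
  "regular_subdifferential f z =
     {v. \<exists>r. r \<in> o[at z](\<lambda>x. norm (x - z)) \<and>
             (\<forall>\<^sub>F x in at z. f x \<ge> f z + v \<bullet> (x - z) + r x)}"

definition subdifferential :: "('a::euclidean_space \<Rightarrow> real) \<Rightarrow> 'a \<Rightarrow> 'a set" where
  "subdifferential f z =
     {v. \<exists>X V. (\<forall>k::nat. V k \<in> regular_subdifferential f (X k)) \<and>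
               X \<longlonglongrightarrow> z \<and> (\<lambda>k. f (X k)) \<longlonglongrightarrow> f z \<and> V \<longlonglongrightarrow> v}"

text \<open>
  The distance to the empty set is \<open>\<infinity>\<close>, whereas \<^const>\<open>infdist\<close> returns 0 there; hence the guard
  \<open>F x \<noteq> {}\<close>. The preimage of \<open>y0\<close> is nonempty because it contains \<open>x0\<close>.
\<close>

definition metrically_subregular ::
    "real \<Rightarrow> ('a::euclidean_space \<Rightarrow> 'b::euclidean_space set) \<Rightarrow> 'a \<Rightarrow> 'b \<Rightarrow> bool" where
  "metrically_subregular \<eta> F x0 y0 \<longleftrightarrow>
     \<eta> > 0 \<and> y0 \<in> F x0 \<and>
     (\<exists>\<kappa>>0. \<exists>r>0. \<forall>x\<in>cball x0 r. F x \<noteq> {} \<longrightarrow>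
        infdist x {z. y0 \<in> F z} \<le> \<kappa> * infdist y0 (F x) powr \<eta>)"

definition subgradient_sequence ::
    "('a::euclidean_space \<Rightarrow> real) \<Rightarrow> real \<Rightarrow> (nat \<Rightarrow> 'a) \<Rightarrow> bool" where
  "subgradient_sequence f \<alpha> X \<longleftrightarrow>
     (\<forall>k. X (Suc k) \<in> {X k - \<alpha> *\<^sub>R v |v. v \<in> subdifferential f (X k)})"

text \<open>The method is set-valued: every sequence it can generate from a generic initial point has to
  leave the ball.\<close>

definition strongly_unstable :: "('a::euclidean_space \<Rightarrow> real) \<Rightarrow> 'a \<Rightarrow> bool" where
  "strongly_unstable f z \<longleftrightarrow>
     (\<exists>\<epsilon>>0. finite {\<alpha>. \<alpha> > 0 \<and>
        \<not> (AE x in lebesgue. x \<in> cball z \<epsilon> \<longrightarrow>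
              (\<forall>X. X 0 = x \<and> subgradient_sequence f \<alpha> X \<longrightarrow> (\<exists>k. X k \<notin> cball z \<epsilon>)))})"

end

theory Submission
  imports Defs "HOL-Computational_Algebra.Polynomial"
begin

text \<open>
  Let \<open>M = G xbar\<close>, a closed set because it is a component of a level set of \<open>f\<close>. A subgradient
  sequence with step size \<open>\<alpha>\<close> that stays in a small ball around \<open>xbar\<close> and never meets \<open>M\<close> cannot exist,
  because two effects contradict each other.

  \<^item> \<^emph>\<open>Conservation.\<close> Since \<open>f\<close> is constant along orbits, a subgradient \<open>v\<close> at \<open>x\<close> is orthogonal to \<open>X
    x\<close> for every \<open>X\<close> in the Lie algebra (\<open>subgradient_orthogonal_to_orbit\<close>). Hence the mixed term in
    \<open>C(x - \<alpha> v)\<close> vanishes and one step adds exactly \<open>\<alpha>\<^sup>2 C(v)\<close> to \<open>C(x)\<close> (\<open>conserved_C_step\<close>). Off \<open>M\<close>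
    the increments have positive inner products with one another, so the square of the norm of
    their sum is at least the sum of the squares of their norms. In a ball \<open>C\<close> is bounded, so the
    increments tend to 0. By compactness, an increment can be small only near \<open>M\<close>; thus the distance
    of the iterates to \<open>M\<close> tends to 0.

  \<^item> \<^emph>\<open>Overshooting.\<close> Subregularity gives \<open>dist x M \<le> \<kappa> |v|\<^sup>\<eta>\<close> for every subgradient \<open>v\<close> at
    \<open>x\<close>. As \<open>\<eta> > 1\<close>, this makes the step length \<open>\<alpha> |v|\<close> much larger than the distance to \<open>M\<close> once that
    distance is small. The step is almost normal to \<open>M\<close>, and \<open>M\<close> is almost flat near \<open>xbar\<close>, so such a
    step lands at least as far from \<open>M\<close> as it started (\<open>step_leaves_orbit\<close>). The distance can then not
    tend to 0.

  The two are combined in \<open>no_trapped_sequence_off_orbit\<close>. There remain the initial points from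
  which some iterate lies in \<open>M\<close>. They belong to the iterated preimages, under the set-valued step,
  of the part of the level set of \<open>xbar\<close> near \<open>xbar\<close>. That part is definable and has no interior, for
  an interior point would be critical and hence lie in \<open>M\<close>, and a closed orbit has no interior. So
  it is null, and the proof is finished by \<open>null_preimages_of_subgradient_step\<close>: for all but
  finitely many \<open>\<alpha>\<close>, preimages of null sets under the step are null.

  O-minimality enters through this nullity and this last result. By Fubini's theorem and induction
  on the dimension, a definable set without interior is null
  (\<open>definable_negligible_if_interior_empty\<close>). From this, every definable function is continuously
  differentiable outside a null closed set (\<open>definable_function_C1\<close>). Applied to \<open>f\<close> and to its
  partial derivatives, this shows that almost everywhere the step is \<open>x \<mapsto> x - \<alpha> \<nabla>f(x)\<close> and has the
  derivative \<open>1 - \<alpha> H\<close> for some matrix \<open>H\<close>. If infinitely many \<open>\<alpha>\<close> were bad, definability would produce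
  an interval of step sizes that are all bad on one common ball, and \<open>1 - \<alpha> H\<close> would be singular for
  a whole interval of \<open>\<alpha>\<close> and a fixed \<open>H\<close>.

  Flatness of \<open>M\<close> (\<open>orbit_flat\<close>, \<open>orbit_map_open_at_identity\<close>) is where the group enters a second time:
  \<open>M\<close> is an immersed image of \<open>G\<close>, and being closed it is embedded, by Baire's theorem.
\<close>

section \<open>Formulas over an o-minimal structure\<close>

locale ominimal =
  fixes S :: "nat \<Rightarrow> real list set set"
  assumes ominimal: "ominimal_structure S"
begin

text \<open>
  The free variables of a formula are the entries of a sequence of reals. Compared with sets of
  lists of a fixed length, this lets formulas in different numbers of variables be combined
  without padding, and a quantified variable can be treated as a de Bruijn index: it is entry 0,
  and the other variables move up by one.
\<close>

definition definable :: "((nat \<Rightarrow> real) \<Rightarrow> bool) \<Rightarrow> bool" where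
  "definable P \<longleftrightarrow> (\<exists>k. \<exists>A\<in>S k. \<forall>e. P e \<longleftrightarrow> map e [0..<k] \<in> A)"

definition definable_term :: "((nat \<Rightarrow> real) \<Rightarrow> real) \<Rightarrow> bool" where
  "definable_term \<tau> \<longleftrightarrow> definable (\<lambda>e. e 0 = \<tau> (\<lambda>i. e (Suc i)))"

lemmas structure_axioms = ominimal[unfolded ominimal_structure_def]

lemma S_length: "A \<in> S k \<Longrightarrow> xs \<in> A \<Longrightarrow> length xs = k"
  using structure_axioms[THEN conjunct1, THEN spec, of k] by blast

lemmas S_UNIV = structure_axioms[THEN conjunct2, THEN conjunct1, rule_format]
lemmas S_compl = structure_axioms[THEN conjunct2, THEN conjunct2, THEN conjunct1, rule_format]
lemmas S_Un = structure_axioms[THEN conjunct2, THEN conjunct2, THEN conjunct2, THEN conjunct1, rule_format]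
lemma S_eq: "i < k \<Longrightarrow> j < k \<Longrightarrow> {xs. length xs = k \<and> xs ! i = xs ! j} \<in> S k"
  using structure_axioms[THEN conjunct2, THEN conjunct2, THEN conjunct2, THEN conjunct2, THEN conjunct1] by blast
lemmas S_append = structure_axioms[THEN conjunct2, THEN conjunct2, THEN conjunct2, THEN conjunct2, THEN conjunct2, THEN conjunct1, rule_format]
lemmas S_Cons = structure_axioms[THEN conjunct2, THEN conjunct2, THEN conjunct2, THEN conjunct2, THEN conjunct2, THEN conjunct2, THEN conjunct1, rule_format]
lemmas S_butlast = structure_axioms[THEN conjunct2, THEN conjunct2, THEN conjunct2, THEN conjunct2, THEN conjunct2, THEN conjunct2, THEN conjunct2, THEN conjunct1, rule_format]
lemmas S_add = structure_axioms[THEN conjunct2, THEN conjunct2, THEN conjunct2, THEN conjunct2, THEN conjunct2, THEN conjunct2, THEN conjunct2, THEN conjunct2, THEN conjunct1, rule_format]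
lemmas S_mult = structure_axioms[THEN conjunct2, THEN conjunct2, THEN conjunct2, THEN conjunct2, THEN conjunct2, THEN conjunct2, THEN conjunct2, THEN conjunct2, THEN conjunct2, THEN conjunct1, rule_format]
lemmas S_1 = structure_axioms[THEN conjunct2, THEN conjunct2, THEN conjunct2, THEN conjunct2, THEN conjunct2, THEN conjunct2, THEN conjunct2, THEN conjunct2, THEN conjunct2, THEN conjunct2, rule_format]

lemma S_Int: "A \<in> S k \<Longrightarrow> B \<in> S k \<Longrightarrow> A \<inter> B \<in> S k"
proof -
  assume A: "A \<in> S k" and B: "B \<in> S k"
  have "A \<inter> B = {xs. length xs = k} - (({xs. length xs = k} - A) \<union> ({xs. length xs = k} - B))"
    using S_length[OF A] S_length[OF B] by blast
  then show ?thesis using A B S_compl S_Un by metis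
qed

lemma definable_more_variables:
  assumes "A \<in> S k"
  shows "\<exists>B\<in>S (k + m). \<forall>e::nat\<Rightarrow>real. map e [0..<k] \<in> A \<longleftrightarrow> map e [0..<k + m] \<in> B"
proof (induction m)
  case (Suc m)
  then obtain B where B: "B \<in> S (k + m)"
    "\<And>e::nat\<Rightarrow>real. map e [0..<k] \<in> A \<longleftrightarrow> map e [0..<k + m] \<in> B" by blast
  show ?case
    using S_append[OF B(1)] B(2)
    by (intro bexI[of _ "{xs @ [t] |xs t. xs \<in> B}"]) auto
qed (use assms in auto)

lemma definable_cong: "(\<And>e. P e \<longleftrightarrow> Q e) \<Longrightarrow> definable P \<longleftrightarrow> definable Q"
  by presburger

lemma definable_not:
  assumes "definable P" shows "definable (\<lambda>e. \<not> P e)"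
proof -
  obtain k A where A: "A \<in> S k" "\<And>e. P e \<longleftrightarrow> map e [0..<k] \<in> A"
    using assms unfolding definable_def by blast
  show ?thesis unfolding definable_def
    using S_compl[OF A(1)] A(2) by (intro exI[of _ k] bexI) auto
qed

lemma definable_conj:
  assumes "definable P" "definable Q" shows "definable (\<lambda>e. P e \<and> Q e)"
proof -
  obtain k A where A: "A \<in> S k" "\<And>e. P e \<longleftrightarrow> map e [0..<k] \<in> A"
    using assms unfolding definable_def by blast
  obtain l B where B: "B \<in> S l" "\<And>e. Q e \<longleftrightarrow> map e [0..<l] \<in> B"
    using assms unfolding definable_def by blast
  obtain A' where A': "A' \<in> S (k + l)" "\<And>e::nat\<Rightarrow>real. map e [0..<k] \<in> A \<longleftrightarrow> map e [0..<k + l] \<in> A'"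
    using definable_more_variables[OF A(1)] by blast
  obtain B' where B': "B' \<in> S (k + l)" "\<And>e::nat\<Rightarrow>real. map e [0..<l] \<in> B \<longleftrightarrow> map e [0..<k + l] \<in> B'"
    using definable_more_variables[OF B(1), of k] by (metis add.commute)
  show ?thesis unfolding definable_def
    using S_Int[OF A'(1) B'(1)] A(2) A'(2) B(2) B'(2) by (intro exI[of _ "k + l"] bexI) auto
qed

lemma definable_disj:
  assumes "definable P" "definable Q" shows "definable (\<lambda>e. P e \<or> Q e)"
  using definable_not[OF definable_conj[OF definable_not[OF assms(1)] definable_not[OF assms(2)]]]
  by simp

lemma definable_imp:
  assumes "definable P" "definable Q" shows "definable (\<lambda>e. P e \<longrightarrow> Q e)"
proof -
  have "(\<lambda>e. P e \<longrightarrow> Q e) = (\<lambda>e. \<not> P e \<or> Q e)" by auto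
  then show ?thesis using definable_disj[OF definable_not[OF assms(1)] assms(2)] by presburger
qed

lemma definable_const: "definable (\<lambda>e. c)"
proof -
  have "{xs. length xs = 0} \<in> S 0" by (rule S_UNIV)
  then have T: "definable (\<lambda>e. True)" unfolding definable_def by (intro exI[of _ 0] bexI) auto
  show ?thesis using T definable_not[OF T] by (cases c) auto
qed

text \<open>
  The axioms allow one coordinate to be added or removed at a time; this lemma and \<open>S_take\<close> iterate
  them.
\<close>

lemma S_suffix: "A \<in> S k \<Longrightarrow> {xs @ ys |xs ys. length xs = m \<and> ys \<in> A} \<in> S (m + k)"
proof (induction m)
  case (Suc m)
  have "{t # xs |xs t. xs \<in> {xs @ ys |xs ys. length xs = m \<and> ys \<in> A}} \<in> S (Suc (m + k))"
    using S_Cons[OF Suc.IH[OF Suc.prems]] .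
  also have "{t # xs |xs t. xs \<in> {xs @ ys |xs ys. length xs = m \<and> ys \<in> A}}
     = {xs @ ys |xs ys. length xs = Suc m \<and> ys \<in> A}" (is "?L = ?R")
  proof
    show "?L \<subseteq> ?R"
    proof
      fix zs assume "zs \<in> ?L"
      then obtain t xs ys where "zs = (t # xs) @ ys" "length xs = m" "ys \<in> A" by auto
      then show "zs \<in> ?R" by (metis (mono_tags, lifting) length_Cons mem_Collect_eq)
    qed
    show "?R \<subseteq> ?L"
    proof
      fix zs assume "zs \<in> ?R"
      then obtain t xs ys where "zs = t # (xs @ ys)" "length xs = m" "ys \<in> A"
        by (auto simp: length_Suc_conv)
      then show "zs \<in> ?L" by blast
    qed
  qed
  finally show ?case by simp
qed simp

lemma S_take: "A \<in> S (k + m) \<Longrightarrow> take k ` A \<in> S k"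
proof (induction m arbitrary: A)
  case 0
  then have "take k ` A = A" using S_length[OF 0] by (force simp: image_iff)
  with 0 show ?case by simp
next
  case (Suc m)
  have "take k ` butlast ` A \<in> S k" using Suc S_butlast by simp
  moreover have "take k (butlast xs) = take k xs" if "xs \<in> A" for xs
    using S_length[OF Suc.prems that] by (simp add: take_butlast)
  then have "take k ` butlast ` A = take k ` A" by (force simp: image_image)
  ultimately show ?case by simp
qed

lemma S_equalities:
  assumes "\<And>j. j < (m::nat) \<Longrightarrow> a j < k \<and> b j < k"
  shows "{xs. length xs = k \<and> (\<forall>j<m. xs ! a j = xs ! b j)} \<in> S k"
  using assms
proof (induction m)
  case 0 then show ?case using S_UNIV by simp
next
  case (Suc m)
  have eq: "{xs. length xs = k \<and> (\<forall>j<Suc m. xs ! a j = xs ! b j)}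
      = {xs. length xs = k \<and> (\<forall>j<m. xs ! a j = xs ! b j)} \<inter> {xs. length xs = k \<and> xs ! a m = xs ! b m}"
    by (auto simp: less_Suc_eq)
  show ?case unfolding eq using Suc by (intro S_Int S_eq) auto
qed

text \<open>
  Substitution of variables is not an axiom. A set \<open>{xs. (xs ! \<sigma> 0, \<dots>, xs ! \<sigma> (m - 1)) \<in> A}\<close> is the
  projection of the set of all \<open>xs @ ys\<close> with \<open>ys \<in> A\<close> whose coordinates satisfy the diagonal
  equations \<open>ys ! j = xs ! \<sigma> j\<close>.
\<close>

lemma definable_rename:
  assumes "definable P" shows "definable (\<lambda>e. P (\<lambda>i. e (\<sigma> i)))"
proof -
  obtain m A where A: "A \<in> S m" "\<And>e. P e \<longleftrightarrow> map e [0..<m] \<in> A"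
    using assms unfolding definable_def by blast
  define k where "k = Suc (Max (insert 0 (\<sigma> ` {..<m})))"
  have k: "\<sigma> i < k" if "i < m" for i
    unfolding k_def using that by (auto simp: less_Suc_eq_le intro!: Max_ge)
  define B where "B = {xs @ ys |xs ys. length xs = k \<and> ys \<in> A}
      \<inter> {xs. length xs = k + m \<and> (\<forall>j<m. xs ! (k + j) = xs ! \<sigma> j)}"
  have "B \<in> S (k + m)"
    unfolding B_def
    by (intro S_Int S_suffix A S_equalities) (use k in \<open>auto intro: trans_less_add1\<close>)
  then have *: "take k ` B \<in> S k" by (rule S_take)
  have "P (\<lambda>i. e (\<sigma> i)) \<longleftrightarrow> map e [0..<k] \<in> take k ` B" for e
  proof
    assume "P (\<lambda>i. e (\<sigma> i))"
    then have a: "map (\<lambda>i. e (\<sigma> i)) [0..<m] \<in> A" using A(2) by blast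
    have "map e [0..<k] @ map (\<lambda>i. e (\<sigma> i)) [0..<m] \<in> {xs @ ys |xs ys. length xs = k \<and> ys \<in> A}"
      using a by (intro CollectI exI[of _ "map e [0..<k]"] exI[of _ "map (\<lambda>i. e (\<sigma> i)) [0..<m]"]) simp
    then have "map e [0..<k] @ map (\<lambda>i. e (\<sigma> i)) [0..<m] \<in> B"
      unfolding B_def using k by (auto simp: nth_append)
    then show "map e [0..<k] \<in> take k ` B" by (force simp: image_iff)
  next
    assume "map e [0..<k] \<in> take k ` B"
    then obtain zs where zs: "zs \<in> B" "map e [0..<k] = take k zs" by blast
    from zs(1) obtain xs ys where ys: "length xs = k" "ys \<in> A" "zs = xs @ ys"
      unfolding B_def by blast
    have eq: "zs ! (k + j) = zs ! \<sigma> j" if "j < m" for j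
      using zs(1) that unfolding B_def by blast
    have "zs ! \<sigma> j = e (\<sigma> j)" if "j < m" for j
      using arg_cong[OF zs(2), of "\<lambda>l. l ! \<sigma> j"] k[OF that] by simp
    then have "ys = map (\<lambda>i. e (\<sigma> i)) [0..<m]"
      using eq S_length[OF A(1) ys(2)] ys by (intro nth_equalityI) (auto simp: nth_append)
    with ys(2) show "P (\<lambda>i. e (\<sigma> i))" using A(2) by blast
  qed
  with * show ?thesis unfolding definable_def by blast
qed

text \<open>
  Only the last coordinate can be projected away, so the quantified variable is first renamed from
  position 0 to the position after all other relevant variables.
\<close>

lemma definable_ex_aux:
  assumes "definable P" shows "definable (\<lambda>e. \<exists>t. P (case_nat t e))"
proof -
  obtain k0 A0 where A0: "A0 \<in> S k0" "\<And>e. P e \<longleftrightarrow> map e [0..<k0] \<in> A0"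
    using assms unfolding definable_def by blast
  define Q where "Q = (\<lambda>e. P (\<lambda>i. e (if i = 0 then k0 else i - 1)))"
  have Q0: "\<And>e e'. (\<And>i. i \<le> k0 \<Longrightarrow> e i = e' i) \<Longrightarrow> Q e = Q e'"
  proof -
    fix e e' :: "nat \<Rightarrow> real" assume "\<And>i. i \<le> k0 \<Longrightarrow> e i = e' i"
    then have "map (\<lambda>i. e (if i = 0 then k0 else i - 1)) [0..<k0] = map (\<lambda>i. e' (if i = 0 then k0 else i - 1)) [0..<k0]"
      by auto
    then show "Q e = Q e'" unfolding Q_def A0(2) by (rule arg_cong)
  qed
  have "definable Q" unfolding Q_def by (rule definable_rename[OF assms])
  then obtain k1 A1 where A1: "A1 \<in> S k1" "\<And>e. Q e \<longleftrightarrow> map e [0..<k1] \<in> A1"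
    unfolding definable_def by blast
  obtain A where A: "A \<in> S (Suc k0 + k1)" "\<And>e. Q e \<longleftrightarrow> map e [0..<Suc k0 + k1] \<in> A"
    using definable_more_variables[OF A1(1), of "Suc k0"] A1(2) by (metis add.commute)
  have B: "take k0 ` A \<in> S k0" using S_take[of A k0 "Suc k1"] A(1) by simp
  have "(\<exists>t. P (case_nat t e)) \<longleftrightarrow> map e [0..<k0] \<in> take k0 ` A" for e
  proof
    assume "\<exists>t. P (case_nat t e)"
    then obtain t where t: "P (case_nat t e)" by blast
    have "(\<lambda>i. (e(k0 := t)) (if i = 0 then k0 else i - 1)) i = case_nat t e i" if "i < k0" for i
      using that by (cases i) auto
    then have "map (\<lambda>i. (e(k0 := t)) (if i = 0 then k0 else i - 1)) [0..<k0] = map (case_nat t e) [0..<k0]"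
      by (intro map_cong) auto
    then have "Q (e(k0 := t))" unfolding Q_def A0(2) using t[unfolded A0(2)] by (rule ssubst)
    then have "map (e(k0 := t)) [0..<Suc k0 + k1] \<in> A" using A(2) by blast
    moreover have "take k0 (map (e(k0 := t)) [0..<Suc k0 + k1]) = map e [0..<k0]"
      by (auto simp: take_map simp del: upt_Suc)
    ultimately show "map e [0..<k0] \<in> take k0 ` A" by (metis imageI)
  next
    assume "map e [0..<k0] \<in> take k0 ` A"
    then obtain xs where xs: "xs \<in> A" "take k0 xs = map e [0..<k0]" by auto
    have len: "length xs = Suc k0 + k1" using S_length[OF A(1) xs(1)] .
    have "map (nth xs) [0..<Suc k0 + k1] = xs" using len by (metis map_nth)
    then have q: "Q (nth xs)" using A(2) xs(1) by metis
    have "xs ! i = e i" if "i < k0" for i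
      using arg_cong[OF xs(2), of "\<lambda>l. l ! i"] that len by simp
    then have "Q (e(k0 := xs ! k0))" using q Q0[of "e(k0 := xs ! k0)" "nth xs"] by auto
    moreover have "(\<lambda>i. (e(k0 := xs ! k0)) (if i = 0 then k0 else i - 1)) i = case_nat (xs ! k0) e i" if "i < k0" for i
      using that by (cases i) auto
    then have "map (\<lambda>i. (e(k0 := xs ! k0)) (if i = 0 then k0 else i - 1)) [0..<k0] = map (case_nat (xs ! k0) e) [0..<k0]"
      by (intro map_cong) auto
    ultimately show "\<exists>t. P (case_nat t e)" unfolding Q_def A0(2) by metis
  qed
  with B show ?thesis unfolding definable_def by blast
qed

text \<open>
  In this form, and together with the other closure properties (collected in \<open>definable_intros\<close>
  below), the quantifier rule lets the definability of a formula be proved by rules that follow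
  its syntax.
\<close>

lemma definable_ex:
  assumes "definable (\<lambda>e. Q (\<lambda>i. e (Suc i)) (e 0))" shows "definable (\<lambda>e. \<exists>t. Q e t)"
  using definable_ex_aux[OF assms] by simp

lemma definable_all:
  assumes "definable (\<lambda>e. Q (\<lambda>i. e (Suc i)) (e 0))" shows "definable (\<lambda>e. \<forall>t. Q e t)"
  using definable_not[OF definable_ex[of "\<lambda>e t. \<not> Q e t", OF definable_not[OF assms]]] by simp

lemma definable_ball_less:
  assumes "\<And>i. i < (m::nat) \<Longrightarrow> definable (P i)" shows "definable (\<lambda>e. \<forall>i<m. P i e)"
  using assms
proof (induction m)
  case (Suc m)
  have "definable (\<lambda>e. (\<forall>i<m. P i e) \<and> P m e)" using Suc by (intro definable_conj) auto
  then show ?case by (rule iffD1[OF definable_cong, rotated]) (auto simp: less_Suc_eq)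
qed (simp add: definable_const)

lemma definable_all_finite:
  assumes "\<And>i::'i::finite. definable (P i)" shows "definable (\<lambda>e. \<forall>i. P i e)"
proof -
  have "definable (\<lambda>e. \<forall>i\<in>I. P i e)" if "finite I" for I
    using that
  proof induction
    case (insert i I)
    then show ?case using definable_conj[OF assms[of i] insert.IH] by simp
  qed (simp add: definable_const)
  from this[of UNIV] show ?thesis by simp
qed

definition prepend :: "nat \<Rightarrow> (nat \<Rightarrow> real) \<Rightarrow> (nat \<Rightarrow> real) \<Rightarrow> nat \<Rightarrow> real" where
  "prepend k y e = (\<lambda>i. if i < k then y i else e (i - k))"

lemma definable_ex_many:
  assumes "definable P" shows "definable (\<lambda>e. \<exists>y. P (prepend k y e))"
  using assms
proof (induction k arbitrary: P)
  case 0 then show ?case by (simp add: prepend_def)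
next
  case (Suc k)
  have "definable (\<lambda>e. \<exists>y. \<exists>t. P (case_nat t (prepend k y e)))"
    using Suc.IH[OF definable_ex_aux[OF Suc.prems]] .
  moreover have "(\<exists>y t. P (case_nat t (prepend k y e))) \<longleftrightarrow> (\<exists>y. P (prepend (Suc k) y e))" for e
  proof
    assume "\<exists>y t. P (case_nat t (prepend k y e))"
    then obtain y t where "P (case_nat t (prepend k y e))" by blast
    moreover have "case_nat t (prepend k y e) = prepend (Suc k) (case_nat t y) e"
      by (auto simp: prepend_def fun_eq_iff split: nat.splits)
    ultimately show "\<exists>y. P (prepend (Suc k) y e)" by metis
  next
    assume "\<exists>y. P (prepend (Suc k) y e)"
    then obtain y where "P (prepend (Suc k) y e)" by blast
    moreover have "prepend (Suc k) y e = case_nat (y 0) (prepend k (\<lambda>i. y (Suc i)) e)"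
      by (auto simp: prepend_def fun_eq_iff split: nat.splits)
    ultimately show "\<exists>y t. P (case_nat t (prepend k y e))" by metis
  qed
  ultimately show ?case by simp
qed

lemma definable_finite_dependence:
  assumes "definable P" obtains k where "\<And>e e'. (\<And>i. i < k \<Longrightarrow> e i = e' i) \<Longrightarrow> P e = P e'"
proof -
  obtain k A where A: "A \<in> S k" "\<And>e. P e \<longleftrightarrow> map e [0..<k] \<in> A"
    using assms unfolding definable_def by blast
  have "P e = P e'" if "\<And>i. i < k \<Longrightarrow> e i = e' i" for e e'
  proof -
    have "map e [0..<k] = map e' [0..<k]" using that by auto
    then show ?thesis unfolding A(2) by (rule arg_cong)
  qed
  then show thesis using that by blast
qed

lemma definable_term_eq:
  assumes "definable_term \<tau>"
  shows "definable (\<lambda>e. e i = \<tau> (\<lambda>j. e (j + k)))"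
  using definable_rename[OF assms[unfolded definable_term_def], of "case_nat i (\<lambda>j. j + k)"] by simp

text \<open>
  Terms are substituted for variables by quantifying over their values, which is possible because
  only finitely many of them matter.
\<close>

lemma definable_subst:
  assumes P: "definable P" and \<tau>: "\<And>i. definable_term (\<tau> i)"
  shows "definable (\<lambda>e. P (\<lambda>i. \<tau> i e))"
proof -
  obtain k where k: "\<And>e e'. (\<And>i. i < k \<Longrightarrow> e i = e' i) \<Longrightarrow> P e = P e'"
    using definable_finite_dependence[OF P] by blast
  have "definable (\<lambda>e. (\<forall>i<k. e i = \<tau> i (\<lambda>j. e (j + k))) \<and> P e)"
    by (intro definable_conj definable_ball_less definable_term_eq \<tau> P)
  from definable_ex_many[OF this, of k] show ?thesis
  proof (rule iffD1[OF definable_cong, rotated])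
    fix e
    have sh: "(\<lambda>j. prepend k y e (j + k)) = e" for y by (simp add: prepend_def)
    show "(\<exists>y. (\<forall>i<k. prepend k y e i = \<tau> i (\<lambda>j. prepend k y e (j + k))) \<and> P (prepend k y e)) = P (\<lambda>i. \<tau> i e)"
      unfolding sh
    proof
      assume "\<exists>y. (\<forall>i<k. prepend k y e i = \<tau> i e) \<and> P (prepend k y e)"
      then show "P (\<lambda>i. \<tau> i e)" using k by metis
    next
      assume "P (\<lambda>i. \<tau> i e)"
      moreover have "prepend k (\<lambda>i. \<tau> i e) e i = \<tau> i e" if "i < k" for i
        using that by (simp add: prepend_def)
      ultimately show "\<exists>y. (\<forall>i<k. prepend k y e i = \<tau> i e) \<and> P (prepend k y e)" using k by metis
    qed
  qed
qed

lemma definable_term_var: "definable_term (\<lambda>e. e i)"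
proof -
  have *: "{xs. length xs = Suc (Suc i) \<and> xs ! 0 = xs ! Suc i} \<in> S (Suc (Suc i))"
    by (rule S_eq) auto
  show ?thesis unfolding definable_term_def definable_def
    by (intro exI[of _ "Suc (Suc i)"] bexI[OF _ *]) (auto simp: nth_append simp del: upt_Suc)
qed

lemma definable_one_variable_set:
  assumes "open I \<and> is_interval I \<or> I = {c}" shows "definable (\<lambda>e. e 0 \<in> (I::real set))"
proof -
  have "(\<lambda>t. [t]) ` I \<in> S 1" unfolding S_1 using assms
    by (auto intro!: exI[of _ "{I}"])
  then show ?thesis unfolding definable_def
    by (intro exI[of _ 1] bexI) auto
qed

lemma definable_term_const: "definable_term (\<lambda>e. c)"
  unfolding definable_term_def using definable_one_variable_set[of "{c}" c] by simp

lemma definable_term_compose: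
  assumes "definable_term \<tau>" "\<And>i. definable_term (\<sigma> i)"
  shows "definable_term (\<lambda>e. \<tau> (\<lambda>i. \<sigma> i e))"
proof -
  have s: "definable_term (\<lambda>e. case_nat (e 0) (\<lambda>i. \<sigma> i (\<lambda>i. e (Suc i))) j)" for j
  proof (cases j)
    case 0 then show ?thesis using definable_term_var by simp
  next
    case (Suc i)
    show ?thesis unfolding definable_term_def
      using definable_rename[OF assms(2)[of i, unfolded definable_term_def], of "case_nat 0 (\<lambda>j. Suc (Suc j))"] Suc
      by simp
  qed
  show ?thesis
    unfolding definable_term_def
    using definable_subst[OF assms(1)[unfolded definable_term_def], of "\<lambda>j e. case_nat (e 0) (\<lambda>i. \<sigma> i (\<lambda>i. e (Suc i))) j", OF s] by simp
qed

lemma definable_term_binary: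
  assumes "{[a, b, h a b] |a b. True} \<in> S 3" "definable_term \<tau>" "definable_term \<sigma>"
  shows "definable_term (\<lambda>e. h (\<tau> e) (\<sigma> e))"
proof -
  have "definable (\<lambda>e. e 2 = h (e 0) (e 1))"
    unfolding definable_def
    by (intro exI[of _ 3] bexI[OF _ assms(1)]) (auto simp: numeral_3_eq_3 numeral_2_eq_2)
  from definable_rename[OF this, of "\<lambda>i. if i = 2 then 0 else Suc i"]
  have "definable_term (\<lambda>e. h (e 0) (e 1))"
    unfolding definable_term_def by simp
  from definable_term_compose[OF this, of "\<lambda>i. if i = 0 then \<tau> else \<sigma>"] assms show ?thesis
    by simp
qed

lemmas definable_term_add = definable_term_binary[OF S_add]
lemmas definable_term_mult = definable_term_binary[OF S_mult]

lemma definable_eq: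
  assumes "definable_term \<tau>" "definable_term \<sigma>" shows "definable (\<lambda>e. \<tau> e = \<sigma> e)"
  using definable_subst[OF definable_term_var[of 0, unfolded definable_term_def],
    of "\<lambda>i. if i = 0 then \<tau> else \<sigma>"] assms by simp

lemma definable_term_minus:
  assumes "definable_term \<tau>" "definable_term \<sigma>" shows "definable_term (\<lambda>e. \<tau> e - \<sigma> e)"
proof -
  have "definable_term (\<lambda>e. \<tau> e + (-1) * \<sigma> e)"
    by (intro definable_term_add definable_term_mult definable_term_const assms)
  then show ?thesis by simp
qed

lemma definable_less:
  assumes "definable_term \<tau>" "definable_term \<sigma>" shows "definable (\<lambda>e. \<tau> e < \<sigma> e)"
proof -
  have "definable (\<lambda>e. e 0 \<in> {0::real<..})"
    by (rule definable_one_variable_set) (auto simp: is_interval_def)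
  from definable_subst[OF this, of "\<lambda>i e. \<sigma> e - \<tau> e"] show ?thesis
    using definable_term_minus[OF assms(2,1)] by simp
qed

lemma definable_le:
  assumes "definable_term \<tau>" "definable_term \<sigma>" shows "definable (\<lambda>e. \<tau> e \<le> \<sigma> e)"
  using definable_not[OF definable_less[OF assms(2,1)]] by (simp add: not_less)

lemma definable_term_sum:
  assumes "\<And>i. i \<in> I \<Longrightarrow> definable_term (\<tau> i)" shows "definable_term (\<lambda>e. \<Sum>i\<in>I. \<tau> i e)"
  using assms
proof (induction I rule: infinite_finite_induct)
  case (insert i I)
  then show ?case by (simp add: definable_term_add)
qed (auto intro: definable_term_const)

lemma definable_termI:
  assumes "definable (\<lambda>e. Q (\<lambda>i. e (Suc i)) (e 0))" "\<And>e t. Q e t \<longleftrightarrow> t = \<tau> e"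
  shows "definable_term \<tau>"
  using assms unfolding definable_term_def by simp

lemma S_if_definable:
  assumes P: "definable P" and k: "\<And>e e'. (\<And>i. i < k \<Longrightarrow> e i = e' i) \<Longrightarrow> P e = P e'"
  shows "{map e [0..<k] |e. P e} \<in> S k"
proof -
  obtain l A where A: "A \<in> S l" "\<And>e. P e \<longleftrightarrow> map e [0..<l] \<in> A"
    using P unfolding definable_def by blast
  obtain B where B: "B \<in> S (k + l)" "\<And>e. P e \<longleftrightarrow> map e [0..<k + l] \<in> B"
    using definable_more_variables[OF A(1), of k] A(2) by (metis add.commute)
  have "{map e [0..<k] |e. P e} = take k ` B"
  proof (intro equalityI subsetI)
    fix xs assume "xs \<in> {map e [0..<k] |e. P e}"
    then obtain e where e: "xs = map e [0..<k]" "P e" by blast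
    then have "map e [0..<k + l] \<in> B" using B by blast
    moreover have "take k (map e [0..<k + l]) = xs" using e by (simp add: take_map)
    ultimately show "xs \<in> take k ` B" by (metis imageI)
  next
    fix xs assume "xs \<in> take k ` B"
    then obtain ys where ys: "ys \<in> B" "xs = take k ys" by blast
    have len: "length ys = k + l" using S_length[OF B(1) ys(1)] .
    have "map (nth ys) [0..<k + l] = ys" using len by (metis map_nth)
    then have "P (nth ys)" using B(2) ys(1) by metis
    moreover have "xs = map (nth ys) [0..<k]"
      using ys(2) len by (intro nth_equalityI) auto
    ultimately show "xs \<in> {map e [0..<k] |e. P e}" by blast
  qed
  then show ?thesis using S_take[OF B(1)] by simp
qed

text \<open>
  The sets that the last axiom of o-minimality prescribes in dimension one.
\<close>

definition tame :: "real set \<Rightarrow> bool" where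
  "tame A \<longleftrightarrow> (\<exists>\<I>. finite \<I> \<and> A = \<Union>\<I> \<and> (\<forall>I\<in>\<I>. (\<exists>a. I = {a}) \<or> (open I \<and> is_interval I)))"

text \<open>
  Every real constant is definable, so a definable set may be cut along a coordinate line through
  an arbitrary point.
\<close>

lemma tame_definable_slice:
  assumes "definable P" shows "tame {t. P (c(i := t))}"
proof -
  have "definable (\<lambda>e. P (\<lambda>j. if j = i then e 0 else c j))"
  proof (rule definable_subst[OF assms])
    show "definable_term (\<lambda>e. if j = i then e 0 else c j)" for j
      by (cases "j = i") (simp_all add: definable_term_var definable_term_const)
  qed
  then have "definable (\<lambda>e. P (c(i := e 0)))" unfolding fun_upd_def .
  then have "{map e [0..<1] |e. P (c(i := e 0))} \<in> S 1" by (rule S_if_definable) auto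
  moreover have "{map e [0..<1] |e. P (c(i := e 0))} = (\<lambda>t. [t]) ` {t. P (c(i := t))}"
    by (auto intro: exI[of _ "\<lambda>_. _"])
  ultimately obtain \<I> where "(\<lambda>t. [t]) ` {t. P (c(i := t))} = (\<lambda>t. [t]) ` \<Union>\<I>" "finite \<I>"
      "\<forall>I\<in>\<I>. (\<exists>a. I = {a}) \<or> (open I \<and> is_interval I)"
    unfolding S_1 by auto
  then show ?thesis unfolding tame_def by (auto simp: inj_image_eq_iff inj_def)
qed

lemma tame_infinite_interval:
  assumes "tame A" "infinite A" obtains a b where "a < b" "{a<..<b} \<subseteq> A"
proof -
  obtain \<I> where \<I>: "finite \<I>" "A = \<Union>\<I>" "\<forall>I\<in>\<I>. (\<exists>a. I = {a}) \<or> (open I \<and> is_interval I)"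
    using assms(1) unfolding tame_def by blast
  then obtain I where I: "I \<in> \<I>" "infinite I" using assms(2) by blast
  then have "open I" "I \<noteq> {}" using \<I> by auto
  then obtain x e where "e > 0" "ball x e \<subseteq> I" by (meson open_contains_ball ex_in_conv)
  then show thesis using that[of "x - e" "x + e"] I \<I> by (force simp: ball_eq_greaterThanLessThan)
qed

text \<open>
  Why one-sided limits in one variable are never oscillating: near \<open>a\<close>, on the right, a tame
  condition is either always or never satisfied.
\<close>

lemma tame_eventually:
  assumes "tame A"
  shows "\<exists>b>a. {a<..<b} \<subseteq> A \<or> {a<..<b} \<inter> A = {}"
proof -
  obtain \<I> where \<I>: "finite \<I>" "A = \<Union>\<I>" "\<forall>I\<in>\<I>. (\<exists>a. I = {a}) \<or> (open I \<and> is_interval I)"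
    using assms unfolding tame_def by blast
  show ?thesis unfolding \<I>(2) using \<I>(1,3)
  proof (induction \<I>)
    case empty show ?case by (intro exI[of _ "a+1"]) auto
  next
    case (insert I \<I>)
    then obtain b where b: "b > a" "{a<..<b} \<subseteq> \<Union>\<I> \<or> {a<..<b} \<inter> \<Union>\<I> = {}" by auto
    have "\<exists>b'>a. {a<..<b'} \<subseteq> I \<or> {a<..<b'} \<inter> I = {}"
    proof (cases "\<exists>c. I = {c}")
      case True
      then obtain c where "I = {c}" by blast
      then show ?thesis by (intro exI[of _ "if c > a then c else a + 1"]) auto
    next
      case False
      then have I: "is_interval I" using insert.prems by auto
      show ?thesis
      proof (cases "\<forall>b'>a. {a<..<b'} \<inter> I \<noteq> {}")
        case True
        then obtain b' where b': "b' \<in> {a<..<a+1} \<inter> I" by (metis ex_in_conv less_add_one)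
        have "t \<in> I" if t: "t \<in> {a<..<b'}" for t
        proof -
          obtain s where "s \<in> {a<..<t} \<inter> I" using True t by fastforce
          then show ?thesis using I b' t
            by (metis IntD1 IntD2 greaterThanLessThan_iff less_eq_real_def mem_is_interval_1_I)
        qed
        then show ?thesis using b' by (intro exI[of _ b']) auto
      qed blast
    qed
    then obtain b' where b': "b' > a" "{a<..<b'} \<subseteq> I \<or> {a<..<b'} \<inter> I = {}" by blast
    have "{a<..<min b b'} \<subseteq> {a<..<b}" "{a<..<min b b'} \<subseteq> {a<..<b'}" by auto
    then have "{a<..<min b b'} \<subseteq> \<Union>(insert I \<I>) \<or> {a<..<min b b'} \<inter> \<Union>(insert I \<I>) = {}"
      using b(2) b'(2) by auto
    then show ?case using b(1) b'(1) by (intro exI[of _ "min b b'"]) auto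
  qed
qed

text \<open>
  The substitute for uniform estimates: an assertion that holds at each point of an interval with
  a constant from a countable range holds on some subinterval with one and the same constant.
  Otherwise each member of the cover would be finite and the interval countable.
\<close>

lemma tame_cover_interval:
  fixes A :: "'i \<Rightarrow> real set"
  assumes "a < b" "countable I" "{a<..<b} \<subseteq> (\<Union>i\<in>I. A i)" "\<And>i. i \<in> I \<Longrightarrow> tame (A i \<inter> {a<..<b})"
  obtains i c d where "i \<in> I" "c < d" "{c<..<d} \<subseteq> A i" "{c<..<d} \<subseteq> {a<..<b}"
proof -
  have "\<exists>i\<in>I. infinite (A i \<inter> {a<..<b})"
  proof (rule ccontr)
    assume "\<not> ?thesis"
    then have count: "countable (\<Union>i\<in>I. A i \<inter> {a<..<b})"
      using assms(2) by (intro countable_UN) (auto intro: countable_finite)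
    have "(\<Union>i\<in>I. A i \<inter> {a<..<b}) = {a<..<b}" using assms(3) by blast
    from count[unfolded this] show False using uncountable_open_interval[of a b] assms(1) by blast
  qed
  then obtain i where i: "i \<in> I" "infinite (A i \<inter> {a<..<b})" by blast
  obtain c d where "c < d" "{c<..<d} \<subseteq> A i \<inter> {a<..<b}"
    using tame_infinite_interval[OF assms(4)[OF i(1)] i(2)] .
  then show thesis using i that by auto
qed

end

section \<open>Definable sets without interior are null\<close>

abbreviation product_lborel :: "nat \<Rightarrow> (nat \<Rightarrow> real) measure" where
  "product_lborel k \<equiv> Pi\<^sub>M {..<k} (\<lambda>_. lborel)"

interpretation lborel_product: product_sigma_finite "\<lambda>_::nat. lborel :: real measure"
  by standard

text \<open>
  Fubini's theorem, with the last coordinate integrated first.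
\<close>

lemma null_set_if_slices_finite:
  assumes E: "E \<in> sets (product_lborel (Suc k))" and N: "N \<in> null_sets (product_lborel k)"
    and fin: "\<And>x. x \<in> space (product_lborel k) - N \<Longrightarrow> finite {t. x(k := t) \<in> E}"
  shows "E \<in> null_sets (product_lborel (Suc k))"
proof -
  have E': "E \<in> sets (Pi\<^sub>M (insert k {..<k}) (\<lambda>_. lborel))" using E by (simp add: lessThan_Suc)
  have "emeasure (product_lborel (Suc k)) E = (\<integral>\<^sup>+x. indicator E x \<partial>product_lborel (Suc k))"
    using E by simp
  also have "\<dots> = (\<integral>\<^sup>+x. (\<integral>\<^sup>+t. indicator E (x(k := t)) \<partial>lborel) \<partial>product_lborel k)"
    unfolding lessThan_Suc
    by (subst lborel_product.product_nn_integral_insert) (use E' in auto)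
  also have "\<dots> = (\<integral>\<^sup>+x. 0 \<partial>product_lborel k)"
  proof (rule nn_integral_cong_AE)
    have "AE x in product_lborel k. x \<notin> N" using N by (rule AE_not_in)
    then show "AE x in product_lborel k. (\<integral>\<^sup>+t. indicator E (x(k := t)) \<partial>lborel) = 0"
      using AE_space
    proof (eventually_elim)
      case (elim x)
      then have "{t. x(k := t) \<in> E} \<in> null_sets lborel"
        using fin[of x] by (auto intro: countable_imp_null_set_lborel countable_finite)
      from AE_not_in[OF this] have "AE t in lborel. indicator E (x(k := t)) = (0::ennreal)"
        by eventually_elim simp
      then have "(\<integral>\<^sup>+t. indicator E (x(k := t)) \<partial>lborel) = (\<integral>\<^sup>+t. 0 \<partial>(lborel :: real measure))"
        by (rule nn_integral_cong_AE)
      then show ?case by simp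
    qed
  qed
  finally have "emeasure (product_lborel (Suc k)) E = 0" by simp
  then show ?thesis using E by auto
qed

definition depends_on_first :: "nat \<Rightarrow> ((nat \<Rightarrow> real) \<Rightarrow> bool) \<Rightarrow> bool" where
  "depends_on_first k P \<longleftrightarrow> (\<forall>e e'. (\<forall>i<k. e i = e' i) \<longrightarrow> P e = P e')"

text \<open>
  Nonempty interior, for sets of sequences whose first \<open>k\<close> entries matter. The induction on the
  dimension needs sequences, as the dimension of a type of vectors is fixed.
\<close>

definition contains_box :: "nat \<Rightarrow> ((nat \<Rightarrow> real) \<Rightarrow> bool) \<Rightarrow> bool" where
  "contains_box k P \<longleftrightarrow> (\<exists>a b. (\<forall>i<k. a i < b i) \<and> (\<forall>x. (\<forall>i<k. a i < x i \<and> x i < b i) \<longrightarrow> P x))"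

text \<open>
  Phrased with a cover, since measurability of definable sets is not known beforehand but is
  obtained along with nullity.
\<close>

definition null_cover :: "nat \<Rightarrow> ((nat \<Rightarrow> real) \<Rightarrow> bool) \<Rightarrow> bool" where
  "null_cover k P \<longleftrightarrow> (\<exists>N\<in>null_sets (product_lborel k). \<forall>x\<in>space (product_lborel k). P x \<longrightarrow> x \<in> N)"

context ominimal
begin

lemma definable_term_uminus: "definable_term \<tau> \<Longrightarrow> definable_term (\<lambda>e. - \<tau> e)"
  using definable_term_minus[OF definable_term_const[of 0]] by simp

lemma definable_sup_dist_less:
  "definable (\<lambda>e. \<forall>i<k. \<bar>e i - e (i + k)\<bar> < e (2 * k))"
  unfolding abs_less_iff
  by (intro definable_ball_less definable_conj definable_less definable_term_uminus
      definable_term_minus definable_term_var)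

text \<open>
  The points of a definable set that are not interior to it form a definable set without interior.
  If such sets are null, every definable set is therefore open up to a null set.
\<close>

lemma almost_Borel_if_null_cover:
  assumes IH: "\<And>P. definable P \<Longrightarrow> depends_on_first k P \<Longrightarrow> \<not> contains_box k P \<Longrightarrow> null_cover k P"
    and P: "definable P" "depends_on_first k P"
  obtains B N where "B \<in> sets (product_lborel k)" "N \<in> null_sets (product_lborel k)"
    "\<And>x. x \<in> space (product_lborel k) - N \<Longrightarrow> P x \<longleftrightarrow> x \<in> B"
proof -
  define inbox where "inbox = (\<lambda>a b x. \<forall>i<k. a i < x i \<and> x i < (b i::real))"
  \<comment> \<open>the points of \<open>P\<close> that are not interior\<close>
  define P' where "P' = (\<lambda>e. P e \<and> \<not> (\<exists>\<delta>>0. \<forall>y. (\<forall>i<k. \<bar>y i - e i\<bar> < \<delta>) \<longrightarrow> P y))"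
  have pre: "prepend k y e i = y i" "prepend k y e (i + k) = e i" if "i < k" for i y e
    using that by (auto simp: prepend_def)
  have "definable (\<lambda>e. \<exists>y. \<not> ((\<forall>i<k. \<bar>prepend k y e i - prepend k y e (i + k)\<bar> < prepend k y e (2 * k)) \<longrightarrow> P (prepend k y e)))"
    by (intro definable_ex_many definable_not definable_imp definable_sup_dist_less P)
  moreover have "(\<forall>i<k. \<bar>prepend k y e i - prepend k y e (i + k)\<bar> < prepend k y e (2 * k))
       = (\<forall>i<k. \<bar>y i - e i\<bar> < e k)" "P (prepend k y e) = P y" for y e
    using P(2) pre by (auto simp: depends_on_first_def prepend_def)
  ultimately have *: "definable (\<lambda>e. \<not> (\<forall>y. (\<forall>i<k. \<bar>y i - e i\<bar> < e k) \<longrightarrow> P y))" by simp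
  have "definable (\<lambda>e. (\<forall>y. (\<forall>i<k. \<bar>y i - e (Suc i)\<bar> < e 0) \<longrightarrow> P y))"
  proof -
    have "(\<forall>i<k. \<bar>y i - e (if i = k then 0 else Suc i)\<bar> < e (if k = k then 0 else Suc k))
        = (\<forall>i<k. \<bar>y i - e (Suc i)\<bar> < e 0)" for y e :: "nat \<Rightarrow> real" by auto
    then show ?thesis
      using definable_rename[OF definable_not[OF *], of "\<lambda>i. if i = k then 0 else Suc i"]
      by (simp only: not_not)
  qed
  then have "definable (\<lambda>e. \<exists>\<delta>>0. \<forall>y. (\<forall>i<k. \<bar>y i - e i\<bar> < \<delta>) \<longrightarrow> P y)"
    by (intro definable_ex definable_conj definable_less definable_term_var definable_term_const)
  then have "definable P'" unfolding P'_def by (intro definable_conj P definable_not)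
  moreover have "depends_on_first k P'"
    using P(2) unfolding depends_on_first_def P'_def by (metis (no_types, lifting))
  moreover have "\<not> contains_box k P'"
  proof
    assume "contains_box k P'"
    then obtain a b where ab: "\<And>i. i < k \<Longrightarrow> a i < b i"
      "\<And>x. (\<And>i. i < k \<Longrightarrow> a i < x i \<and> x i < b i) \<Longrightarrow> P' x"
      unfolding contains_box_def by auto
    define x where "x = (\<lambda>i. (a i + b i) / 2)"
    define \<delta> where "\<delta> = Min (insert 1 ((\<lambda>i. (b i - a i) / 2) ` {..<k}))"
    have "\<delta> > 0" unfolding \<delta>_def using ab(1) by simp
    have \<delta>: "\<delta> \<le> (b i - a i) / 2" if "i < k" for i
      unfolding \<delta>_def using that by (intro Min_le) auto
    have "P y" if y: "\<forall>i<k. \<bar>y i - x i\<bar> < \<delta>" for y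
    proof -
      have "a i < y i \<and> y i < b i" if "i < k" for i
        using y[rule_format, OF that] \<delta>[OF that] unfolding x_def by (auto simp: abs_less_iff field_simps)
      then show ?thesis using ab(2) unfolding P'_def by blast
    qed
    moreover have "P' x" using ab unfolding x_def by (intro ab(2)) (auto simp: field_simps)
    ultimately show False using \<open>\<delta> > 0\<close> unfolding P'_def by blast
  qed
  ultimately have "null_cover k P'" by (rule IH)
  then obtain N where N: "N \<in> null_sets (product_lborel k)"
    "\<And>x. x \<in> space (product_lborel k) \<Longrightarrow> P' x \<Longrightarrow> x \<in> N"
    unfolding null_cover_def by blast
  define R where "R = {(a, b). a \<in> PiE {..<k} (\<lambda>_. \<rat>) \<and> b \<in> PiE {..<k} (\<lambda>_. \<rat>) \<and> (\<forall>x. inbox a b x \<longrightarrow> P x)}"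
  have "countable (PiE {..<k} (\<lambda>_. \<rat> :: real set))" by (intro countable_PiE) (auto simp: countable_rat)
  then have "countable (PiE {..<k} (\<lambda>_. \<rat> :: real set) \<times> PiE {..<k} (\<lambda>_. \<rat> :: real set))" by blast
  then have "countable R" by (rule countable_subset[rotated]) (auto simp: R_def)
  define B where "B = (\<Union>(a, b)\<in>R. {x \<in> space (product_lborel k). inbox a b x})"
  have "{x \<in> space (product_lborel k). inbox a b x} \<in> sets (product_lborel k)" for a b
    unfolding inbox_def by measurable
  then have "B \<in> sets (product_lborel k)"
    unfolding B_def using \<open>countable R\<close> by (intro sets.countable_UN') auto
  moreover have "P x \<longleftrightarrow> x \<in> B" if x: "x \<in> space (product_lborel k) - N" for x
  proof
    assume "P x"
    moreover have "\<not> P' x" using N(2) x by blast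
    ultimately obtain \<delta> where \<delta>: "\<delta> > 0" "\<And>y. (\<forall>i<k. \<bar>y i - x i\<bar> < \<delta>) \<Longrightarrow> P y"
      unfolding P'_def by blast
    have "\<exists>q\<in>\<rat>. x i - \<delta> < q \<and> q < x i" "\<exists>q\<in>\<rat>. x i < q \<and> q < x i + \<delta>" for i
      using \<delta>(1) Rats_dense_in_real[of "x i - \<delta>" "x i"] Rats_dense_in_real[of "x i" "x i + \<delta>"] by auto
    then obtain a b where ab: "\<And>i. a i \<in> \<rat>" "\<And>i. b i \<in> \<rat>" "\<And>i. x i - \<delta> < a i" "\<And>i. a i < x i"
       "\<And>i. x i < b i" "\<And>i. b i < x i + \<delta>" by metis
    define a' where "a' = restrict a {..<k}"
    define b' where "b' = restrict b {..<k}"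
    have "inbox a' b' x" using ab unfolding inbox_def a'_def b'_def by simp
    moreover have "P y" if "inbox a' b' y" for y
    proof (rule \<delta>(2), intro allI impI)
      fix i assume "i < k"
      then have "a i < y i" "y i < b i" using that unfolding inbox_def a'_def b'_def by auto
      then show "\<bar>y i - x i\<bar> < \<delta>" using ab(3)[of i] ab(6)[of i] by linarith
    qed
    then have "(a', b') \<in> R" unfolding R_def a'_def b'_def using ab by auto
    ultimately show "x \<in> B" unfolding B_def using x by blast
  next
    assume "x \<in> B" then show "P x" unfolding B_def R_def by auto
  qed
  ultimately show thesis using that N(1) by blast
qed

text \<open>
  Induction on the dimension, by looking at the slices of the set in the direction of the last
  coordinate. The base points whose slice contains a fixed rational interval form a set without
  interior, which is null by induction; so almost all slices are finite. This does not yet give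
  nullity, because the set need not be measurable. It is therefore enlarged: by the induction
  hypothesis the condition that the slice meets a given rational interval is measurable up to a
  null set, and the points \<open>(x, t)\<close> such that the slice over \<open>x\<close> meets every rational interval around
  \<open>t\<close> form a measurable set, whose slices are the closures of the original ones. A finite set is its
  own closure, so Fubini's theorem applies.
\<close>

lemma null_cover_if_no_box:
  "definable P \<Longrightarrow> depends_on_first k P \<Longrightarrow> \<not> contains_box k P \<Longrightarrow> null_cover k P"
proof (induction k arbitrary: P)
  case 0
  then have "\<not> P x" for x unfolding contains_box_def depends_on_first_def by blast
  then show ?case unfolding null_cover_def by (intro bexI[of _ "{}"]) auto
next
  case (Suc k)
  note P = Suc.prems
  define J where "J = {(q, r). q \<in> \<rat> \<and> r \<in> \<rat> \<and> q < (r::real)}"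
  have "countable J"
    by (rule countable_subset[of _ "\<rat> \<times> \<rat>"]) (auto simp: J_def countable_rat)
  have cons: "(\<lambda>i. e (Suc i))(k := e 0) = (\<lambda>i. e (if i = k then 0 else Suc i))" for e :: "nat \<Rightarrow> real"
    by auto
  have slice: "definable (\<lambda>e. P ((\<lambda>i. e (Suc i))(k := e 0)))"
    unfolding cons by (rule definable_rename[OF P(1)])
  have dep: "P (e(k := t)) = P (e'(k := t))" if "\<forall>i<k. e i = e' i" for e e' t
    using P(2) that unfolding depends_on_first_def by (auto simp: less_Suc_eq)
  have full: "null_cover k (\<lambda>e. \<forall>t. q < t \<and> t < r \<longrightarrow> P (e(k := t)))" if "q < r" for q r
  proof (rule Suc.IH)
    show "definable (\<lambda>e. \<forall>t. q < t \<and> t < r \<longrightarrow> P (e(k := t)))"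
      by (intro definable_all definable_imp definable_conj definable_less definable_term_var
          definable_term_const slice)
    show "depends_on_first k (\<lambda>e. \<forall>t. q < t \<and> t < r \<longrightarrow> P (e(k := t)))"
      using dep unfolding depends_on_first_def by blast
    show "\<not> contains_box k (\<lambda>e. \<forall>t. q < t \<and> t < r \<longrightarrow> P (e(k := t)))"
    proof
      assume "contains_box k (\<lambda>e. \<forall>t. q < t \<and> t < r \<longrightarrow> P (e(k := t)))"
      then obtain a b where ab: "\<forall>i<k. a i < b i"
        "\<And>x t. (\<forall>i<k. a i < x i \<and> x i < b i) \<Longrightarrow> q < t \<Longrightarrow> t < r \<Longrightarrow> P (x(k := t))"
        unfolding contains_box_def by blast
      have "P x" if "\<forall>i<Suc k. (a(k := q)) i < x i \<and> x i < (b(k := r)) i" for x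
        using ab(2)[of x "x k"] that by (auto simp: less_Suc_eq split: if_splits)
      moreover have "\<forall>i<Suc k. (a(k := q)) i < (b(k := r)) i"
        using ab(1) \<open>q < r\<close> by (auto simp: less_Suc_eq)
      ultimately show False using P(3) unfolding contains_box_def by blast
    qed
  qed
  have "\<forall>j\<in>J. \<exists>N\<in>null_sets (product_lborel k). \<forall>x\<in>space (product_lborel k).
      (\<forall>t. fst j < t \<and> t < snd j \<longrightarrow> P (x(k := t))) \<longrightarrow> x \<in> N"
    using full unfolding null_cover_def J_def by auto
  then obtain N where N: "\<And>j. j \<in> J \<Longrightarrow> N j \<in> null_sets (product_lborel k)"
    "\<And>j x. j \<in> J \<Longrightarrow> x \<in> space (product_lborel k) \<Longrightarrow>
      (\<forall>t. fst j < t \<and> t < snd j \<longrightarrow> P (x(k := t))) \<Longrightarrow> x \<in> N j"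
    by metis
  have "\<exists>B N. B \<in> sets (product_lborel k) \<and> N \<in> null_sets (product_lborel k) \<and>
    (\<forall>x\<in>space (product_lborel k) - N. (\<exists>t. q < t \<and> t < r \<and> P (x(k := t))) \<longleftrightarrow> x \<in> B)" for q r
  proof -
    have d: "definable (\<lambda>e. \<exists>t. q < t \<and> t < r \<and> P (e(k := t)))"
      by (intro definable_ex definable_conj definable_less definable_term_var definable_term_const slice)
    have dd: "depends_on_first k (\<lambda>e. \<exists>t. q < t \<and> t < r \<and> P (e(k := t)))"
      using dep unfolding depends_on_first_def by blast
    show ?thesis
      by (rule almost_Borel_if_null_cover[OF Suc.IH d dd]) blast+
  qed
  then have "\<forall>j. \<exists>BN. fst BN \<in> sets (product_lborel k) \<and> snd BN \<in> null_sets (product_lborel k) \<and>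
    (\<forall>x\<in>space (product_lborel k) - snd BN. (\<exists>t. fst j < t \<and> t < snd j \<and> P (x(k := t))) \<longleftrightarrow> x \<in> fst BN)"
    by simp
  then obtain BN where BN: "\<And>j. fst (BN j) \<in> sets (product_lborel k)"
    "\<And>j. snd (BN j) \<in> null_sets (product_lborel k)"
    "\<And>j x. x \<in> space (product_lborel k) - snd (BN j) \<Longrightarrow>
      (\<exists>t. fst j < t \<and> t < snd j \<and> P (x(k := t))) \<longleftrightarrow> x \<in> fst (BN j)"
    by metis
  define Z where "Z = (\<Union>j\<in>J. N j) \<union> (\<Union>j\<in>J. snd (BN j))"
  have Z: "Z \<in> null_sets (product_lborel k)"
    unfolding Z_def using N BN \<open>countable J\<close> by (intro null_sets.Un null_sets_UN') auto
  \<comment> \<open>The first alternative only serves to discard the exceptional null set \<open>Z\<close> of base points.\<close>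
  define E where "E = {x \<in> space (product_lborel (Suc k)). restrict x {..<k} \<in> Z \<or>
     (\<forall>j\<in>J. fst j < x k \<and> x k < snd j \<longrightarrow> restrict x {..<k} \<in> fst (BN j))}"
  have fin: "finite {t. P (x(k := t))}" if x: "x \<in> space (product_lborel k) - Z" for x
  proof (rule ccontr)
    assume "infinite {t. P (x(k := t))}"
    then obtain a b where ab: "a < b" "{a<..<b} \<subseteq> {t. P (x(k := t))}"
      using tame_infinite_interval[OF tame_definable_slice[OF P(1)]] by blast
    obtain q where q: "q \<in> \<rat>" "a < q" "q < b" using Rats_dense_in_real[OF ab(1)] by blast
    obtain r where r: "r \<in> \<rat>" "q < r" "r < b" using Rats_dense_in_real[OF q(3)] by blast
    have "(q, r) \<in> J" using q r unfolding J_def by auto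
    moreover have "\<forall>t. q < t \<and> t < r \<longrightarrow> P (x(k := t))" using ab(2) q r by (auto simp: subset_eq)
    ultimately have "x \<in> N (q, r)" using x N(2)[of "(q, r)" x] by auto
    then show False using x \<open>(q, r) \<in> J\<close> unfolding Z_def by blast
  qed
  have restr: "restrict (x(k := t)) {..<k} = x" if "x \<in> space (product_lborel k)" for x t
    using that by (auto simp: space_PiM PiE_def extensional_def fun_eq_iff)
  have E_slice: "x(k := t) \<in> E \<longleftrightarrow> (\<forall>j\<in>J. fst j < t \<and> t < snd j \<longrightarrow> (\<exists>s. fst j < s \<and> s < snd j \<and> P (x(k := s))))"
    if x: "x \<in> space (product_lborel k) - Z" for x t
  proof -
    have "x(k := t) \<in> space (product_lborel (Suc k))"
      using x by (auto simp: space_PiM PiE_def extensional_def less_Suc_eq)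
    moreover have "x \<in> fst (BN j) \<longleftrightarrow> (\<exists>s. fst j < s \<and> s < snd j \<and> P (x(k := s)))" if "j \<in> J" for j
      using BN(3)[of x j] x that unfolding Z_def by blast
    ultimately show ?thesis unfolding E_def using x restr[of x t] by auto
  qed
  have "E \<in> null_sets (product_lborel (Suc k))"
  proof (rule null_set_if_slices_finite[OF _ Z])
    have r[measurable]: "(\<lambda>x. restrict x {..<k}) \<in> measurable (product_lborel (Suc k)) (product_lborel k)"
      by (rule measurable_restrict_subset) auto
    have [measurable]: "Z \<in> sets (product_lborel k)" "\<And>j. fst (BN j) \<in> sets (product_lborel k)"
      using Z BN by auto
    have [measurable]: "(\<lambda>x. x k) \<in> borel_measurable (product_lborel (Suc k))" by measurable
    have [measurable]: "Measurable.pred (product_lborel (Suc k)) (\<lambda>x. \<forall>j\<in>J. fst j < x k \<and> x k < snd j \<longrightarrow> restrict x {..<k} \<in> fst (BN j))"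
      using \<open>countable J\<close> by measurable
    show "E \<in> sets (product_lborel (Suc k))" unfolding E_def by measurable
  next
    fix x assume x: "x \<in> space (product_lborel k) - Z"
    have "{t. x(k := t) \<in> E} \<subseteq> {t. P (x(k := t))}"
    proof (rule ccontr)
      assume "\<not> ?thesis"
      then obtain t where t: "x(k := t) \<in> E" "t \<notin> {t. P (x(k := t))}" by blast
      have "open (- {t. P (x(k := t))})" using fin[OF x] by (simp add: finite_imp_closed open_Compl)
      then obtain e where e: "e > 0" "ball t e \<subseteq> - {t. P (x(k := t))}"
        using t(2) open_contains_ball by blast
      obtain q where q: "q \<in> \<rat>" "t - e < q" "q < t" using Rats_dense_in_real[of "t - e" t] e by auto
      obtain r where r: "r \<in> \<rat>" "t < r" "r < t + e" using Rats_dense_in_real[of t "t + e"] e by auto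
      have "(q, r) \<in> J" using q r unfolding J_def by auto
      then obtain s where "q < s" "s < r" "P (x(k := s))" using t(1)[unfolded E_slice[OF x]] q r by auto
      then show False using e(2) q r by (auto simp: ball_eq_greaterThanLessThan subset_eq)
    qed
    then show "finite {t. x(k := t) \<in> E}" using fin[OF x] finite_subset by blast
  qed
  moreover have "z \<in> E" if z: "z \<in> space (product_lborel (Suc k))" "P z" for z
  proof (cases "restrict z {..<k} \<in> Z")
    case True then show ?thesis using z unfolding E_def by blast
  next
    case False
    define x where "x = restrict z {..<k}"
    have x: "x \<in> space (product_lborel k) - Z"
      using z False unfolding x_def by (auto simp: space_PiM PiE_def)
    have zx: "z = x(k := z k)"
      using z(1) unfolding x_def by (auto simp: space_PiM PiE_def extensional_def fun_eq_iff)
    have "x(k := z k) \<in> E" unfolding E_slice[OF x] using z(2) zx by metis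
    then show ?thesis using zx by simp
  qed
  ultimately show ?case unfolding null_cover_def by blast
qed

end

text \<open>
  An arbitrary numbering of the index type, which identifies vectors with sequences.
\<close>

definition coord :: "'n::finite \<Rightarrow> nat" where
  "coord = (SOME h. bij_betw h UNIV {..<CARD('n)})"

definition vec_of :: "(nat \<Rightarrow> real) \<Rightarrow> real ^ 'n" where
  "vec_of e = (\<chi> j. e (coord j))"

definition coords_of :: "real ^ 'n \<Rightarrow> nat \<Rightarrow> real" where
  "coords_of x = (\<lambda>i\<in>{..<CARD('n)}. x $ inv coord i)"

lemma bij_coord: "bij_betw (coord :: 'n::finite \<Rightarrow> nat) UNIV {..<CARD('n)}"
proof -
  have "\<exists>h. bij_betw h (UNIV :: 'n set) {..<CARD('n)}"
    using finite_same_card_bij[of "UNIV :: 'n set" "{..<CARD('n)}"] by simp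
  then show ?thesis unfolding coord_def by (rule someI_ex)
qed

lemma coord_less: "coord (j :: 'n::finite) < CARD('n)"
  using bij_coord by (auto simp: bij_betw_def)

lemma inv_coord: "inv coord (coord (j :: 'n::finite)) = j"
  using bij_coord[where ?'n='n] by (simp add: bij_betw_def inv_f_f)

lemma coord_inv: "i < CARD('n) \<Longrightarrow> coord (inv coord i :: 'n::finite) = i"
  using bij_betw_inv_into_right[OF bij_coord, of i] by simp

lemma vec_of_nth [simp]: "vec_of e $ j = e (coord j)"
  by (simp add: vec_of_def)

lemma vec_of_coords_of [simp]: "vec_of (coords_of x) = x"
  by (simp add: vec_eq_iff coords_of_def coord_less inv_coord)

lemma vec_of_cong: "(\<And>i. i < CARD('n) \<Longrightarrow> e i = e' i) \<Longrightarrow> (vec_of e :: real ^ 'n) = vec_of e'"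
  by (simp add: vec_eq_iff coord_less)

lemma prod_Basis_cart: "(\<Prod>b\<in>(Basis :: (real ^ 'n) set). g (x \<bullet> b)) = (\<Prod>j\<in>UNIV. g (x $ j))"
proof -
  have B: "(Basis :: (real ^ 'n) set) = range (\<lambda>j. axis j 1)" by (auto simp: Basis_vec_def)
  have "inj (\<lambda>j::'n. axis j (1::real))" by (auto simp: inj_def axis_eq_axis)
  then show ?thesis unfolding B by (subst prod.reindex) (auto simp: inner_axis)
qed

lemma vec_of_measurable [measurable]:
  "(vec_of :: _ \<Rightarrow> real ^ 'n) \<in> borel_measurable (product_lborel CARD('n))"
proof (rule borel_measurable_euclidean_space[THEN iffD2], rule ballI)
  fix b :: "real ^ 'n" assume "b \<in> Basis"
  then obtain j where b: "b = axis j 1" by (auto simp: Basis_vec_def)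
  have "(\<lambda>e. e (coord j)) \<in> borel_measurable (product_lborel CARD('n))"
  proof -
    have "coord j \<in> {..<CARD('n)}" using coord_less[of j] by simp
    then show ?thesis by measurable
  qed
  then show "(\<lambda>e. vec_of e \<bullet> b) \<in> borel_measurable (product_lborel CARD('n))"
    unfolding b by (simp add: inner_axis)
qed

lemma lborel_eq_distr_vec_of:
  "lborel = distr (product_lborel CARD('n)) borel (vec_of :: _ \<Rightarrow> real ^ 'n)"
proof (rule lborel_eqI)
  fix l u :: "real ^ 'n" assume lu: "\<And>b. b \<in> Basis \<Longrightarrow> l \<bullet> b \<le> u \<bullet> b"
  have le: "l $ j \<le> u $ j" for j using lu[of "axis j 1"] by (auto simp: inner_axis Basis_vec_def)
  have "vec_of -` box l u \<inter> space (product_lborel CARD('n))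
      = PiE {..<CARD('n)} (\<lambda>i. {l $ inv coord i<..<u $ inv coord i})" (is "?L = ?R")
  proof (intro equalityI subsetI)
    fix e assume e: "e \<in> ?L"
    have "l $ inv coord i < e i \<and> e i < u $ inv coord i" if "i < CARD('n)" for i
    proof -
      have "l $ j < e (coord j) \<and> e (coord j) < u $ j" for j
        using e by (auto simp: mem_box_cart)
      from this[of "inv coord i"] show ?thesis using coord_inv[OF that] by simp
    qed
    then show "e \<in> ?R" using e by (auto simp: space_PiM PiE_def)
  next
    fix e assume e: "e \<in> ?R"
    have "l $ j < e (coord j) \<and> e (coord j) < u $ j" for j
      using e coord_less[of j] by (auto simp: PiE_def Pi_def inv_coord dest!: spec[of _ "coord j"])
    then show "e \<in> ?L" using e by (auto simp: space_PiM PiE_def mem_box_cart)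
  qed
  then have "emeasure (distr (product_lborel CARD('n)) borel vec_of) (box l u)
      = emeasure (product_lborel CARD('n)) (PiE {..<CARD('n)} (\<lambda>i. {l $ inv coord i<..<u $ inv coord i}))"
    by (subst emeasure_distr) auto
  also have "\<dots> = (\<Prod>i<CARD('n). emeasure lborel {l $ inv coord i<..<u $ (inv coord i :: 'n)})"
    by (rule lborel_product.emeasure_PiM) auto
  also have "\<dots> = (\<Prod>j\<in>UNIV. emeasure lborel {l $ j<..<u $ (j :: 'n)})"
    by (rule prod.reindex_bij_betw[OF bij_betw_inv_into[OF bij_coord], of "\<lambda>j. emeasure lborel {l $ j<..<u $ j}"])
  also have "\<dots> = (\<Prod>j\<in>UNIV. ennreal ((u - l) $ j))"
    using le by (intro prod.cong) auto
  also have "\<dots> = ennreal (\<Prod>j\<in>UNIV. (u - l) $ j)"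
    using le by (intro prod_ennreal) auto
  also have "(\<Prod>j\<in>UNIV. (u - l) $ j) = (\<Prod>b\<in>Basis. (u - l) \<bullet> b)"
    using prod_Basis_cart[of "\<lambda>t. t" "u - l"] by simp
  finally show "emeasure (distr (product_lborel CARD('n)) borel vec_of) (box l u) = (\<Prod>b\<in>Basis. (u - l) \<bullet> b)" .
qed simp

lemma coords_of_measurable [measurable]:
  "(coords_of :: real ^ 'n \<Rightarrow> _) \<in> measurable borel (product_lborel CARD('n))"
  unfolding coords_of_def
proof (rule measurable_restrict)
  fix i
  have "(\<lambda>x :: real ^ 'n. x \<bullet> axis (inv coord i) 1) \<in> borel_measurable borel" by measurable
  then show "(\<lambda>x :: real ^ 'n. x $ inv coord i) \<in> measurable borel lborel" by (simp add: inner_axis)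
qed

context ominimal
begin

text \<open>
  The transfer of \<open>null_cover_if_no_box\<close> from product measure to Lebesgue measure.
\<close>

theorem definable_negligible_if_interior_empty:
  fixes A :: "(real ^ 'n) set"
  assumes "definable (\<lambda>e. vec_of e \<in> A)" and "interior A = {}"
  shows "negligible A"
proof -
  have "\<not> contains_box CARD('n) (\<lambda>e. vec_of e \<in> A)"
  proof
    assume "contains_box CARD('n) (\<lambda>e. vec_of e \<in> A)"
    then obtain a b where ab: "\<And>i. i < CARD('n) \<Longrightarrow> a i < b i"
      "\<And>x. (\<And>i. i < CARD('n) \<Longrightarrow> a i < x i \<and> x i < b i) \<Longrightarrow> vec_of x \<in> A"
      unfolding contains_box_def by auto
    have "box (vec_of a) (vec_of b) \<subseteq> A"
    proof
      fix v :: "real ^ 'n" assume v: "v \<in> box (vec_of a) (vec_of b)"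
      have "a i < coords_of v i \<and> coords_of v i < b i" if "i < CARD('n)" for i
        using v[unfolded mem_box_cart, rule_format, of "inv coord i"] that
        by (simp add: coords_of_def coord_inv)
      from ab(2)[OF this] show "v \<in> A" by simp
    qed
    moreover have "vec_of (\<lambda>i. (a i + b i) / 2) \<in> box (vec_of a) (vec_of b :: real ^ 'n)"
      using ab(1)[OF coord_less] by (auto simp: mem_box_cart field_simps)
    ultimately show False using assms(2) interior_maximal[OF _ open_box] by blast
  qed
  moreover have "depends_on_first CARD('n) (\<lambda>e. vec_of e \<in> A)"
    using vec_of_cong[where ?'n='n] unfolding depends_on_first_def by metis
  ultimately have "null_cover CARD('n) (\<lambda>e. vec_of e \<in> A)"
    using assms(1) by (intro null_cover_if_no_box)
  then obtain N where N: "N \<in> null_sets (product_lborel CARD('n))"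
    "\<And>e. e \<in> space (product_lborel CARD('n)) \<Longrightarrow> vec_of e \<in> A \<Longrightarrow> e \<in> N"
    unfolding null_cover_def by blast
  define N' where "N' = (coords_of :: real ^ 'n \<Rightarrow> _) -` N \<inter> space borel"
  have "N \<in> sets (product_lborel CARD('n))" using N(1) by auto
  then have N': "N' \<in> sets borel" unfolding N'_def by measurable
  have "vec_of -` N' \<inter> space (product_lborel CARD('n)) \<subseteq> N"
  proof
    fix e assume e: "e \<in> vec_of -` N' \<inter> space (product_lborel CARD('n))"
    then have "coords_of (vec_of e :: real ^ 'n) = e"
      by (auto simp: coords_of_def coord_inv space_PiM PiE_def extensional_def fun_eq_iff)
    then show "e \<in> N" using e unfolding N'_def by auto
  qed
  then have "emeasure (product_lborel CARD('n)) (vec_of -` N' \<inter> space (product_lborel CARD('n))) \<le> 0"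
    using emeasure_mono[OF _ \<open>N \<in> sets (product_lborel CARD('n))\<close>] null_setsD1[OF N(1)] by metis
  then have "emeasure lborel N' = 0"
    using N' by (subst lborel_eq_distr_vec_of) (simp add: emeasure_distr)
  then have "N' \<in> null_sets lborel" using N' by (auto simp: null_sets_def)
  then have "negligible N'" using negligible_iff_null_sets null_sets_completionI by blast
  moreover have "A \<subseteq> N'"
  proof
    fix x assume "x \<in> A"
    moreover have "coords_of x \<in> space (product_lborel CARD('n))"
      by (auto simp: coords_of_def space_PiM)
    ultimately show "x \<in> N'" unfolding N'_def using N(2)[of "coords_of x"] by simp
  qed
  ultimately show ?thesis by (rule negligible_subset)
qed

end

section \<open>Definable functions are continuously differentiable almost everywhere\<close>

lemma inverse_Suc_below: "0 < \<delta> \<Longrightarrow> \<exists>n. 1 / real (Suc n) < \<delta>"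
  using reals_Archimedean[of \<delta>] by (simp add: inverse_eq_divide)

context ominimal
begin

definition definable_function :: "(real ^ 'n \<Rightarrow> real) \<Rightarrow> bool" where
  "definable_function h \<longleftrightarrow> definable_term (\<lambda>e. h (vec_of e))"

definition definable_vec :: "((nat \<Rightarrow> real) \<Rightarrow> real ^ 'n) \<Rightarrow> bool" where
  "definable_vec v \<longleftrightarrow> (\<forall>j. definable_term (\<lambda>e. v e $ j))"

lemma definable_vec_var: "definable_vec (\<lambda>e. vec_of (\<lambda>i. e (\<sigma> i)))"
  unfolding definable_vec_def by (simp add: definable_term_var)

lemma definable_vec_var0: "definable_vec (\<lambda>e. vec_of e)"
  unfolding definable_vec_def by (simp add: definable_term_var)

lemma definable_vec_const: "definable_vec (\<lambda>e. c)"
  unfolding definable_vec_def by (simp add: definable_term_const)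

lemma definable_vec_add: "definable_vec v \<Longrightarrow> definable_vec w \<Longrightarrow> definable_vec (\<lambda>e. v e + w e)"
  unfolding definable_vec_def by (simp add: definable_term_add)

lemma definable_vec_minus: "definable_vec v \<Longrightarrow> definable_vec w \<Longrightarrow> definable_vec (\<lambda>e. v e - w e)"
  unfolding definable_vec_def by (simp add: definable_term_minus)

lemma definable_vec_scaleR: "definable_term \<tau> \<Longrightarrow> definable_vec w \<Longrightarrow> definable_vec (\<lambda>e. \<tau> e *\<^sub>R w e)"
  unfolding definable_vec_def by (simp add: definable_term_mult)

lemma definable_vec_nth: "definable_vec v \<Longrightarrow> definable_term (\<lambda>e. v e $ j)"
  unfolding definable_vec_def by simp

lemma vec_of_components [simp]: "vec_of (\<lambda>i. v $ inv coord i) = v"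
  by (simp add: vec_eq_iff inv_coord)

lemma definable_term_function:
  assumes "definable_function h" "definable_vec v" shows "definable_term (\<lambda>e. h (v e))"
  using definable_term_compose[OF assms(1)[unfolded definable_function_def], of "\<lambda>i e. v e $ inv coord i"]
    assms(2) by (simp add: definable_vec_def)

lemma definable_mem:
  assumes "definable (\<lambda>e. vec_of e \<in> A)" "definable_vec v" shows "definable (\<lambda>e. v e \<in> A)"
  using definable_subst[OF assms(1), of "\<lambda>i e. v e $ inv coord i"] assms(2)
  by (simp add: definable_vec_def)

lemma definable_ex_vec:
  assumes "definable (\<lambda>e. Q (\<lambda>i. e (i + CARD('n))) (vec_of e))"
  shows "definable (\<lambda>e. \<exists>x :: real ^ 'n. Q e x)"
proof -
  have a: "(\<lambda>i. prepend CARD('n) y e (i + CARD('n))) = e" for y e by (simp add: prepend_def)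
  have b: "vec_of (prepend CARD('n) y e) = (vec_of y :: real ^ 'n)" for y e
    by (rule vec_of_cong) (simp add: prepend_def)
  have "definable (\<lambda>e. \<exists>y. Q e (vec_of y :: real ^ 'n))"
    using definable_ex_many[OF assms, of "CARD('n)"] unfolding a b .
  moreover have "(\<exists>y. Q e (vec_of y :: real ^ 'n)) \<longleftrightarrow> (\<exists>x. Q e x)" for e
    by (metis vec_of_coords_of)
  ultimately show ?thesis by simp
qed

lemma definable_all_vec:
  assumes "definable (\<lambda>e. Q (\<lambda>i. e (i + CARD('n))) (vec_of e))"
  shows "definable (\<lambda>e. \<forall>x :: real ^ 'n. Q e x)"
  using definable_not[OF definable_ex_vec[of "\<lambda>e x. \<not> Q e x", OF definable_not[OF assms]]] by simp

text \<open>
  The norm is the nonnegative solution of a polynomial equation, and definability speaks of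
  graphs.
\<close>

lemma definable_term_norm:
  fixes v :: "(nat \<Rightarrow> real) \<Rightarrow> real ^ 'n"
  assumes "definable_vec v" shows "definable_term (\<lambda>e. norm (v e))"
proof (rule definable_termI)
  have "definable_vec (\<lambda>e. v (\<lambda>i. e (Suc i)))"
    unfolding definable_vec_def
    by (intro allI definable_term_compose[of "\<lambda>e. v e $ _" "\<lambda>i e. e (Suc i)"]
        definable_vec_nth assms definable_term_var)
  from definable_vec_nth[OF this]
  show "definable (\<lambda>e. 0 \<le> e 0 \<and> e 0 * e 0 = (\<Sum>j\<in>UNIV. v (\<lambda>i. e (Suc i)) $ j * v (\<lambda>i. e (Suc i)) $ j))"
    by (intro definable_conj definable_le definable_eq definable_term_sum definable_term_mult
        definable_term_var definable_term_const)
  show "0 \<le> t \<and> t * t = (\<Sum>j\<in>UNIV. v e $ j * v e $ j) \<longleftrightarrow> t = norm (v e)" for e t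
  proof -
    have "norm (v e) = sqrt (\<Sum>j\<in>UNIV. v e $ j * v e $ j)"
      by (simp add: norm_eq_sqrt_inner inner_vec_def)
    moreover have "0 \<le> (\<Sum>j\<in>UNIV. v e $ j * v e $ j)" by (intro sum_nonneg) simp
    ultimately show ?thesis by (metis abs_of_nonneg norm_ge_zero real_sqrt_abs2 real_sqrt_pow2 power2_eq_square)
  qed
qed

lemma definable_term_abs: "definable_term \<tau> \<Longrightarrow> definable_term (\<lambda>e. \<bar>\<tau> e\<bar>)"
proof (rule definable_termI)
  assume "definable_term \<tau>"
  from definable_term_compose[OF this, of "\<lambda>i e. e (Suc i)", OF definable_term_var]
  have t: "definable_term (\<lambda>e. \<tau> (\<lambda>i. e (Suc i)))" .
  show "definable (\<lambda>e. 0 \<le> e 0 \<and> (e 0 = \<tau> (\<lambda>i. e (Suc i)) \<or> e 0 = - \<tau> (\<lambda>i. e (Suc i))))"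
    by (intro definable_conj definable_disj definable_le definable_eq definable_term_uminus t
        definable_term_var definable_term_const)
qed auto

lemmas definable_intros =
  definable_not definable_conj definable_disj definable_imp definable_ex definable_all
  definable_all_finite definable_ex_vec definable_all_vec definable_eq definable_less definable_le
  definable_term_var definable_term_const definable_term_add definable_term_minus
  definable_term_uminus definable_term_mult definable_term_abs definable_term_norm
  definable_vec_var definable_vec_var0 definable_vec_const definable_vec_add definable_vec_minus
  definable_vec_scaleR definable_vec_nth

text \<open>
  The right derivative at \<open>t\<close> is \<open>+\<infinity>\<close>.
\<close>

definition has_large_right_quotients :: "(real \<Rightarrow> real) \<Rightarrow> real \<Rightarrow> bool" where
  "has_large_right_quotients g t \<longleftrightarrow> (\<forall>r. \<exists>\<delta>>0. \<forall>s. 0 < s \<and> s < \<delta> \<longrightarrow> r * s < g (t + s) - g t)"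

lemma definable_graph_compose:
  assumes "definable_term (\<lambda>e. g (e 0))" "definable_term \<tau>" shows "definable_term (\<lambda>e. g (\<tau> e))"
  using definable_term_compose[OF assms(1), of "\<lambda>i. \<tau>"] assms(2) by simp

lemma tame_Collect: "definable (\<lambda>e. P (e 0)) \<Longrightarrow> tame {t. P t}"
  using tame_definable_slice[of "\<lambda>e. P (e 0)" _ 0] by simp

lemma tame_Collect_in_interval: "definable (\<lambda>e. P (e 0)) \<Longrightarrow> tame ({t. P t} \<inter> {a<..<b})"
  using tame_Collect[of "\<lambda>t. P t \<and> a < t \<and> t < b"]
  by (simp add: definable_intros Collect_conj_eq[symmetric] greaterThanLessThan_def greaterThan_def lessThan_def)

text \<open>
  On a subinterval \<open>g\<close> is increasing, as the case \<open>r = 0\<close> holds there with a uniform \<open>\<delta>\<close>. There the set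
  of points up to which \<open>g\<close> has grown at rate at least \<open>r\<close> is closed under increasing limits by
  monotonicity, and can be continued to the right from each of its points; so \<open>g\<close> grows at every
  rate \<open>r\<close> between two fixed points.
\<close>

lemma no_interval_of_large_right_quotients:
  assumes g: "definable_term (\<lambda>e. g (e 0))" and "a < b"
  shows "\<exists>t\<in>{a<..<b}. \<not> has_large_right_quotients g t"
proof (rule ccontr)
  assume "\<not> ?thesis"
  then have large: "has_large_right_quotients g t" if "t \<in> {a<..<b}" for t using that by blast
  note dg = definable_graph_compose[OF g]
  define A where "A = (\<lambda>n::nat. {t. \<forall>s. 0 < s \<and> s < 1 / real (Suc n) \<longrightarrow> 0 < g (t + s) - g t})"
  have "\<exists>n\<in>UNIV. t \<in> A n" if t: "t \<in> {a<..<b}" for t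
  proof -
    obtain \<delta> where \<delta>: "\<delta> > 0" "\<And>s. 0 < s \<and> s < \<delta> \<longrightarrow> 0 * s < g (t + s) - g t"
      using large[OF t] unfolding has_large_right_quotients_def by blast
    obtain n where n: "1 / real (Suc n) < \<delta>" using inverse_Suc_below[OF \<delta>(1)] by blast
    have "t \<in> A n" unfolding A_def using \<delta>(2) n by auto
    then show ?thesis by blast
  qed
  then have cover: "{a<..<b} \<subseteq> (\<Union>n\<in>UNIV. A n)" by blast
  have "tame (A n \<inter> {a<..<b})" for n
    unfolding A_def by (intro tame_Collect_in_interval definable_intros dg)
  then obtain n c d where n: "c < d" "{c<..<d} \<subseteq> A n" "{c<..<d} \<subseteq> {a<..<b}"
    using tame_cover_interval[OF \<open>a < b\<close> _ cover] by (metis uncountable_def countableI_type)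
  define p where "p = (c + d) / 2"
  \<comment> \<open>Any two points of \<open>[p, q]\<close> are closer than the scale \<open>1 / Suc n\<close>, so that they can be compared.\<close>
  define h where "h = min (d - p) (1 / real (Suc n)) / 2"
  have "h > 0" unfolding h_def p_def using n(1) by auto
  define q where "q = p + h"
  have pq: "p < q" "q - p < 1 / real (Suc n)" "c < p" "q < d"
    unfolding q_def h_def p_def using n(1) by (auto simp: min_def field_simps)
  have mono: "g u < g v" if "p \<le> u" "u < v" "v \<le> q" for u v
  proof -
    have "u \<in> A n" using n(2) pq that by auto
    moreover have "v - u < 1 / real (Suc n)" using that pq(2) by linarith
    ultimately have "0 < g (u + (v - u)) - g u" using that(2) unfolding A_def by (metis (mono_tags, lifting) diff_gt_0_iff_gt mem_Collect_eq)
    then show ?thesis by simp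
  qed
  define r where "r = (g q - g p) / (q - p) + 1"
  have r: "r > 0" unfolding r_def using mono[of p q] pq by (simp add: add_pos_pos)
  define K where "K = {t\<in>{p..q}. r * (t - p) \<le> g t - g p}"
  define s where "s = Sup K"
  have K: "p \<in> K" "bdd_above K" unfolding K_def using pq by (auto intro: bdd_aboveI[of _ q])
  have s: "p \<le> s" "s \<le> q"
    unfolding s_def using K by (auto intro: cSup_upper) (intro cSup_least, auto simp: K_def)
  have le: "u \<le> s" if "u \<in> K" for u unfolding s_def using K(2) that by (rule cSup_upper[rotated])
  have "s \<le> p + (g s - g p) / r"
    unfolding s_def
  proof (rule cSup_least, fold s_def)
    show "K \<noteq> {}" using K by auto
    fix u assume u: "u \<in> K"
    then have "g u \<le> g s" using mono[of u s] le[OF u] s by (cases "u = s") (auto simp: K_def)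
    then have "r * (u - p) \<le> g s - g p" using u unfolding K_def by auto
    then show "u \<le> p + (g s - g p) / r" using r by (simp add: field_simps)
  qed
  then have sK: "r * (s - p) \<le> g s - g p" using r by (simp add: field_simps)
  have "s = q"
  proof (rule ccontr)
    assume "s \<noteq> q"
    then have "s < q" using s by simp
    have "s \<in> {c<..<d}" using pq s by auto
    then have "s \<in> {a<..<b}" using n(3) by blast
    then obtain \<delta> where \<delta>: "\<delta> > 0" "\<And>h. 0 < h \<Longrightarrow> h < \<delta> \<Longrightarrow> r * h < g (s + h) - g s"
      using large unfolding has_large_right_quotients_def by blast
    define h where "h = min \<delta> (q - s) / 2"
    have h: "0 < h" "h < \<delta>" "s + h \<le> q" unfolding h_def using \<open>s < q\<close> \<delta>(1) by (auto simp: min_def field_simps)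
    have "r * (s + h - p) \<le> g (s + h) - g p"
      using \<delta>(2)[OF h(1,2)] sK by (simp add: algebra_simps)
    then have "s + h \<in> K" unfolding K_def using s h by auto
    then show False using le h by force
  qed
  then have "r * (q - p) \<le> g q - g p" using sK by simp
  moreover have "r * (q - p) = g q - g p + (q - p)"
    unfolding r_def using pq by (simp add: distrib_right)
  ultimately show False using pq by simp
qed

end

text \<open>
  Differentiability as a first-order formula in the values of \<open>g\<close>.
\<close>

definition quotient_limit :: "(real \<Rightarrow> real) \<Rightarrow> real \<Rightarrow> real \<Rightarrow> bool" where
  "quotient_limit g t d \<longleftrightarrow> (\<forall>\<epsilon>>0. \<exists>\<delta>>0. \<forall>s. \<bar>s\<bar> < \<delta> \<longrightarrow> \<bar>g (t + s) - g t - d * s\<bar> \<le> \<epsilon> * \<bar>s\<bar>)"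

lemma quotient_limit_iff: "quotient_limit g t d \<longleftrightarrow> (g has_real_derivative d) (at t)"
proof -
  have "(\<forall>s. \<bar>s\<bar> < \<delta> \<longrightarrow> \<bar>g (t + s) - g t - d * s\<bar> \<le> \<epsilon> * \<bar>s\<bar>)
      \<longleftrightarrow> (\<forall>y. \<bar>y - t\<bar> < \<delta> \<longrightarrow> \<bar>g y - g t - d * (y - t)\<bar> \<le> \<epsilon> * \<bar>y - t\<bar>)" for \<epsilon> \<delta>
    by (metis add.commute diff_add_cancel add_diff_cancel_left')
  then show ?thesis
    unfolding quotient_limit_def has_field_derivative_def has_derivative_at_alt
    by (simp add: bounded_linear_mult_right)
qed

context ominimal
begin

text \<open>
  Bounds for difference quotients at a fixed scale \<open>\<delta>\<close>. The scale is kept explicit because two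
  points at distance less than \<open>\<delta>\<close> can be compared with each other.
\<close>

definition right_above :: "(real \<Rightarrow> real) \<Rightarrow> real \<Rightarrow> real \<Rightarrow> real \<Rightarrow> bool" where
  "right_above g \<delta> r t \<longleftrightarrow> (\<forall>s. 0 < s \<and> s < \<delta> \<longrightarrow> r * s < g (t + s) - g t)"
definition right_below :: "(real \<Rightarrow> real) \<Rightarrow> real \<Rightarrow> real \<Rightarrow> real \<Rightarrow> bool" where
  "right_below g \<delta> r t \<longleftrightarrow> (\<forall>s. 0 < s \<and> s < \<delta> \<longrightarrow> g (t + s) - g t \<le> r * s)"
definition left_above :: "(real \<Rightarrow> real) \<Rightarrow> real \<Rightarrow> real \<Rightarrow> real \<Rightarrow> bool" where
  "left_above g \<delta> r t \<longleftrightarrow> (\<forall>s. 0 < s \<and> s < \<delta> \<longrightarrow> r * s < g t - g (t - s))"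
definition left_below :: "(real \<Rightarrow> real) \<Rightarrow> real \<Rightarrow> real \<Rightarrow> real \<Rightarrow> bool" where
  "left_below g \<delta> r t \<longleftrightarrow> (\<forall>s. 0 < s \<and> s < \<delta> \<longrightarrow> g t - g (t - s) \<le> r * s)"

lemmas one_sided_defs = right_above_def right_below_def left_above_def left_below_def

lemma tame_germ_decided:
  assumes "tame {s. P s}"
  shows "\<exists>n. (\<forall>s. 0 < s \<and> s < 1 / real (Suc n) \<longrightarrow> P s) \<or> (\<forall>s. 0 < s \<and> s < 1 / real (Suc n) \<longrightarrow> \<not> P s)"
proof -
  obtain b where b: "b > 0" "{0<..<b} \<subseteq> {s. P s} \<or> {0<..<b} \<inter> {s. P s} = {}"
    using tame_eventually[OF assms, of 0] by blast
  obtain n where "1 / real (Suc n) < b" using inverse_Suc_below[OF b(1)] by blast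
  then have "s \<in> {0<..<b}" if "0 < s \<and> s < 1 / real (Suc n)" for s using that by auto
  with b(2) show ?thesis by blast
qed

lemma right_dichotomy:
  assumes g: "definable_term (\<lambda>e. g (e 0))"
  shows "\<exists>n. right_above g (1 / real (Suc n)) r t \<or> right_below g (1 / real (Suc n)) r t"
proof -
  have "tame {s. r * s < g (t + s) - g t}"
    by (intro tame_Collect definable_intros definable_graph_compose[OF g])
  from tame_germ_decided[OF this] show ?thesis unfolding one_sided_defs not_less .
qed

lemma left_dichotomy:
  assumes g: "definable_term (\<lambda>e. g (e 0))"
  shows "\<exists>n. left_above g (1 / real (Suc n)) r t \<or> left_below g (1 / real (Suc n)) r t"
proof -
  have "tame {s. r * s < g t - g (t - s)}"
    by (intro tame_Collect definable_intros definable_graph_compose[OF g])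
  from tame_germ_decided[OF this] show ?thesis unfolding one_sided_defs not_less .
qed

text \<open>
  A gap between the one-sided derivatives: the right one is the larger if \<open>up\<close> holds, and the left
  one otherwise.
\<close>

definition jump_at :: "bool \<Rightarrow> (real \<Rightarrow> real) \<Rightarrow> real \<Rightarrow> real \<Rightarrow> real \<Rightarrow> real \<Rightarrow> bool" where
  "jump_at up g \<delta> q r t \<longleftrightarrow> (if up then right_above g \<delta> r t \<and> left_below g \<delta> q t
     else left_above g \<delta> r t \<and> right_below g \<delta> q t)"

text \<open>
  The rates \<open>r\<close> that the right difference quotients eventually exceed form a down-set. If it is
  empty or everything, the right derivative is infinite. Otherwise its supremum is the right
  derivative, and it is the left derivative too unless there is a gap, in which two rational
  numbers can be placed.
\<close>

lemma quotient_limit_cases: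
  assumes g: "definable_term (\<lambda>e. g (e 0))"
  obtains d where "quotient_limit g t d"
  | up n q r where "q \<in> \<rat>" "r \<in> \<rat>" "q < r" "jump_at up g (1 / real (Suc n)) q r t"
  | "has_large_right_quotients g t" | "has_large_right_quotients (\<lambda>s. - g s) t"
proof -
  define \<Delta> where "\<Delta> = (\<lambda>n. 1 / real (Suc n))"
  have \<Delta>: "\<Delta> n > 0" "m \<le> n \<Longrightarrow> \<Delta> n \<le> \<Delta> m" for m n unfolding \<Delta>_def by (auto simp: frac_le)
  define R where "R = {r. \<exists>n. right_above g (\<Delta> n) r t}"
  have notR: "\<exists>n. right_below g (\<Delta> n) r t" if "r \<notin> R" for r
    using right_dichotomy[OF g, of r t] that unfolding R_def \<Delta>_def by blast
  have down: "r \<in> R" if "r' \<in> R" "r \<le> r'" for r r'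
    using that unfolding R_def one_sided_defs by (smt (verit) mem_Collect_eq mult_right_mono)
  consider "R = UNIV" | "R = {}" | "R \<noteq> UNIV" "R \<noteq> {}" by blast
  then show thesis
  proof cases
    case 1
    have "has_large_right_quotients g t"
      using 1 \<Delta> unfolding has_large_right_quotients_def R_def right_above_def by blast
    then show thesis by (rule that(3))
  next
    case 2
    have "\<exists>\<delta>>0. \<forall>s. 0 < s \<and> s < \<delta> \<longrightarrow> r * s < - g (t + s) - - g t" for r
    proof -
      obtain n where n: "right_below g (\<Delta> n) (- r - 1) t" using notR 2 by blast
      have "r * s < - g (t + s) - - g t" if "0 < s \<and> s < \<Delta> n" for s
      proof -
        have "g (t + s) - g t \<le> (- r - 1) * s" using n that unfolding right_below_def by blast
        also have "\<dots> = - (r * s) - s" by (simp add: algebra_simps)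
        finally show ?thesis using that by linarith
      qed
      then show ?thesis using \<Delta>(1)[of n] by blast
    qed
    then have "has_large_right_quotients (\<lambda>s. - g s) t" unfolding has_large_right_quotients_def by simp
    then show thesis by (rule that(4))
  next
    case 3
    then obtain r0 where "r0 \<notin> R" by blast
    then have bdd: "bdd_above R" using down by (intro bdd_aboveI[of _ r0]) (meson nle_le)
    define d where "d = Sup R"
    have below: "r \<in> R" if "r < d" for r
      using less_cSupD[OF 3(2)] that down unfolding d_def by (meson less_imp_le)
    have above: "r \<notin> R" if "d < r" for r
      using cSup_upper[OF _ bdd] that unfolding d_def by fastforce
    show thesis
    proof (cases "\<exists>up n q r. q \<in> \<rat> \<and> r \<in> \<rat> \<and> q < r \<and> jump_at up g (\<Delta> n) q r t")
      case True then show thesis using that(2) unfolding \<Delta>_def by blast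
    next
      case False
      have lower: "\<exists>n. right_above g (\<Delta> n) r t \<and> left_above g (\<Delta> n) r t" if "r < d" for r
      proof -
        obtain q where q: "q \<in> \<rat>" "r < q" "q < d" using Rats_dense_in_real[OF \<open>r < d\<close>] by blast
        obtain q' where q': "q' \<in> \<rat>" "q < q'" "q' < d" using Rats_dense_in_real[OF q(3)] by blast
        obtain n where n: "right_above g (\<Delta> n) q' t" using below[OF q'(3)] unfolding R_def by blast
        obtain m where m: "left_above g (\<Delta> m) q t \<or> left_below g (\<Delta> m) q t"
          using left_dichotomy[OF g, of q t] unfolding \<Delta>_def by blast
        have n': "right_above g (\<Delta> (max m n)) q' t"
          using n \<Delta>(2)[of n "max m n"] unfolding one_sided_defs by (meson less_le_trans max.cobounded2)
        have "\<not> left_below g (\<Delta> m) q t"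
        proof
          assume "left_below g (\<Delta> m) q t"
          then have "left_below g (\<Delta> (max m n)) q t"
            using \<Delta>(2)[of m "max m n"] unfolding one_sided_defs by (meson less_le_trans max.cobounded1)
          with n' have "jump_at True g (\<Delta> (max m n)) q q' t" unfolding jump_at_def by simp
          with False q q' show False by blast
        qed
        with m have "left_above g (\<Delta> m) q t" by blast
        then have "left_above g (\<Delta> (max m n)) q t"
          using \<Delta>(2)[of m "max m n"] unfolding one_sided_defs by (meson less_le_trans max.cobounded1)
        then have "left_above g (\<Delta> (max m n)) r t" using q(2)
          unfolding one_sided_defs by (meson less_trans mult_strict_right_mono)
        moreover have "right_above g (\<Delta> (max m n)) r t" using n' q q'
          unfolding one_sided_defs by (meson less_trans mult_strict_right_mono)
        ultimately show ?thesis by blast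
      qed
      have upper: "\<exists>n. right_below g (\<Delta> n) r t \<and> left_below g (\<Delta> n) r t" if "d < r" for r
      proof -
        obtain q where q: "q \<in> \<rat>" "d < q" "q < r" using Rats_dense_in_real[OF \<open>d < r\<close>] by blast
        obtain q' where q': "q' \<in> \<rat>" "d < q'" "q' < q" using Rats_dense_in_real[OF q(2)] by blast
        obtain n where n: "right_below g (\<Delta> n) q' t" using notR[OF above[OF q'(2)]] by blast
        obtain m where m: "left_above g (\<Delta> m) q t \<or> left_below g (\<Delta> m) q t"
          using left_dichotomy[OF g, of q t] unfolding \<Delta>_def by blast
        have n': "right_below g (\<Delta> (max m n)) q' t"
          using n \<Delta>(2)[of n "max m n"] unfolding one_sided_defs by (meson less_le_trans max.cobounded2)
        have "\<not> left_above g (\<Delta> m) q t"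
        proof
          assume "left_above g (\<Delta> m) q t"
          then have "left_above g (\<Delta> (max m n)) q t"
            using \<Delta>(2)[of m "max m n"] unfolding one_sided_defs by (meson less_le_trans max.cobounded1)
          with n' have "jump_at False g (\<Delta> (max m n)) q' q t" unfolding jump_at_def by simp
          with False q q' show False by blast
        qed
        with m have "left_below g (\<Delta> m) q t" by blast
        then have "left_below g (\<Delta> (max m n)) q t"
          using \<Delta>(2)[of m "max m n"] unfolding one_sided_defs by (meson less_le_trans max.cobounded1)
        then have "left_below g (\<Delta> (max m n)) r t" using q(3)
          unfolding one_sided_defs by (meson less_imp_le mult_right_mono order_trans)
        moreover have "right_below g (\<Delta> (max m n)) r t" using n' q q'
          unfolding one_sided_defs by (meson less_imp_le less_trans mult_right_mono order_trans)
        ultimately show ?thesis by blast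
      qed
      have "quotient_limit g t d"
        unfolding quotient_limit_def
      proof (intro allI impI)
        fix \<epsilon> :: real assume "\<epsilon> > 0"
        obtain m where m: "right_above g (\<Delta> m) (d - \<epsilon>) t" "left_above g (\<Delta> m) (d - \<epsilon>) t"
          using lower[of "d - \<epsilon>"] \<open>\<epsilon> > 0\<close> by auto
        obtain n where n: "right_below g (\<Delta> n) (d + \<epsilon>) t" "left_below g (\<Delta> n) (d + \<epsilon>) t"
          using upper[of "d + \<epsilon>"] \<open>\<epsilon> > 0\<close> by auto
        have "\<bar>g (t + s) - g t - d * s\<bar> \<le> \<epsilon> * \<bar>s\<bar>" if s: "\<bar>s\<bar> < min (\<Delta> m) (\<Delta> n)" for s
        proof (cases s "0 :: real" rule: linorder_cases)
          case less
          then have "(d - \<epsilon>) * (- s) < g t - g (t - (- s))" "g t - g (t - (- s)) \<le> (d + \<epsilon>) * (- s)"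
            using m(2)[unfolded one_sided_defs, rule_format, of "- s"]
              n(2)[unfolded one_sided_defs, rule_format, of "- s"] s by auto
          then show ?thesis using less by (simp add: abs_le_iff algebra_simps)
        next
          case greater
          then have "(d - \<epsilon>) * s < g (t + s) - g t" "g (t + s) - g t \<le> (d + \<epsilon>) * s"
            using m(1) n(1) s unfolding one_sided_defs by auto
          then show ?thesis using greater by (simp add: abs_le_iff algebra_simps)
        qed simp
        then show "\<exists>\<delta>>0. \<forall>s. \<bar>s\<bar> < \<delta> \<longrightarrow> \<bar>g (t + s) - g t - d * s\<bar> \<le> \<epsilon> * \<bar>s\<bar>"
          using \<Delta>(1)[of m] \<Delta>(1)[of n] by (intro exI[of _ "min (\<Delta> m) (\<Delta> n)"]) auto
      qed
      then show thesis by (rule that(1))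
    qed
  qed
qed

text \<open>
  If \<open>g\<close> failed to be differentiable at infinitely many points, one kind of failure would occur on a
  whole interval with constant rational bounds and at a constant scale. For a gap this is absurd:
  the quotient between two nearby points is a right quotient of the one and a left quotient of the
  other.
\<close>

theorem finite_no_quotient_limit:
  assumes g: "definable_term (\<lambda>e. g (e 0))"
  shows "finite {t. \<nexists>d. quotient_limit g t d}"
proof (rule ccontr)
  note dg = definable_graph_compose[OF g]
  assume "infinite {t. \<nexists>d. quotient_limit g t d}"
  moreover have "tame {t. \<nexists>d. quotient_limit g t d}"
    unfolding quotient_limit_def by (intro tame_Collect definable_intros dg)
  ultimately obtain a b where ab: "a < b" "{a<..<b} \<subseteq> {t. \<nexists>d. quotient_limit g t d}"
    using tame_infinite_interval by blast
  define J where "J = (UNIV :: bool set) \<times> (UNIV :: nat set) \<times> {(q, r). q \<in> \<rat> \<and> r \<in> \<rat> \<and> q < (r::real)}"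
  define I where "I = {None, Some (None)} \<union> (\<lambda>j. Some (Some j)) ` J"
  define A where "A = (\<lambda>i. case i of None \<Rightarrow> {t. has_large_right_quotients g t}
     | Some None \<Rightarrow> {t. has_large_right_quotients (\<lambda>s. - g s) t}
     | Some (Some (up, n :: nat, q, r)) \<Rightarrow> {t. jump_at up g (1 / real (Suc n)) q r t})"
  have "countable {(q, r). q \<in> \<rat> \<and> r \<in> \<rat> \<and> q < (r::real)}"
    by (rule countable_subset[of _ "\<rat> \<times> \<rat>"]) (auto simp: countable_rat)
  then have "countable I" unfolding I_def J_def by auto
  have "{a<..<b} \<subseteq> (\<Union>i\<in>I. A i)"
  proof
    fix t assume "t \<in> {a<..<b}"
    then have no: "\<nexists>d. quotient_limit g t d" using ab(2) by blast
    show "t \<in> (\<Union>i\<in>I. A i)"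
    proof (cases t rule: quotient_limit_cases[OF g])
      case (2 up n q r)
      then have "Some (Some (up, n, q, r)) \<in> I" "t \<in> A (Some (Some (up, n, q, r)))"
        unfolding I_def J_def A_def by auto
      then show ?thesis by blast
    next
      case 3 then have "t \<in> A None" unfolding A_def by simp
      then show ?thesis unfolding I_def by blast
    next
      case 4 then have "t \<in> A (Some None)" unfolding A_def by simp
      then show ?thesis unfolding I_def by blast
    qed (use no in blast)
  qed
  moreover have "tame (A i \<inter> {a<..<b})" for i
  proof -
    have "tame ({t. has_large_right_quotients g t} \<inter> {a<..<b})"
      "tame ({t. has_large_right_quotients (\<lambda>s. - g s) t} \<inter> {a<..<b})"
      unfolding has_large_right_quotients_def by (intro tame_Collect_in_interval definable_intros dg)+
    moreover have "tame ({t. jump_at up g (1 / real (Suc n)) q r t} \<inter> {a<..<b})" for up n q r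
      by (cases up; simp only: jump_at_def one_sided_defs if_True if_False;
          intro tame_Collect_in_interval definable_intros dg)
    ultimately show ?thesis unfolding A_def by (auto split: option.splits)
  qed
  ultimately obtain i c d where i: "i \<in> I" "c < d" "{c<..<d} \<subseteq> A i"
    using tame_cover_interval[OF ab(1) \<open>countable I\<close>] by metis
  from i(1) consider "i = None" | "i = Some None"
    | up n q r where "i = Some (Some (up, n, q, r))" "q < r" unfolding I_def J_def by auto
  then show False
  proof cases
    case 1
    then show False using no_interval_of_large_right_quotients[OF g i(2)] i(3) unfolding A_def by auto
  next
    case 2
    have "definable_term (\<lambda>e. - g (e 0))" by (intro definable_intros dg)
    from no_interval_of_large_right_quotients[OF this i(2)] show False using i(3) 2 unfolding A_def by auto
  next
    case (3 up n q r)
    define u where "u = (c + d) / 2"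
    define h where "h = min (d - u) (1 / real (Suc n)) / 2"
    have h: "h > 0" "h < 1 / real (Suc n)" "c < u" "u + h < d"
      unfolding h_def u_def using i(2) by (auto simp: min_def field_simps)
    then have "u \<in> A i" "u + h \<in> A i" using i(3) by auto
    then have J: "jump_at up g (1 / real (Suc n)) q r u" "jump_at up g (1 / real (Suc n)) q r (u + h)"
      unfolding 3 A_def by auto
    have "q * h < r * h" using 3(2) h(1) by simp
    show False
    proof (cases up)
      case True
      then have "r * h < g (u + h) - g u" "g (u + h) - g (u + h - h) \<le> q * h"
        using J h unfolding jump_at_def one_sided_defs by (metis (full_types))+
      then show False using \<open>q * h < r * h\<close> by simp
    next
      case False
      then have "g (u + h) - g u \<le> q * h" "r * h < g (u + h) - g (u + h - h)"
        using J h unfolding jump_at_def one_sided_defs by (metis (full_types))+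
      then show False using \<open>q * h < r * h\<close> by simp
    qed
  qed
qed

end

text \<open>
  The coordinates of the increment are switched on one after the other, with the mean value
  theorem applied to each.
\<close>

lemma has_derivative_if_partials_continuous:
  fixes h :: "real ^ 'n \<Rightarrow> real" and D :: "'n \<Rightarrow> real ^ 'n \<Rightarrow> real"
  assumes "open U" "x \<in> U"
    and partial: "\<And>y j. y \<in> U \<Longrightarrow> ((\<lambda>s. h (y + s *\<^sub>R axis j 1)) has_real_derivative D j y) (at 0)"
    and cont: "\<And>j. isCont (D j) x"
  shows "(h has_derivative (\<lambda>v. \<Sum>j\<in>UNIV. D j x * v $ j)) (at x)"
proof -
  have key: "\<exists>\<delta>>0. \<forall>v. norm v < \<delta> \<and> (\<forall>j. j \<notin> J \<longrightarrow> v $ j = 0) \<longrightarrow>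
      \<bar>h (x + v) - h x - (\<Sum>j\<in>J. D j x * v $ j)\<bar> \<le> \<epsilon> * norm v"
    if "finite J" "\<epsilon> > 0" for J \<epsilon>
    using that
  proof (induction arbitrary: \<epsilon>)
    case empty
    then have "\<forall>v. (\<forall>j. v $ j = 0) \<longrightarrow> v = (0 :: real ^ 'n)" by (simp add: vec_eq_iff)
    then show ?case by (intro exI[of _ 1]) auto
  next
    case (insert j J)
    from insert.IH[of "\<epsilon> / 2"] insert.prems obtain \<delta>1 where \<delta>1: "\<delta>1 > 0" "\<And>v. norm v < \<delta>1 \<Longrightarrow> (\<And>j. j \<notin> J \<Longrightarrow> v $ j = 0) \<Longrightarrow>
      \<bar>h (x + v) - h x - (\<Sum>j\<in>J. D j x * v $ j)\<bar> \<le> \<epsilon> / 2 * norm v"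
      by auto
    obtain \<delta>2 where \<delta>2: "\<delta>2 > 0" "\<And>y. dist y x < \<delta>2 \<Longrightarrow> \<bar>D j y - D j x\<bar> < \<epsilon> / 2"
      using cont[of j] insert.prems unfolding continuous_at_eps_delta dist_real_def by (metis half_gt_zero)
    obtain \<delta>3 where \<delta>3: "\<delta>3 > 0" "ball x \<delta>3 \<subseteq> U"
      using \<open>open U\<close> \<open>x \<in> U\<close> open_contains_ball by blast
    define \<delta> where "\<delta> = Min {\<delta>1, \<delta>2, \<delta>3}"
    have \<delta>: "\<delta> > 0" "\<delta> \<le> \<delta>1" "\<delta> \<le> \<delta>2" "\<delta> \<le> \<delta>3" unfolding \<delta>_def using \<delta>1 \<delta>2 \<delta>3 by auto
    have "\<bar>h (x + v) - h x - (\<Sum>j\<in>insert j J. D j x * v $ j)\<bar> \<le> \<epsilon> * norm v"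
      if v: "norm v < \<delta>" "\<And>i. i \<notin> insert j J \<Longrightarrow> v $ i = 0" for v
    proof -
      define w where "w = v - v $ j *\<^sub>R axis j 1"
      have w_nth: "w $ i = (if i = j then 0 else v $ i)" for i unfolding w_def by (simp add: axis_def)
      have norm_le: "norm (w + s *\<^sub>R axis j 1) \<le> norm v" if "\<bar>s\<bar> \<le> \<bar>v $ j\<bar>" for s
        using that by (intro norm_le_componentwise_cart) (auto simp: w_nth axis_def)
      have w: "norm w \<le> norm v" using norm_le[of 0] by simp
      have 1: "\<bar>h (x + w) - h x - (\<Sum>j\<in>J. D j x * w $ j)\<bar> \<le> \<epsilon> / 2 * norm w"
        using \<delta>1(2)[of w] w v \<delta> by (auto simp: w_nth)
      have sumeq: "(\<Sum>i\<in>J. D i x * w $ i) = (\<Sum>i\<in>J. D i x * v $ i)"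
        using insert.hyps by (intro sum.cong) (auto simp: w_nth)
      define \<psi> where "\<psi> = (\<lambda>s. h (x + w + s *\<^sub>R axis j 1) - D j x * s)"
      have near: "dist (x + w + s *\<^sub>R axis j 1) x < \<delta>" if "s \<in> closed_segment 0 (v $ j)" for s
      proof -
        have "\<bar>s\<bar> \<le> \<bar>v $ j\<bar>" using that by (auto simp: closed_segment_eq_real_ivl split: if_splits)
        then show ?thesis using norm_le[of s] v(1) by (simp add: dist_norm algebra_simps)
      qed
      have "norm (\<psi> (v $ j) - \<psi> 0) \<le> \<epsilon> / 2 * norm (v $ j - 0)"
      proof (rule field_differentiable_bound[where S = "closed_segment 0 (v $ j)"
            and f' = "\<lambda>s. D j (x + w + s *\<^sub>R axis j 1) - D j x"])
        fix s assume s: "s \<in> closed_segment 0 (v $ j)"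
        have "x + w + s *\<^sub>R axis j 1 \<in> U"
          using near[OF s] \<delta> \<delta>3 by (auto simp: subset_eq dist_commute)
        from partial[OF this, of j]
        have "((\<lambda>u. h (x + w + (u + s) *\<^sub>R axis j 1)) has_real_derivative D j (x + w + s *\<^sub>R axis j 1)) (at 0)"
          by (simp add: algebra_simps scaleR_add_left)
        then have "((\<lambda>u. h (x + w + u *\<^sub>R axis j 1)) has_real_derivative D j (x + w + s *\<^sub>R axis j 1)) (at s)"
          using DERIV_shift[of "\<lambda>u. h (x + w + u *\<^sub>R axis j 1)" _ 0 s] by simp
        then show "(\<psi> has_real_derivative D j (x + w + s *\<^sub>R axis j 1) - D j x) (at s within closed_segment 0 (v $ j))"
          unfolding \<psi>_def by (auto intro!: derivative_eq_intros intro: has_field_derivative_at_within)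
        show "norm (D j (x + w + s *\<^sub>R axis j 1) - D j x) \<le> \<epsilon> / 2"
          using \<delta>2(2)[of "x + w + s *\<^sub>R axis j 1"] near[OF s] \<delta> by auto
      qed auto
      also have "\<dots> \<le> \<epsilon> / 2 * norm v"
        using insert.prems component_le_norm_cart[of v j] by (intro mult_left_mono) auto
      finally have 2: "\<bar>h (x + v) - h (x + w) - D j x * v $ j\<bar> \<le> \<epsilon> / 2 * norm v"
        unfolding \<psi>_def w_def by (simp add: algebra_simps)
      have "\<epsilon> / 2 * norm w \<le> \<epsilon> / 2 * norm v" using w insert.prems by (intro mult_left_mono) auto
      moreover have "(\<Sum>i\<in>insert j J. D i x * v $ i) = D j x * v $ j + (\<Sum>i\<in>J. D i x * v $ i)"
        using insert.hyps by simp
      moreover have "\<epsilon> * norm v = \<epsilon> / 2 * norm v + \<epsilon> / 2 * norm v" by simp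
      ultimately show ?thesis using 1 2 unfolding sumeq by linarith
    qed
    then show ?case using \<delta>(1) by blast
  qed
  show ?thesis
    unfolding has_derivative_at_alt
  proof (intro conjI allI impI)
    show "bounded_linear (\<lambda>v. \<Sum>j\<in>UNIV. D j x * v $ j)"
      by (intro bounded_linear_sum bounded_linear_compose[OF bounded_linear_mult_right] bounded_linear_vec_nth)
    fix e :: real assume "0 < e"
    from key[of UNIV, OF finite this] obtain \<delta> where \<delta>: "\<delta> > 0" "\<And>v. norm v < \<delta> \<Longrightarrow>
      \<bar>h (x + v) - h x - (\<Sum>j\<in>UNIV. D j x * v $ j)\<bar> \<le> e * norm v" by auto
    show "\<exists>d>0. \<forall>y. norm (y - x) < d \<longrightarrow> norm (h y - h x - (\<Sum>j\<in>UNIV. D j x * (y - x) $ j)) \<le> e * norm (y - x)"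
      using \<delta>(1) \<delta>(2)[of "_ - x"] by (intro exI[of _ \<delta>]) auto
  qed
qed

context ominimal
begin

lemma definable_interior:
  assumes A: "definable (\<lambda>e. vec_of e \<in> (A :: (real ^ 'n) set))"
  shows "definable (\<lambda>e. vec_of e \<in> interior A)"
proof -
  have "x \<in> interior A \<longleftrightarrow> (\<exists>\<delta>>0. \<forall>y. norm (y - x) < \<delta> \<longrightarrow> y \<in> A)" for x
    unfolding mem_interior by (auto simp: subset_eq dist_norm norm_minus_commute)
  then show ?thesis by (simp only:) (intro definable_intros definable_mem[OF A])
qed

lemma negligible_diff_interior:
  assumes A: "definable (\<lambda>e. vec_of e \<in> (A :: (real ^ 'n) set))"
  shows "negligible (A - interior A)"
proof (rule definable_negligible_if_interior_empty)
  have "definable (\<lambda>e. vec_of e \<in> A \<and> \<not> vec_of e \<in> interior A)"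
    by (intro definable_intros A definable_interior)
  then show "definable (\<lambda>e. vec_of e \<in> A - interior A)" by simp
  show "interior (A - interior A) = {}"
  proof -
    have "interior (A - interior A) \<subseteq> interior A" by (rule interior_mono) auto
    moreover have "interior (A - interior A) \<subseteq> A - interior A" by (rule interior_subset)
    ultimately show ?thesis by blast
  qed
qed

lemma negligible_Compl_interior:
  assumes "definable (\<lambda>e. vec_of e \<in> (A :: (real ^ 'n) set))" "negligible (- A)"
  shows "negligible (- interior A)"
proof -
  have "- interior A \<subseteq> - A \<union> (A - interior A)" by auto
  then show ?thesis using assms negligible_diff_interior negligible_Un negligible_subset by metis
qed

lemma definable_isCont:
  assumes h: "definable_function (h :: real ^ 'n \<Rightarrow> real)"
  shows "definable (\<lambda>e. vec_of e \<in> {x. isCont h x})"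
proof -
  have "isCont h x \<longleftrightarrow> (\<forall>\<epsilon>>0. \<exists>\<delta>>0. \<forall>y. norm (y - x) < \<delta> \<longrightarrow> \<bar>h y - h x\<bar> < \<epsilon>)" for x
    unfolding continuous_at_eps_delta dist_norm by simp
  then show ?thesis
    by (simp only: mem_Collect_eq) (intro definable_intros definable_term_function[OF h])
qed

text \<open>
  At a discontinuity \<open>x\<close> a rational \<open>q\<close> separates \<open>h x\<close> from values of \<open>h\<close> taken arbitrarily near \<open>x\<close>, so
  that \<open>x\<close> lies in \<open>{h \<ge> q} \<inter> closure {h < q}\<close> or in the analogous set with the inequalities reversed.
  An open subset of \<open>{h \<ge> q}\<close> does not meet the closure of \<open>{h < q}\<close>; so these sets have no interior.
\<close>

lemma negligible_discontinuities:
  assumes h: "definable_function (h :: real ^ 'n \<Rightarrow> real)"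
  shows "negligible {x. \<not> isCont h x}"
proof -
  have cl: "x \<in> closure A \<longleftrightarrow> (\<forall>\<delta>>0. \<exists>y. norm (y - x) < \<delta> \<and> y \<in> A)" for x and A :: "(real ^ 'n) set"
    unfolding closure_approachable dist_norm by blast
  have int: "interior ({x. \<not> P x} \<inter> closure {x. P x}) = {}" for P :: "real ^ 'n \<Rightarrow> bool"
  proof -
    have "{x. \<not> P x} = - {x. P x}" by blast
    then have "interior ({x. \<not> P x} \<inter> closure {x. P x}) \<subseteq> - closure {x. P x}"
      by (simp add: interior_complement[symmetric] interior_Int)
    then show ?thesis using interior_subset by blast
  qed
  have neg: "negligible ({x. \<not> P x} \<inter> closure {x. P x})"
    if P: "\<And>v. definable_vec v \<Longrightarrow> definable (\<lambda>e. P (v e))" for P :: "real ^ 'n \<Rightarrow> bool"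
  proof (rule definable_negligible_if_interior_empty[OF _ int])
    have "definable (\<lambda>e. \<not> P (vec_of e) \<and> (\<forall>\<delta>>0. \<exists>y. norm (y - vec_of e) < \<delta> \<and> P y))"
      by (intro definable_intros P)
    then show "definable (\<lambda>e. vec_of e \<in> {x. \<not> P x} \<inter> closure {x. P x})"
      by (simp only: Int_iff cl mem_Collect_eq)
  qed
  have neg1: "negligible ({x. \<not> h x < q} \<inter> closure {x. h x < q})" for q
  proof (rule neg)
    fix v :: "_ \<Rightarrow> real ^ 'n" assume "definable_vec v"
    then show "definable (\<lambda>e. h (v e) < q)"
      by (intro definable_less definable_term_function[OF h] definable_term_const)
  qed
  have neg2: "negligible ({x. \<not> q < h x} \<inter> closure {x. q < h x})" for q
  proof (rule neg)
    fix v :: "_ \<Rightarrow> real ^ 'n" assume "definable_vec v"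
    then show "definable (\<lambda>e. q < h (v e))"
      by (intro definable_less definable_term_function[OF h] definable_term_const)
  qed
  define N where "N = (\<Union>q\<in>\<rat>. {x. \<not> h x < q} \<inter> closure {x. h x < q}) \<union>
      (\<Union>q\<in>\<rat>. {x. \<not> q < h x} \<inter> closure {x. q < h x})"
  have "negligible N"
    unfolding N_def
    by (intro negligible_Un negligible_countable_Union[where \<F> = "_ ` _"]) (auto simp: neg1 neg2 countable_rat)
  moreover have "{x. \<not> isCont h x} \<subseteq> N"
  proof (rule ccontr)
    assume "\<not> ?thesis"
    then obtain x where x: "\<not> isCont h x" "x \<notin> N" by blast
    have "isCont h x"
      unfolding continuous_at_eps_delta
    proof (intro allI impI)
      fix \<epsilon> :: real assume "\<epsilon> > 0"
      obtain q where q: "q \<in> \<rat>" "h x - \<epsilon> < q" "q < h x" using Rats_dense_in_real[of "h x - \<epsilon>" "h x"] \<open>\<epsilon> > 0\<close> by auto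
      obtain r where r: "r \<in> \<rat>" "h x < r" "r < h x + \<epsilon>" using Rats_dense_in_real[of "h x" "h x + \<epsilon>"] \<open>\<epsilon> > 0\<close> by auto
      have "x \<notin> closure {x. h x < q}" using x(2) q unfolding N_def by force
      then obtain \<delta> where \<delta>: "\<delta> > 0" "\<And>y. norm (y - x) < \<delta> \<Longrightarrow> \<not> h y < q" unfolding cl by auto
      have "x \<notin> closure {x. r < h x}" using x(2) r unfolding N_def by force
      then obtain \<delta>' where \<delta>': "\<delta>' > 0" "\<And>y. norm (y - x) < \<delta>' \<Longrightarrow> \<not> r < h y" unfolding cl by auto
      have "dist (h y) (h x) < \<epsilon>" if "dist y x < min \<delta> \<delta>'" for y
        using \<delta>(2)[of y] \<delta>'(2)[of y] that q r unfolding dist_norm by auto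
      then show "\<exists>d>0. \<forall>y. dist y x < d \<longrightarrow> dist (h y) (h x) < \<epsilon>"
        using \<delta>(1) \<delta>'(1) by (intro exI[of _ "min \<delta> \<delta>'"]) auto
    qed
    with x show False by blast
  qed
  ultimately show ?thesis by (rule negligible_subset)
qed

text \<open>
  Along each coordinate line a definable function is differentiable off a finite set, so the
  points without a \<open>j\<close>-th partial derivative form a set without interior. The partial derivatives
  are definable functions again, hence continuous almost everywhere. To get an open set of good
  points, the interior is taken, which loses only a null set.
\<close>

theorem definable_function_C1:
  fixes h :: "real ^ 'n \<Rightarrow> real"
  assumes h: "definable_function h"
  obtains U D where "open U" "negligible (- U)" "\<And>j. definable_function (D j)"
    "\<And>x j. x \<in> U \<Longrightarrow> isCont (D j) x"
    "\<And>x. x \<in> U \<Longrightarrow> (h has_derivative (\<lambda>v. (\<chi> j. D j x) \<bullet> v)) (at x)"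
proof -
  note dh = definable_term_function[OF h]
  define L where "L = (\<lambda>(j::'n) x d. quotient_limit (\<lambda>s. h (x + s *\<^sub>R axis j 1)) 0 d)"
  define D where "D = (\<lambda>j x. if \<exists>d. L j x d then THE d. L j x d else 0)"
  have L_deriv: "L j x d \<longleftrightarrow> ((\<lambda>s. h (x + s *\<^sub>R axis j 1)) has_real_derivative d) (at 0)" for j x d
    unfolding L_def quotient_limit_iff ..
  then have uniq: "d = d'" if "L j x d" "L j x d'" for j x d d'
    using that DERIV_unique by blast
  have LD: "L j x (D j x)" if "\<exists>d. L j x d" for j x
    using that uniq unfolding D_def by (simp, metis theI')
  have dD: "definable_function (D j)" for j
    unfolding definable_function_def
  proof (rule definable_termI)
    show "definable (\<lambda>e. L j (vec_of (\<lambda>i. e (Suc i))) (e 0) \<or> \<not> (\<exists>d. L j (vec_of (\<lambda>i. e (Suc i))) d) \<and> e 0 = 0)"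
      unfolding L_def quotient_limit_def by (intro definable_intros dh)
    show "L j (vec_of e) t \<or> \<not> (\<exists>d. L j (vec_of e) d) \<and> t = 0 \<longleftrightarrow> t = D j (vec_of e)" for e t
      using LD[of j "vec_of e"] uniq[of j "vec_of e"] unfolding D_def by auto
  qed
  have d1: "definable (\<lambda>e. vec_of e \<in> {x. \<exists>d. L j x d})" for j
    unfolding mem_Collect_eq L_def quotient_limit_def by (intro definable_intros dh)
  have n1: "negligible (- {x. \<exists>d. L j x d})" for j
  proof (rule definable_negligible_if_interior_empty)
    show "definable (\<lambda>e. vec_of e \<in> - {x. \<exists>d. L j x d})"
      using definable_not[OF d1[of j]] by simp
    show "interior (- {x. \<exists>d. L j x d}) = {}"
    proof (rule ccontr)
      assume "interior (- {x. \<exists>d. L j x d}) \<noteq> {}"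
      then obtain x r where r: "r > 0" "ball x r \<subseteq> - {x. \<exists>d. L j x d}"
        by (metis ex_in_conv mem_interior)
      define g where "g = (\<lambda>s. h (x + s *\<^sub>R axis j 1))"
      have "definable_term (\<lambda>e. g (e 0))" unfolding g_def by (intro dh definable_intros)
      from finite_no_quotient_limit[OF this] have "finite {t. \<nexists>d. quotient_limit g t d}" .
      moreover have "{-r<..<r} \<subseteq> {t. \<nexists>d. quotient_limit g t d}"
      proof
        fix t assume "t \<in> {-r<..<r}"
        then have "x + t *\<^sub>R axis j 1 \<in> ball x r" by (auto simp: dist_norm)
        then have "\<nexists>d. L j (x + t *\<^sub>R axis j 1) d" using r(2) by blast
        moreover have "quotient_limit g t d = L j (x + t *\<^sub>R axis j 1) d" for d
          unfolding L_def quotient_limit_def g_def by (simp add: algebra_simps)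
        ultimately show "t \<in> {t. \<nexists>d. quotient_limit g t d}" by simp
      qed
      ultimately have "finite {-r<..<r}" using finite_subset by blast
      then show False using r(1) using infinite_Ioo[of "-r" r] by simp
    qed
  qed
  define A where "A = (\<lambda>j. {x. \<exists>d. L j x d} \<inter> {x. isCont (D j) x})"
  have dA: "definable (\<lambda>e. vec_of e \<in> A j)" for j
    unfolding A_def Int_iff by (intro definable_conj d1 definable_isCont dD)
  have "negligible (- A j)" for j
  proof -
    have "- A j = - {x. \<exists>d. L j x d} \<union> {x. \<not> isCont (D j) x}" unfolding A_def by blast
    then show ?thesis using n1[of j] negligible_discontinuities[OF dD[of j]] by (metis negligible_Un)
  qed
  then have nA: "negligible (- interior (A j))" for j using negligible_Compl_interior[OF dA] by blast
  define U where "U = (\<Inter>j\<in>UNIV. interior (A j))"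
  have "- U = \<Union> (range (\<lambda>j. - interior (A j)))" unfolding U_def by blast
  then have "negligible (- U)" using nA by (auto intro!: negligible_Union)
  moreover have "open U" unfolding U_def by (intro open_INT) auto
  moreover have UA: "x \<in> A j" if "x \<in> U" for x j using that interior_subset unfolding U_def by blast
  moreover have "(h has_derivative (\<lambda>v. (\<chi> j. D j x) \<bullet> v)) (at x)" if "x \<in> U" for x
  proof -
    have "(h has_derivative (\<lambda>v. \<Sum>j\<in>UNIV. D j x * v $ j)) (at x)"
      using \<open>open U\<close> that
    proof (rule has_derivative_if_partials_continuous)
      fix y j assume "y \<in> U"
      then show "((\<lambda>s. h (y + s *\<^sub>R axis j 1)) has_real_derivative D j y) (at 0)"
        using UA[of y j] LD unfolding A_def L_deriv[symmetric] by blast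
    qed (use UA[OF that] in \<open>auto simp: A_def\<close>)
    then show ?thesis by (simp add: inner_vec_def)
  qed
  ultimately show thesis using that[of U D] dD unfolding A_def by blast
qed

end

section \<open>Regular and limiting subgradients\<close>

lemma regular_subgradient_lower_bound:
  assumes "v \<in> regular_subdifferential f z" "c > 0"
  shows "\<exists>\<delta>>0. \<forall>y. norm (y - z) < \<delta> \<longrightarrow> f y \<ge> f z + v \<bullet> (y - z) - c * norm (y - z)"
proof -
  obtain r where r: "r \<in> o[at z](\<lambda>x. norm (x - z))"
    "\<forall>\<^sub>F x in at z. f x \<ge> f z + v \<bullet> (x - z) + r x"
    using assms(1) unfolding regular_subdifferential_def by blast
  have "\<forall>\<^sub>F x in at z. norm (r x) \<le> c * norm (norm (x - z))"
    using landau_o.smallD[OF r(1) assms(2)] .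
  with r(2) have "\<forall>\<^sub>F x in at z. f x \<ge> f z + v \<bullet> (x - z) - c * norm (x - z)"
    by eventually_elim auto
  then obtain \<delta> where "\<delta> > 0" "\<And>x. x \<noteq> z \<Longrightarrow> dist x z < \<delta> \<Longrightarrow> f x \<ge> f z + v \<bullet> (x - z) - c * norm (x - z)"
    unfolding eventually_at by auto
  then have "f y \<ge> f z + v \<bullet> (y - z) - c * norm (y - z)" if "norm (y - z) < \<delta>" for y
    using that by (cases "y = z") (auto simp: dist_norm)
  then show ?thesis using \<open>\<delta> > 0\<close> by blast
qed

text \<open>
  The inequality that defines a regular subgradient is used on both sides of the parameter 0 and
  thus yields an equation. It will be applied to straight lines, where it identifies the gradient,
  and to curves inside an orbit of a symmetry group of \<open>f\<close>.
\<close>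

lemma regular_subgradient_along_curve:
  fixes f :: "'a::euclidean_space \<Rightarrow> real"
  assumes v: "v \<in> regular_subdifferential f (\<gamma> 0)"
    and \<gamma>: "(\<gamma> has_vector_derivative w) (at 0)"
    and f\<gamma>: "((\<lambda>t. f (\<gamma> t)) has_real_derivative d) (at 0)"
  shows "v \<bullet> w = d"
proof -
  define \<phi> where "\<phi> = (\<lambda>t. f (\<gamma> t) - v \<bullet> \<gamma> t)"
  define e where "e = d - v \<bullet> w"
  define K where "K = norm w + 2"
  have K: "K > 0" unfolding K_def by (simp add: add_nonneg_pos)
  have "((\<lambda>t. v \<bullet> \<gamma> t) has_real_derivative v \<bullet> w) (at 0)"
    unfolding has_real_derivative_iff_has_vector_derivative
    using bounded_linear.has_vector_derivative[OF bounded_linear_inner_right \<gamma>] .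
  then have \<phi>: "quotient_limit \<phi> 0 e"
    unfolding quotient_limit_iff \<phi>_def e_def by (intro DERIV_diff f\<gamma>)
  have bound: "\<bar>e\<bar> \<le> c * K" if c: "c > 0" for c
  proof -
    obtain \<delta>1 where \<delta>1: "\<delta>1 > 0" "\<And>y. norm (y - \<gamma> 0) < \<delta>1 \<Longrightarrow> f y \<ge> f (\<gamma> 0) + v \<bullet> (y - \<gamma> 0) - c * norm (y - \<gamma> 0)"
      using regular_subgradient_lower_bound[OF v c] by blast
    obtain \<delta>2 where \<delta>2: "\<delta>2 > 0" "\<And>t. \<bar>t\<bar> < \<delta>2 \<Longrightarrow> norm (\<gamma> t - \<gamma> 0 - t *\<^sub>R w) \<le> 1 * \<bar>t\<bar>"
      using \<gamma> unfolding has_vector_derivative_def has_derivative_at_alt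
      by (metis diff_zero real_norm_def zero_less_one)
    obtain \<delta>3 where \<delta>3: "\<delta>3 > 0" "\<And>t. \<bar>t\<bar> < \<delta>3 \<Longrightarrow> \<bar>\<phi> (0 + t) - \<phi> 0 - e * t\<bar> \<le> c * \<bar>t\<bar>"
      using \<phi> c unfolding quotient_limit_def by blast
    have \<gamma>_le: "norm (\<gamma> t - \<gamma> 0) \<le> (norm w + 1) * \<bar>t\<bar>" if "\<bar>t\<bar> < \<delta>2" for t
    proof -
      have "norm (\<gamma> t - \<gamma> 0) \<le> norm (\<gamma> t - \<gamma> 0 - t *\<^sub>R w) + norm (t *\<^sub>R w)"
        by (metis diff_add_cancel norm_triangle_ineq)
      then show ?thesis using \<delta>2(2)[OF that] by (simp add: algebra_simps)
    qed
    have "\<delta>1 / K > 0" using \<delta>1(1) K by simp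
    from field_lbound_gt_zero[OF this] obtain t where t: "t > 0" "t < \<delta>1 / K" "t < \<delta>2" "t < \<delta>3"
      using \<delta>2(1) \<delta>3(1) by (metis field_lbound_gt_zero less_trans)
    have *: "\<phi> s - \<phi> 0 \<ge> - c * (norm w + 1) * t" if "\<bar>s\<bar> = t" for s
    proof -
      have n: "norm (\<gamma> s - \<gamma> 0) \<le> (norm w + 1) * t" using \<gamma>_le[of s] that t by auto
      also have "\<dots> \<le> K * t" unfolding K_def using t by (intro mult_right_mono) auto
      also have "K * t < \<delta>1" using t(2) K by (simp add: field_simps)
      finally have "f (\<gamma> s) \<ge> f (\<gamma> 0) + v \<bullet> (\<gamma> s - \<gamma> 0) - c * norm (\<gamma> s - \<gamma> 0)" by (rule \<delta>1(2))
      moreover have "c * norm (\<gamma> s - \<gamma> 0) \<le> c * ((norm w + 1) * t)"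
        using n \<open>c > 0\<close> by (intro mult_left_mono) auto
      ultimately show ?thesis unfolding \<phi>_def by (simp add: inner_diff_right algebra_simps)
    qed
    have "\<bar>\<phi> (0 + t) - \<phi> 0 - e * t\<bar> \<le> c * t" "\<bar>\<phi> (0 + (-t)) - \<phi> 0 - e * (-t)\<bar> \<le> c * t"
      using \<delta>3(2)[of t] \<delta>3(2)[of "-t"] t by auto
    moreover have "\<phi> t - \<phi> 0 \<ge> - c * (norm w + 1) * t" "\<phi> (-t) - \<phi> 0 \<ge> - c * (norm w + 1) * t"
      using *[of t] *[of "-t"] t by auto
    ultimately have "\<bar>e * t\<bar> \<le> c * (norm w + 1) * t + c * t" by (simp add: abs_le_iff)
    also have "\<dots> = c * K * t" unfolding K_def by (simp add: algebra_simps)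
    finally show ?thesis using t(1) by (simp add: abs_mult)
  qed
  have "\<bar>e\<bar> \<le> 0"
  proof (rule field_le_epsilon)
    fix \<epsilon> :: real assume "\<epsilon> > 0"
    then show "\<bar>e\<bar> \<le> 0 + \<epsilon>" using bound[of "\<epsilon> / K"] K by simp
  qed
  then show ?thesis unfolding e_def by simp
qed

lemma regular_subgradient_eq_gradient:
  fixes f :: "'a::euclidean_space \<Rightarrow> real"
  assumes v: "v \<in> regular_subdifferential f z" and f: "(f has_derivative (\<lambda>w. g \<bullet> w)) (at z)"
  shows "v = g"
proof -
  have "v \<bullet> w = g \<bullet> w" for w
  proof (rule regular_subgradient_along_curve[where \<gamma> = "\<lambda>t. z + t *\<^sub>R w" and f = f])
    show "v \<in> regular_subdifferential f (z + 0 *\<^sub>R w)" using v by simp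
    show "((\<lambda>t. z + t *\<^sub>R w) has_vector_derivative w) (at 0)"
      by (auto intro!: derivative_eq_intros)
    have "((\<lambda>t. f (z + t *\<^sub>R w)) has_derivative (\<lambda>t. g \<bullet> (t *\<^sub>R w))) (at 0)"
      by (rule has_derivative_compose[of "\<lambda>t. z + t *\<^sub>R w" _ _ _ f])
         (use f in \<open>auto intro!: derivative_eq_intros\<close>)
    then show "((\<lambda>t. f (z + t *\<^sub>R w)) has_real_derivative g \<bullet> w) (at 0)"
      unfolding has_field_derivative_def by (simp add: mult_commute_abs)
  qed
  then show ?thesis by (metis vector_eq_rdot)
qed

lemma subdifferential_eq_gradient:
  fixes f :: "'a::euclidean_space \<Rightarrow> real"
  assumes "open U" "z \<in> U" and f: "\<And>x. x \<in> U \<Longrightarrow> (f has_derivative (\<lambda>w. g x \<bullet> w)) (at x)"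
    and g: "isCont g z" and v: "v \<in> subdifferential f z"
  shows "v = g z"
proof -
  obtain X V where XV: "\<And>k::nat. V k \<in> regular_subdifferential f (X k)" "X \<longlonglongrightarrow> z" "V \<longlonglongrightarrow> v"
    using v unfolding subdifferential_def by blast
  have "\<forall>\<^sub>F k in sequentially. X k \<in> U" using XV(2) assms(1,2) by (rule topological_tendstoD)
  then have "\<forall>\<^sub>F k in sequentially. g (X k) = V k"
    by eventually_elim (metis regular_subgradient_eq_gradient XV(1) f)
  moreover have "(\<lambda>k. g (X k)) \<longlonglongrightarrow> g z" using g XV(2) by (rule isCont_tendsto_compose)
  ultimately have "V \<longlonglongrightarrow> g z" by (rule Lim_transform_eventually[rotated])
  then show ?thesis using XV(3) LIMSEQ_unique by blast
qed

lemma subdifferential_bounded: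
  fixes f :: "'a::euclidean_space \<Rightarrow> real"
  assumes f: "L-lipschitz_on (ball z r) f" and x: "x \<in> ball z r" and v: "v \<in> subdifferential f x"
  shows "norm v \<le> L"
proof -
  have regular: "norm v \<le> L" if x: "x \<in> ball z r" and v: "v \<in> regular_subdifferential f x" for x v
  proof (rule field_le_epsilon)
    fix c :: real assume "c > 0"
    obtain \<delta> where \<delta>: "\<delta> > 0" "\<And>y. norm (y - x) < \<delta> \<Longrightarrow> f y \<ge> f x + v \<bullet> (y - x) - c * norm (y - x)"
      using regular_subgradient_lower_bound[OF v \<open>c > 0\<close>] by blast
    obtain e where e: "e > 0" "ball x e \<subseteq> ball z r" using x open_ball open_contains_ball by blast
    show "norm v \<le> L + c"
    proof (cases "v = 0")
      case True
      then show ?thesis using lipschitz_on_nonneg[OF f] \<open>c > 0\<close> by simp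
    next
      case False
      define t where "t = min \<delta> e / (2 * norm v)"
      have t: "t > 0" "t * norm v < \<delta>" "t * norm v < e"
        unfolding t_def using False \<delta>(1) e(1) by (auto simp: min_def)
      define y where "y = x + t *\<^sub>R v"
      have ny: "norm (y - x) = t * norm v" unfolding y_def using t(1) by simp
      then have "y \<in> ball x e" using t(3) by (simp add: dist_norm norm_minus_commute)
      then have "y \<in> ball z r" using e(2) by blast
      then have "f y - f x \<le> L * (t * norm v)"
        using lipschitz_onD[OF f _ x, of y] ny by (simp add: dist_norm)
      moreover have "f y \<ge> f x + v \<bullet> (y - x) - c * (t * norm v)" using \<delta>(2)[of y] ny t(2) by simp
      moreover have "v \<bullet> (y - x) = (t * norm v) * norm v" unfolding y_def by (simp add: power2_norm_eq_inner[symmetric] power2_eq_square)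
      ultimately have "(t * norm v) * norm v \<le> (t * norm v) * (L + c)" by (simp add: algebra_simps)
      then show ?thesis using t(1) False by (simp add: mult_le_cancel_left)
    qed
  qed
  obtain X V where XV: "\<And>k::nat. V k \<in> regular_subdifferential f (X k)" "X \<longlonglongrightarrow> x" "V \<longlonglongrightarrow> v"
    using v unfolding subdifferential_def by blast
  have "\<forall>\<^sub>F k in sequentially. X k \<in> ball z r" using XV(2) x by (intro topological_tendstoD) auto
  then have "\<forall>\<^sub>F k in sequentially. norm (V k) \<le> L" by eventually_elim (rule regular[OF _ XV(1)])
  then show ?thesis using tendsto_upperbound[OF tendsto_norm[OF XV(3)]] by simp
qed

text \<open>
  A diagonal sequence of regular subgradients; continuity of \<open>f\<close> supplies the convergence of the
  values.
\<close>

lemma subdifferential_closed_graph: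
  fixes f :: "'a::euclidean_space \<Rightarrow> real"
  assumes f: "continuous_on UNIV f" and v: "\<And>k::nat. v k \<in> subdifferential f (x k)"
    and lim: "x \<longlonglongrightarrow> a" "v \<longlonglongrightarrow> b"
  shows "b \<in> subdifferential f a"
proof -
  have "\<exists>X V. V \<in> regular_subdifferential f X \<and> dist X (x k) < 1 / real (Suc k) \<and> dist V (v k) < 1 / real (Suc k)" for k
  proof -
    obtain X V where XV: "\<And>i::nat. V i \<in> regular_subdifferential f (X i)" "X \<longlonglongrightarrow> x k" "V \<longlonglongrightarrow> v k"
      using v[of k] unfolding subdifferential_def by blast
    have "\<forall>\<^sub>F i in sequentially. dist (X i) (x k) < 1 / real (Suc k)"
      "\<forall>\<^sub>F i in sequentially. dist (V i) (v k) < 1 / real (Suc k)"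
      using XV(2,3) by (auto intro: tendstoD)
    then have "\<forall>\<^sub>F i in sequentially. dist (X i) (x k) < 1 / real (Suc k) \<and> dist (V i) (v k) < 1 / real (Suc k)"
      by eventually_elim simp
    then obtain i where "dist (X i) (x k) < 1 / real (Suc k) \<and> dist (V i) (v k) < 1 / real (Suc k)"
      by (auto simp: eventually_sequentially)
    then show ?thesis using XV(1) by blast
  qed
  then obtain X V where XV: "\<And>k. V k \<in> regular_subdifferential f (X k)"
    "\<And>k. dist (X k) (x k) < 1 / real (Suc k)" "\<And>k. dist (V k) (v k) < 1 / real (Suc k)"
    by metis
  have inv0: "(\<lambda>k. 1 / real (Suc k)) \<longlonglongrightarrow> 0" using LIMSEQ_inverse_real_of_nat by (simp add: inverse_eq_divide)
  have squeeze: "g \<longlonglongrightarrow> 0" if "\<And>k. 0 \<le> g k" "\<And>k. g k < 1 / real (Suc k)" for g :: "nat \<Rightarrow> real"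
    by (rule tendsto_sandwich[OF _ _ tendsto_const inv0])
       (use that in \<open>auto intro!: always_eventually less_imp_le simp del: of_nat_Suc\<close>)
  have "(\<lambda>k. dist (X k) (x k)) \<longlonglongrightarrow> 0" "(\<lambda>k. dist (V k) (v k)) \<longlonglongrightarrow> 0"
    by (rule squeeze; use XV in simp)+
  then have "(\<lambda>k. X k - x k) \<longlonglongrightarrow> 0" "(\<lambda>k. V k - v k) \<longlonglongrightarrow> 0"
    unfolding dist_norm by (auto dest: tendsto_norm_zero_cancel)
  from tendsto_add[OF this(1) lim(1)] tendsto_add[OF this(2) lim(2)]
  have "X \<longlonglongrightarrow> a" "V \<longlonglongrightarrow> b" by simp_all
  moreover have "(\<lambda>k. f (X k)) \<longlonglongrightarrow> f a"
    using f \<open>X \<longlonglongrightarrow> a\<close> by (simp add: continuous_on_eq_continuous_at isCont_tendsto_compose)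
  ultimately show ?thesis using XV(1) unfolding subdifferential_def by blast
qed

lemma zero_subgradient_at_local_constancy:
  fixes f :: "'a::euclidean_space \<Rightarrow> real"
  assumes "open U" "x \<in> U" "\<And>y. y \<in> U \<Longrightarrow> f y = f x"
  shows "0 \<in> subdifferential f x"
proof -
  have "\<forall>\<^sub>F y in at x. y \<in> U" using assms(1,2) by (rule eventually_at_in_open')
  then have "\<forall>\<^sub>F y in at x. f y \<ge> f x + 0 \<bullet> (y - x) + 0" by eventually_elim (simp add: assms(3))
  then have "0 \<in> regular_subdifferential f x"
    unfolding regular_subdifferential_def by (auto intro!: exI[of _ "\<lambda>_. 0"])
  then show ?thesis unfolding subdifferential_def 
    by (intro CollectI exI[of _ "\<lambda>_. x"] exI[of _ "\<lambda>_. 0"] conjI allI tendsto_const)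
qed

lemma locally_Lipschitz_continuous:
  fixes f :: "'a::metric_space \<Rightarrow> 'b::metric_space"
  assumes "locally_Lipschitz f" shows "continuous_on UNIV f"
proof (rule continuous_at_imp_continuous_on, rule ballI)
  fix x
  obtain \<epsilon> L where "\<epsilon> > 0" "L-lipschitz_on (ball x \<epsilon>) f"
    using assms unfolding locally_Lipschitz_def by blast
  then show "isCont f x"
    by (intro continuous_on_interior[OF lipschitz_on_continuous_on[of L "ball x \<epsilon>" f]])
       (simp_all add: interior_open)
qed

section \<open>Preimages of null sets under a subgradient step\<close>

text \<open>
  Negated: \<open>\<Phi>\<close> is bounded below at \<open>x\<close> by a multiple of the distance. As a first-order formula in the
  values of \<open>\<Phi>\<close>, it makes sense, and is definable, where \<open>\<Phi>\<close> is not known to be differentiable.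
\<close>

definition not_expanding_at :: "('a::real_normed_vector \<Rightarrow> 'a) \<Rightarrow> 'a \<Rightarrow> bool" where
  "not_expanding_at \<Phi> x \<longleftrightarrow> (\<forall>\<epsilon>>0. \<exists>y. norm (y - x) < \<epsilon> \<and> norm (\<Phi> y - \<Phi> x) < \<epsilon> * norm (y - x))"

text \<open>
  On the set where \<open>\<Phi>\<close> expands with a fixed constant at a fixed scale, cut into small pieces, \<open>\<Phi>\<close> is
  injective with Lipschitz inverse, and Lipschitz images of null sets are null.
\<close>

lemma negligible_preimage_if_expanding:
  fixes \<Phi> :: "'a::euclidean_space \<Rightarrow> 'a"
  assumes N: "negligible N"
  shows "negligible {x. \<Phi> x \<in> N \<and> \<not> not_expanding_at \<Phi> x}"
proof -
  define E where "E = (\<lambda>m::nat. {x. \<Phi> x \<in> N \<and> (\<forall>y. norm (y - x) < 1 / real (Suc m) \<longrightarrow>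
     1 / real (Suc m) * norm (y - x) \<le> norm (\<Phi> y - \<Phi> x))})"
  have "negligible (E m)" for m
  proof (subst locally_negligible_alt, rule ballI)
    fix x assume x: "x \<in> E m"
    define \<epsilon> where "\<epsilon> = 1 / real (Suc m)"
    have \<epsilon>: "\<epsilon> > 0" unfolding \<epsilon>_def by simp
    define U where "U = E m \<inter> ball x (\<epsilon> / 2)"
    have exp: "\<epsilon> * norm (y - z) \<le> norm (\<Phi> y - \<Phi> z)" if "y \<in> U" "z \<in> U" for y z
    proof -
      have "dist y z < \<epsilon>" using that unfolding U_def
        by (metis IntD2 dist_triangle_half_r mem_ball)
      then show ?thesis using that unfolding U_def E_def \<epsilon>_def by (auto simp: dist_norm)
    qed
    have inj: "inj_on \<Phi> U"
    proof (rule inj_onI)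
      fix y z assume "y \<in> U" "z \<in> U" "\<Phi> y = \<Phi> z"
      then show "y = z" using exp[of y z] \<epsilon> by (simp add: mult_le_0_iff)
    qed
    define \<Psi> where "\<Psi> = inv_into U \<Phi>"
    have \<Psi>: "\<Psi> (\<Phi> y) = y" if "y \<in> U" for y unfolding \<Psi>_def using inj that by simp
    have "negligible (\<Psi> ` (\<Phi> ` U))"
    proof (rule negligible_locally_Lipschitz_image)
      show "negligible (\<Phi> ` U)" by (rule negligible_subset[OF N]) (auto simp: U_def E_def)
      fix p assume "p \<in> \<Phi> ` U"
      then obtain z where z: "z \<in> U" "p = \<Phi> z" by blast
      have "norm (\<Psi> q - \<Psi> p) \<le> (1 / \<epsilon>) * norm (q - p)" if "q \<in> \<Phi> ` U" for q
        using that z exp \<epsilon> by (auto simp: \<Psi> field_simps)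
      then show "\<exists>T B. open T \<and> p \<in> T \<and> (\<forall>q\<in>\<Phi> ` U \<inter> T. norm (\<Psi> q - \<Psi> p) \<le> B * norm (q - p))"
        by (intro exI[of _ UNIV] exI[of _ "1 / \<epsilon>"]) auto
    qed auto
    moreover have "\<Psi> ` (\<Phi> ` U) = U" using \<Psi> by (force simp: image_iff)
    ultimately have "negligible U" by simp
    moreover have "openin (top_of_set (E m)) U" unfolding U_def by (simp add: openin_open_Int)
    moreover have "x \<in> U" unfolding U_def using x \<epsilon> by simp
    ultimately show "\<exists>U. openin (top_of_set (E m)) U \<and> x \<in> U \<and> negligible U" by blast
  qed
  then have "negligible (\<Union>m. E m)" by (intro negligible_countable_Union[where \<F> = "range E"]) auto
  then show ?thesis
  proof (rule negligible_subset, intro subsetI)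
    fix x assume "x \<in> {x. \<Phi> x \<in> N \<and> \<not> not_expanding_at \<Phi> x}"
    then obtain \<epsilon> where \<epsilon>0: "\<Phi> x \<in> N" "\<epsilon> > 0" "\<forall>y. norm (y - x) < \<epsilon> \<longrightarrow> \<not> norm (\<Phi> y - \<Phi> x) < \<epsilon> * norm (y - x)"
      unfolding not_expanding_at_def by blast
    have \<epsilon>: "\<Phi> x \<in> N" "\<epsilon> > 0" "\<And>y. norm (y - x) < \<epsilon> \<Longrightarrow> \<epsilon> * norm (y - x) \<le> norm (\<Phi> y - \<Phi> x)"
      using \<epsilon>0 by (auto simp: not_less)
    obtain m where m: "1 / real (Suc m) < \<epsilon>" using inverse_Suc_below[OF \<epsilon>(2)] by blast
    have "1 / real (Suc m) * norm (y - x) \<le> norm (\<Phi> y - \<Phi> x)" if "norm (y - x) < 1 / real (Suc m)" for y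
    proof -
      have "1 / real (Suc m) * norm (y - x) \<le> \<epsilon> * norm (y - x)" using m by (intro mult_right_mono) auto
      also have "\<dots> \<le> norm (\<Phi> y - \<Phi> x)" using \<epsilon>(3) that m by simp
      finally show ?thesis .
    qed
    then have "x \<in> E m" unfolding E_def using \<epsilon>(1) by blast
    then show "x \<in> (\<Union>m. E m)" by blast
  qed
qed

text \<open>
  The determinant of \<open>1 - \<alpha> H\<close> is a polynomial in \<open>\<alpha>\<close> with value 1 at \<open>\<alpha> = 0\<close>.
\<close>

lemma finite_reciprocal_eigenvalues:
  fixes H :: "real ^ 'n \<Rightarrow> real ^ 'n"
  assumes H: "linear H"
  shows "finite {\<alpha>. \<exists>v. v \<noteq> 0 \<and> v - \<alpha> *\<^sub>R H v = 0}"
proof -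
  define A where "A = matrix H"
  define p where "p = (\<Sum>\<pi>\<in>{\<pi>. \<pi> permutes (UNIV :: 'n set)}. of_int (sign \<pi>) *
      (\<Prod>i\<in>UNIV. [: if i = \<pi> i then 1 else 0, - A $ i $ \<pi> i :]))"
  have p: "poly p \<alpha> = det (mat 1 - \<alpha> *\<^sub>R A)" for \<alpha>
    unfolding p_def det_def by (simp add: poly_sum poly_prod mat_def algebra_simps)
  have "poly p 0 = 1" unfolding p by simp
  then have "p \<noteq> 0" by auto
  then have "finite {\<alpha>. poly p \<alpha> = 0}" by (rule poly_roots_finite)
  moreover
  have "poly p \<alpha> = 0" if v: "v \<noteq> 0" "v - \<alpha> *\<^sub>R H v = 0" for \<alpha> v
  proof (rule ccontr)
    assume "poly p \<alpha> \<noteq> 0"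
    then have "invertible (mat 1 - \<alpha> *\<^sub>R A)" unfolding p invertible_det_nz .
    moreover have "(mat 1 - \<alpha> *\<^sub>R A) *v v = 0"
      using v(2) matrix_works[OF H[folded linear_matrix_vector_mul_eq]] H
      by (simp add: A_def matrix_vector_mult_diff_rdistrib scaleR_matrix_vector_assoc[symmetric] matrix_works)
    ultimately show False using v(1) by (metis invertible_left_inverse matrix_left_invertible_ker)
  qed
  then have "{\<alpha>. \<exists>v. v \<noteq> 0 \<and> v - \<alpha> *\<^sub>R H v = 0} \<subseteq> {\<alpha>. poly p \<alpha> = 0}" by blast
  ultimately show ?thesis by (rule finite_subset[rotated])
qed

lemma singular_derivative_if_not_expanding:
  fixes \<Phi> :: "'a::euclidean_space \<Rightarrow> 'a"
  assumes \<Phi>: "(\<Phi> has_derivative L) (at x)" and x: "not_expanding_at \<Phi> x"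
  shows "\<exists>v. v \<noteq> 0 \<and> L v = 0"
proof (rule ccontr)
  have L: "linear L" using \<Phi> has_derivative_linear by blast
  assume "\<nexists>v. v \<noteq> 0 \<and> L v = 0"
  then have "inj L" using linear_injective_0[OF L] by blast
  then obtain B where B: "B > 0" "\<And>v. B * norm v \<le> norm (L v)"
    using linear_inj_bounded_below_pos[OF L] by blast
  obtain d where d: "d > 0" "\<And>y. norm (y - x) < d \<Longrightarrow> norm (\<Phi> y - \<Phi> x - L (y - x)) \<le> B / 2 * norm (y - x)"
    using \<Phi> B(1) unfolding has_derivative_at_alt by (metis half_gt_zero)
  obtain y where y: "norm (y - x) < min d (B / 2)" "norm (\<Phi> y - \<Phi> x) < min d (B / 2) * norm (y - x)"
    using x d(1) B(1) unfolding not_expanding_at_def by (metis half_gt_zero min_less_iff_conj)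
  have "B * norm (y - x) \<le> norm (L (y - x))" by (rule B(2))
  also have "\<dots> \<le> norm (\<Phi> y - \<Phi> x) + norm (\<Phi> y - \<Phi> x - L (y - x))"
    by (metis norm_triangle_sub norm_minus_commute add.commute)
  also have "\<dots> < min d (B / 2) * norm (y - x) + B / 2 * norm (y - x)"
    using y d(2)[of y] by auto
  also have "\<dots> \<le> B / 2 * norm (y - x) + B / 2 * norm (y - x)"
    by (intro add_mono mult_right_mono) auto
  finally show False by simp
qed

context ominimal
begin

text \<open>
  A step size is bad if the points of collapse contain a ball. If infinitely many were bad, then
  an interval of them would be, by tameness, and on a smaller interval the ball can be chosen
  independently of \<open>\<alpha>\<close>, with centre in a countable dense set and rational radius. But \<open>\<gamma>\<close> is
  differentiable at almost every point of that ball, and at a single such point the derivative of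
  \<open>x - \<alpha> \<gamma>(x)\<close> is singular for finitely many \<open>\<alpha>\<close> only.
\<close>

lemma finite_step_sizes_with_collapse:
  fixes \<gamma> :: "real ^ 'n \<Rightarrow> real ^ 'n"
  assumes \<gamma>: "\<And>j. definable_function (\<lambda>x. \<gamma> x $ j)"
  shows "finite {\<alpha>. \<not> negligible {x. not_expanding_at (\<lambda>x. x - \<alpha> *\<^sub>R \<gamma> x) x}}"
proof (rule ccontr)
  define Z where "Z = (\<lambda>x \<alpha>. not_expanding_at (\<lambda>x. x - \<alpha> *\<^sub>R \<gamma> x) x)"
  have d\<gamma>: "definable_vec v \<Longrightarrow> definable_vec (\<lambda>e. \<gamma> (v e))" for v :: "_ \<Rightarrow> real ^ 'n"
    unfolding definable_vec_def[of "\<lambda>e. \<gamma> (v e)"] by (intro allI definable_term_function[OF \<gamma>])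
  have dZ: "definable (\<lambda>e. Z (v e) (\<tau> e))" if v: "definable_vec v" and \<tau>: "definable_term \<tau>" for v \<tau>
  proof -
    have "definable (\<lambda>e. Z (vec_of (\<lambda>i. e (Suc i))) (e 0))"
      unfolding Z_def not_expanding_at_def by (intro definable_intros d\<gamma>)
    moreover have "definable_term (\<lambda>e. case i of 0 \<Rightarrow> \<tau> e | Suc i \<Rightarrow> v e $ inv coord i)" for i
      using v \<tau> by (cases i) (auto simp: definable_vec_def)
    ultimately show ?thesis
      using definable_subst[of "\<lambda>e. Z (vec_of (\<lambda>i. e (Suc i))) (e 0)"
          "\<lambda>i e. case i of 0 \<Rightarrow> \<tau> e | Suc i \<Rightarrow> v e $ inv coord i"] by simp
  qed
  define Bad where "Bad = {\<alpha>. \<exists>x. \<exists>\<delta>>0. \<forall>y. norm (y - x) < \<delta> \<longrightarrow> Z y \<alpha>}"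
  assume "\<not> finite {\<alpha>. \<not> negligible {x. not_expanding_at (\<lambda>x. x - \<alpha> *\<^sub>R \<gamma> x) x}}"
  then have inf: "infinite {\<alpha>. \<not> negligible {x. Z x \<alpha>}}" unfolding Z_def .
  have "{\<alpha>. \<not> negligible {x. Z x \<alpha>}} \<subseteq> Bad"
  proof
    fix \<alpha> assume "\<alpha> \<in> {\<alpha>. \<not> negligible {x. Z x \<alpha>}}"
    moreover have "definable (\<lambda>e. vec_of e \<in> {x. Z x \<alpha>})"
      unfolding mem_Collect_eq by (intro dZ definable_intros)
    ultimately have "interior {x. Z x \<alpha>} \<noteq> {}"
      using definable_negligible_if_interior_empty by blast
    then obtain x \<delta> where \<delta>: "\<delta> > 0" "ball x \<delta> \<subseteq> {x. Z x \<alpha>}" by (metis ex_in_conv mem_interior)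
    have "Z y \<alpha>" if "norm (y - x) < \<delta>" for y
      using subsetD[OF \<delta>(2), of y] that by (simp add: dist_norm norm_minus_commute)
    then show "\<alpha> \<in> Bad" unfolding Bad_def using \<delta>(1) by blast
  qed
  then have "infinite Bad" using inf infinite_super by blast
  moreover have "tame Bad" unfolding Bad_def by (intro tame_Collect definable_intros dZ)
  ultimately obtain a b where ab: "a < b" "{a<..<b} \<subseteq> Bad" using tame_infinite_interval by blast
  obtain Q :: "(real ^ 'n) set" where Q: "countable Q" "\<And>X. open X \<Longrightarrow> X \<noteq> {} \<Longrightarrow> \<exists>d\<in>Q. d \<in> X"
    using countable_dense_setE by blast
  define A where "A = (\<lambda>(x, m :: nat). {\<alpha>. \<forall>y. norm (y - x) < 1 / real (Suc m) \<longrightarrow> Z y \<alpha>})"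
  have "{a<..<b} \<subseteq> (\<Union>i\<in>Q \<times> UNIV. A i)"
  proof
    fix \<alpha> assume "\<alpha> \<in> {a<..<b}"
    then obtain x \<delta> where \<delta>: "\<delta> > 0" "\<And>y. norm (y - x) < \<delta> \<Longrightarrow> Z y \<alpha>" using ab(2) unfolding Bad_def by blast
    obtain q where q: "q \<in> Q" "q \<in> ball x (\<delta> / 2)" using Q(2)[of "ball x (\<delta> / 2)"] \<delta>(1) by auto
    obtain m where m: "1 / real (Suc m) < \<delta> / 2" using inverse_Suc_below[of "\<delta> / 2"] \<delta>(1) by auto
    have "Z y \<alpha>" if "norm (y - q) < 1 / real (Suc m)" for y
    proof (rule \<delta>(2))
      have "norm (y - x) \<le> norm (y - q) + norm (q - x)" by (metis diff_add_cancel norm_triangle_ineq add_diff_eq)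
      then show "norm (y - x) < \<delta>" using that m q(2) by (simp add: dist_norm norm_minus_commute)
    qed
    then have "\<alpha> \<in> A (q, m)" unfolding A_def by simp
    then show "\<alpha> \<in> (\<Union>i\<in>Q \<times> UNIV. A i)" using q(1) by blast
  qed
  moreover have "tame (A i \<inter> {a<..<b})" for i
    unfolding A_def by (cases i, simp only: prod.case, intro tame_Collect_in_interval definable_intros dZ)
  ultimately obtain i c d where i: "i \<in> Q \<times> UNIV" "c < d" "{c<..<d} \<subseteq> A i"
    using tame_cover_interval[OF ab(1), of "Q \<times> UNIV" A] Q(1) by (metis countable_SIGMA countableI_type)
  obtain q m where qm: "i = (q, m)" by force
  have Zq: "Z y \<alpha>" if "y \<in> ball q (1 / real (Suc m))" "\<alpha> \<in> {c<..<d}" for y \<alpha>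
    using i(3) that unfolding qm A_def by (auto simp: dist_norm norm_minus_commute)
  have "\<exists>U. negligible (- U) \<and> (\<forall>x\<in>U. \<exists>g. ((\<lambda>x. \<gamma> x $ j) has_derivative (\<lambda>v. g \<bullet> v)) (at x))" for j
    using definable_function_C1[OF \<gamma>[of j]] by metis
  then obtain U where U: "\<And>j. negligible (- U j)"
    "\<And>j x. x \<in> U j \<Longrightarrow> \<exists>g. ((\<lambda>x. \<gamma> x $ j) has_derivative (\<lambda>v. g \<bullet> v)) (at x)" by metis
  have "negligible (\<Union>(range (\<lambda>j. - U j)))" using U(1) by (auto intro!: negligible_Union)
  moreover have "\<not> negligible (ball q (1 / real (Suc m)))"
    using open_not_negligible[of "ball q (1 / real (Suc m))"] by simp
  ultimately have "\<not> ball q (1 / real (Suc m)) \<subseteq> \<Union>(range (\<lambda>j. - U j))"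
    using negligible_subset by blast
  then obtain x where x: "x \<in> ball q (1 / real (Suc m))" "\<And>j. x \<in> U j" by blast
  obtain g where g: "\<And>j. ((\<lambda>x. \<gamma> x $ j) has_derivative (\<lambda>v. g j \<bullet> v)) (at x)"
    using U(2)[OF x(2)] by metis
  define H where "H = (\<lambda>v. \<chi> j. g j \<bullet> v)"
  have H: "(\<gamma> has_derivative H) (at x)"
    by (subst has_derivative_componentwise_within) (use g in \<open>auto simp: H_def Basis_vec_def inner_axis\<close>)
  then have "linear H" using has_derivative_linear by blast
  from finite_reciprocal_eigenvalues[OF this]
  have "finite {\<alpha>. \<exists>v. v \<noteq> 0 \<and> v - \<alpha> *\<^sub>R H v = 0}" .
  moreover have "{c<..<d} \<subseteq> {\<alpha>. \<exists>v. v \<noteq> 0 \<and> v - \<alpha> *\<^sub>R H v = 0}"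
  proof
    fix \<alpha> assume "\<alpha> \<in> {c<..<d}"
    then have "not_expanding_at (\<lambda>x. x - \<alpha> *\<^sub>R \<gamma> x) x" using Zq[OF x(1)] unfolding Z_def by blast
    moreover have "((\<lambda>x. x - \<alpha> *\<^sub>R \<gamma> x) has_derivative (\<lambda>v. v - \<alpha> *\<^sub>R H v)) (at x)"
      by (intro derivative_intros H)
    ultimately show "\<alpha> \<in> {\<alpha>. \<exists>v. v \<noteq> 0 \<and> v - \<alpha> *\<^sub>R H v = 0}"
      using singular_derivative_if_not_expanding by blast
  qed
  ultimately show False using infinite_Ioo[OF i(2)] finite_subset by blast
qed

text \<open>
  Almost everywhere \<open>f\<close> is continuously differentiable, so the step is single-valued there; its
  gradient is again definable.
\<close>

theorem null_preimages_of_subgradient_step: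
  fixes f :: "real ^ 'n \<Rightarrow> real"
  assumes f: "definable_function f"
  shows "finite {\<alpha>. \<not> (\<forall>N. negligible N \<longrightarrow> negligible {x. \<exists>v\<in>subdifferential f x. x - \<alpha> *\<^sub>R v \<in> N})}"
proof -
  obtain U D where U: "open U" "negligible (- U)" "\<And>j. definable_function (D j)"
    "\<And>x j. x \<in> U \<Longrightarrow> isCont (D j) x"
    "\<And>x. x \<in> U \<Longrightarrow> (f has_derivative (\<lambda>v. (\<chi> j. D j x) \<bullet> v)) (at x)"
    using definable_function_C1[OF f] by blast
  define \<gamma> where "\<gamma> = (\<lambda>x. \<chi> j. D j x)"
  have "isCont \<gamma> x" if "x \<in> U" for x
    using U(4)[OF that] unfolding \<gamma>_def isCont_def by (intro tendsto_vec_lambda)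
  then have sub: "v = \<gamma> x" if "x \<in> U" "v \<in> subdifferential f x" for x v
    using subdifferential_eq_gradient[OF U(1) that(1), of f \<gamma>] U(5) that unfolding \<gamma>_def by blast
  have preimage: "negligible {x. \<exists>v\<in>subdifferential f x. x - \<alpha> *\<^sub>R v \<in> N}"
    if good: "negligible {x. not_expanding_at (\<lambda>x. x - \<alpha> *\<^sub>R \<gamma> x) x}" and N: "negligible N" for \<alpha> N
  proof -
    define \<Phi> where "\<Phi> = (\<lambda>x. x - \<alpha> *\<^sub>R \<gamma> x)"
    have "{x. \<exists>v\<in>subdifferential f x. x - \<alpha> *\<^sub>R v \<in> N} \<subseteq>
        - U \<union> {x. not_expanding_at \<Phi> x} \<union> {x. \<Phi> x \<in> N \<and> \<not> not_expanding_at \<Phi> x}"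
      using sub unfolding \<Phi>_def by auto
    moreover have "negligible (- U \<union> {x. not_expanding_at \<Phi> x} \<union> {x. \<Phi> x \<in> N \<and> \<not> not_expanding_at \<Phi> x})"
      using good U(2) negligible_preimage_if_expanding[OF N] unfolding \<Phi>_def by (intro negligible_Un)
    ultimately show ?thesis using negligible_subset by blast
  qed
  have "finite {\<alpha>. \<not> negligible {x. not_expanding_at (\<lambda>x. x - \<alpha> *\<^sub>R \<gamma> x) x}}"
    by (rule finite_step_sizes_with_collapse) (simp add: \<gamma>_def U(3))
  moreover have "{\<alpha>. \<not> (\<forall>N. negligible N \<longrightarrow> negligible {x. \<exists>v\<in>subdifferential f x. x - \<alpha> *\<^sub>R v \<in> N})}
      \<subseteq> {\<alpha>. \<not> negligible {x. not_expanding_at (\<lambda>x. x - \<alpha> *\<^sub>R \<gamma> x) x}}"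
    using preimage by blast
  ultimately show ?thesis using finite_subset by blast
qed

text \<open>
  The two enumerations of the coordinates may differ, which is a renaming of variables.
\<close>

lemma definable_function_if_definable_fun:
  fixes f :: "real ^ 'n \<Rightarrow> real"
  assumes "definable_fun S f"
  shows "definable_function f"
proof -
  obtain enum where enum: "bij_betw enum {..<CARD('n)} (UNIV :: 'n set)"
    and graph: "{map (\<lambda>i. x $ enum i) [0..<CARD('n)] @ [f x] |x. True} \<in> S (Suc CARD('n))"
    using assms unfolding definable_fun_def by blast
  define pos where "pos = inv_into {..<CARD('n)} enum"
  have pos: "pos (enum i) = i" if "i < CARD('n)" for i
    unfolding pos_def using enum that by (simp add: bij_betw_inv_into_left)
  have pos_less: "pos j < CARD('n)" and enum_pos: "enum (pos j) = j" for j
    unfolding pos_def using enum by (metis bij_betwE bij_betw_inv_into UNIV_I lessThan_iff)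
      (use enum in \<open>simp add: bij_betw_inv_into_right\<close>)
  have "(map e [0..<Suc CARD('n)] \<in> {map (\<lambda>i. x $ enum i) [0..<CARD('n)] @ [f x] |x. True})
     \<longleftrightarrow> e CARD('n) = f (\<chi> j. e (pos j))" for e
  proof
    assume "map e [0..<Suc CARD('n)] \<in> {map (\<lambda>i. x $ enum i) [0..<CARD('n)] @ [f x] |x. True}"
    then obtain x where "map e [0..<CARD('n)] = map (\<lambda>i. x $ enum i) [0..<CARD('n)]" and fx: "e CARD('n) = f x"
      by auto
    then have "e i = x $ enum i" if "i < CARD('n)" for i using that by auto
    then have "x = (\<chi> j. e (pos j))" using pos_less enum_pos by (simp add: vec_eq_iff)
    then show "e CARD('n) = f (\<chi> j. e (pos j))" using fx by simp
  next
    assume "e CARD('n) = f (\<chi> j. e (pos j))"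
    then have "map e [0..<Suc CARD('n)] = map (\<lambda>i. (\<chi> j. e (pos j)) $ enum i) [0..<CARD('n)] @ [f (\<chi> j. e (pos j))]"
      by (simp add: pos)
    then show "map e [0..<Suc CARD('n)] \<in> {map (\<lambda>i. x $ enum i) [0..<CARD('n)] @ [f x] |x. True}" by blast
  qed
  then have "definable (\<lambda>e. e CARD('n) = f (\<chi> j. e (pos j)))"
    unfolding definable_def using graph by blast
  from definable_rename[OF this, of "\<lambda>i. if i = CARD('n) then 0 else Suc (coord (enum i))"]
  have "definable (\<lambda>e. e 0 = f (\<chi> j. e (Suc (coord (enum (pos j))))))"
    using pos_less by (simp add: less_imp_neq)
  then show ?thesis unfolding definable_function_def definable_term_def vec_of_def enum_pos .
qed

end

section \<open>Charts and the Lie algebra of a Lie subgroup\<close>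

lemma smooth_on_has_derivative:
  assumes "smooth_on h U" "x \<in> U"
  shows "(h has_derivative frechet_derivative h (at x)) (at x)"
proof -
  have "differentiable_upto (Suc 0) h U" using assms(1) unfolding smooth_on_def by blast
  then show ?thesis using assms(2) by (simp add: frechet_derivative_works[symmetric])
qed

lemma smooth_on_continuous_derivative:
  assumes "smooth_on h U"
  shows "continuous_on U (\<lambda>x. frechet_derivative h (at x) d)"
proof -
  have "differentiable_upto (Suc 0) h U" using assms unfolding smooth_on_def by blast
  then show ?thesis by simp
qed

lemma smooth_on_continuous: "smooth_on h U \<Longrightarrow> continuous_on U h"
  unfolding smooth_on_def using differentiable_upto.simps(1) by blast

lemma linear_matrix_mult_vec: "linear (\<lambda>A :: real ^ 'n ^ 'm. A *v x)"
  by (rule linearI) (simp_all add: matrix_vector_mult_add_rdistrib scaleR_matrix_vector_assoc)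

lemma linear_matrix_mult_left: "linear (\<lambda>A :: real ^ 'n ^ 'm. (B :: real ^ 'm ^ 'k) ** A)"
  by (rule linearI) (simp_all add: matrix_add_ldistrib matrix_scalar_ac scalar_matrix_assoc
      scalar_mult_eq_scaleR[symmetric] matrix_matrix_mult_def vec_eq_iff sum_distrib_left sum.distrib algebra_simps)

lemma norm_matrix_vector_le: "norm ((A :: real ^ 'n ^ 'm) *v x) \<le> norm A * norm x"
proof -
  have "norm (A *v x) \<le> L2_set (\<lambda>i. norm (A $ i) * norm x) UNIV"
    unfolding norm_vec_def[of "A *v x"]
    by (rule L2_set_mono) (auto simp: matrix_vector_mul_component Cauchy_Schwarz_ineq2)
  also have "\<dots> = norm A * norm x"
    unfolding norm_vec_def[of A] by (simp add: L2_set_left_distrib)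
  finally show ?thesis .
qed

lemma matrix_inv_mult:
  assumes "invertible (A :: real ^ 'n ^ 'n)"
  shows "A ** matrix_inv A = mat 1" "matrix_inv A ** A = mat 1"
  using someI_ex[OF assms[unfolded invertible_def]] unfolding matrix_inv_def by auto

lemma subspace_Int_open_line:
  fixes p w :: "'a::real_normed_vector"
  assumes "subspace V" "open W" "p \<in> W \<inter> V" "w \<in> V"
  shows "\<forall>\<^sub>F t in at 0. p + t *\<^sub>R w \<in> W \<inter> V"
proof -
  have "isCont (\<lambda>t. p + t *\<^sub>R w) 0" by (intro continuous_intros)
  then have "((\<lambda>t. p + t *\<^sub>R w) \<longlongrightarrow> p + 0 *\<^sub>R w) (at 0)" unfolding isCont_def .
  then have "\<forall>\<^sub>F t in at 0. p + t *\<^sub>R w \<in> W" using assms by (intro topological_tendstoD) auto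
  then show ?thesis
    by eventually_elim (use assms in \<open>auto intro: subspace_add subspace_scale\<close>)
qed

text \<open>
  The topology \<open>T\<close> of the group may be finer than the Euclidean one; charts are homeomorphisms for
  \<open>T\<close>.
\<close>

lemma chart_open_preimage:
  assumes "immersed_param T V W \<phi>" "openin T \<Omega>"
  shows "openin (top_of_set (W \<inter> V)) {p \<in> W \<inter> V. \<phi> p \<in> \<Omega>}"
proof -
  have hom: "homeomorphic_map (top_of_set (W \<inter> V)) (subtopology T (\<phi> ` (W \<inter> V))) \<phi>"
    using assms(1) unfolding immersed_param_def by blast
  then have "continuous_map (top_of_set (W \<inter> V)) (subtopology T (\<phi> ` (W \<inter> V))) \<phi>"
    by (rule homeomorphic_imp_continuous_map)
  then have "continuous_map (top_of_set (W \<inter> V)) T \<phi>" by (simp add: continuous_map_in_subtopology)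
  from openin_continuous_map_preimage[OF this assms(2)] show ?thesis by simp
qed

lemma chart_open_image:
  assumes "immersed_param T V W \<phi>" "openin (top_of_set (W \<inter> V)) N"
  shows "openin T (\<phi> ` N)"
proof -
  have hom: "homeomorphic_map (top_of_set (W \<inter> V)) (subtopology T (\<phi> ` (W \<inter> V))) \<phi>"
    and op: "openin T (\<phi> ` (W \<inter> V))"
    using assms(1) unfolding immersed_param_def by blast+
  have "openin (subtopology T (\<phi> ` (W \<inter> V))) (\<phi> ` N)"
    using homeomorphic_map_openness[OF hom] assms(2) openin_subset[OF assms(2)] by blast
  then show ?thesis using op openin_trans_full by blast
qed

lemma chart_inj:
  assumes "immersed_param T V W \<phi>" shows "inj_on \<phi> (W \<inter> V)"
  using assms unfolding immersed_param_def by (auto dest: homeomorphic_imp_injective_map)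

text \<open>
  Smooth maps into the group are continuous for \<open>T\<close>; applied to multiplication and inversion, this
  makes the group topological.
\<close>

lemma smooth_into_open_preimage:
  assumes "smooth_into T D h" "openin T \<Omega>"
  shows "openin (top_of_set D) {x \<in> D. h x \<in> \<Omega>}"
proof (subst openin_subopen, intro ballI)
  fix x assume "x \<in> {x \<in> D. h x \<in> \<Omega>}"
  then have x: "x \<in> D" "h x \<in> \<Omega>" by auto
  obtain V W \<phi> N \<sigma> where chart: "immersed_param T V W \<phi>" and N: "open N" "x \<in> N" "smooth_on \<sigma> N"
    and fact0: "\<forall>y\<in>D \<inter> N. \<sigma> y \<in> W \<inter> V \<and> h y = \<phi> (\<sigma> y)"
    using assms(1)[unfolded smooth_into_def, rule_format, OF x(1)] by (elim exE conjE) rule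
  have fact: "\<sigma> y \<in> W \<inter> V \<and> h y = \<phi> (\<sigma> y)" if "y \<in> D \<inter> N" for y using fact0 that by blast
  obtain Q where Q: "open Q" "{p \<in> W \<inter> V. \<phi> p \<in> \<Omega>} = (W \<inter> V) \<inter> Q"
    using chart_open_preimage[OF chart assms(2)] unfolding openin_open by blast
  have "open (N \<inter> \<sigma> -` Q)"
    using smooth_on_continuous[OF N(3)] N(1) Q(1) by (simp add: continuous_on_open_vimage Int_commute)
  then have "openin (top_of_set D) (D \<inter> (N \<inter> \<sigma> -` Q))" by (rule openin_open_Int)
  moreover have "x \<in> D \<inter> (N \<inter> \<sigma> -` Q)" using x N fact[of x] Q(2) by auto
  moreover have "D \<inter> (N \<inter> \<sigma> -` Q) \<subseteq> {x \<in> D. h x \<in> \<Omega>}" using fact Q(2) by auto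
  ultimately show "\<exists>Ta. openin (top_of_set D) Ta \<and> x \<in> Ta \<and> Ta \<subseteq> {x \<in> D. h x \<in> \<Omega>}" by blast
qed

text \<open>
  To show that a velocity lies in a subspace \<open>V\<close>, it is convenient to see \<open>V\<close> as the kernel of \<open>K\<close> and
  to differentiate \<open>K \<circ> c\<close>.
\<close>

lemma subspace_eq_kernel:
  fixes V :: "'a::euclidean_space set"
  assumes "subspace V"
  obtains K :: "'a \<Rightarrow> 'a" where "linear K" "\<And>v. K v = 0 \<longleftrightarrow> v \<in> V"
proof -
  obtain g :: "'a \<Rightarrow> 'a" where g: "g ` UNIV \<subseteq> V" "linear g" "\<And>v. v \<in> V \<Longrightarrow> g v = v"
    using linear_exists_left_inverse_on[OF linear_id assms] by auto
  have "linear (\<lambda>v. v - g v)" using g(2) by (intro linear_compose_sub linear_ident)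
  moreover have "v - g v = 0 \<longleftrightarrow> v \<in> V" for v using g(1,3) by auto
  ultimately show thesis by (rule that)
qed

lemma derivative_in_subspace:
  fixes c :: "real \<Rightarrow> 'a::euclidean_space"
  assumes V: "subspace V" and c: "(c has_vector_derivative w) (at t)" "\<forall>\<^sub>F s in at t. c s \<in> V" "c t \<in> V"
  shows "w \<in> V"
proof -
  obtain K :: "'a \<Rightarrow> 'a" where K: "linear K" "\<And>v. K v = 0 \<longleftrightarrow> v \<in> V" by (rule subspace_eq_kernel[OF V]) blast
  have "((\<lambda>s. K (c s)) has_vector_derivative K w) (at t)"
    using bounded_linear.has_vector_derivative[OF _ c(1)] K(1) linear_conv_bounded_linear by blast
  then have "((\<lambda>s. 0) has_vector_derivative K w) (at t)"
    unfolding has_vector_derivative_def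
    by (rule has_derivative_transform_eventually) (use c(2,3) K(2) in \<open>auto elim: eventually_mono\<close>)
  then have "K w = 0" using vector_derivative_unique_at has_vector_derivative_const by blast
  then show ?thesis using K(2) by blast
qed

locale lie_subgroup =
  fixes G :: "(real ^ 'n ^ 'n) set" and T :: "(real ^ 'n ^ 'n) topology"
  assumes lie: "lie_subgroup_GL G T"
begin

lemma group_laws: "A \<in> G \<Longrightarrow> invertible A" "mat 1 \<in> G" "A \<in> G \<Longrightarrow> B \<in> G \<Longrightarrow> A ** B \<in> G"
  "A \<in> G \<Longrightarrow> matrix_inv A \<in> G" and topspace: "topspace T = G" and countable: "second_countable T"
  using lie unfolding lie_subgroup_GL_def by auto

lemma chart_exists:
  assumes "A \<in> G" obtains V W \<phi> p where "immersed_param T V W \<phi>" "p \<in> W \<inter> V" "\<phi> p = A"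
proof -
  have "\<exists>d. \<forall>A\<in>G. \<exists>V W \<phi>. immersed_param T V W \<phi> \<and> dim V = d \<and> A \<in> \<phi> ` (W \<inter> V)"
    using lie unfolding lie_subgroup_GL_def by blast
  then obtain V W \<phi> where "immersed_param T V W \<phi>" "A \<in> \<phi> ` (W \<inter> V)" using assms by blast
  then show thesis using that by blast
qed

lemma mult_smooth: "immersed_param T V W \<phi> \<Longrightarrow> immersed_param T V' W' \<psi> \<Longrightarrow>
    smooth_into T ((W \<inter> V) \<times> (W' \<inter> V')) (\<lambda>(p, q). \<phi> p ** \<psi> q)"
  using lie unfolding lie_subgroup_GL_def by blast

lemma inverse_smooth: "immersed_param T V W \<phi> \<Longrightarrow> smooth_into T (W \<inter> V) (\<lambda>p. matrix_inv (\<phi> p))"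
  using lie unfolding lie_subgroup_GL_def by blast

lemma chart_in_G: "immersed_param T V W \<phi> \<Longrightarrow> p \<in> W \<inter> V \<Longrightarrow> \<phi> p \<in> G"
  using openin_subset topspace unfolding immersed_param_def by blast

lemma open_left_translate:
  assumes "g \<in> G" "openin T \<Omega>" shows "openin T {b \<in> G. g ** b \<in> \<Omega>}"
proof (subst openin_subopen, intro ballI)
  fix b assume "b \<in> {b \<in> G. g ** b \<in> \<Omega>}"
  then have b: "b \<in> G" "g ** b \<in> \<Omega>" by auto
  obtain V W \<phi> p where \<phi>: "immersed_param T V W \<phi>" "p \<in> W \<inter> V" "\<phi> p = g" using chart_exists[OF assms(1)] .
  obtain V' W' \<psi> q where \<psi>: "immersed_param T V' W' \<psi>" "q \<in> W' \<inter> V'" "\<psi> q = b" using chart_exists[OF b(1)] .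
  have "openin (top_of_set ((W \<inter> V) \<times> (W' \<inter> V'))) {z \<in> (W \<inter> V) \<times> (W' \<inter> V'). (\<lambda>(p, q). \<phi> p ** \<psi> q) z \<in> \<Omega>}"
    by (rule smooth_into_open_preimage[OF mult_smooth[OF \<phi>(1) \<psi>(1)] assms(2)])
  then obtain Q where Q: "open Q" "{z \<in> (W \<inter> V) \<times> (W' \<inter> V'). (\<lambda>(p, q). \<phi> p ** \<psi> q) z \<in> \<Omega>} = ((W \<inter> V) \<times> (W' \<inter> V')) \<inter> Q"
    unfolding openin_open by blast
  have "open (Pair p -` Q)" by (rule continuous_open_vimage[OF Q(1)]) (intro continuous_intros)
  then have "openin T (\<psi> ` ((W' \<inter> V') \<inter> Pair p -` Q))" by (intro chart_open_image[OF \<psi>(1)] openin_open_Int)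
  moreover have mem: "r \<in> Pair p -` Q \<longleftrightarrow> g ** \<psi> r \<in> \<Omega>" if "r \<in> W' \<inter> V'" for r
  proof -
    have "(p, r) \<in> {z \<in> (W \<inter> V) \<times> (W' \<inter> V'). (\<lambda>(p, q). \<phi> p ** \<psi> q) z \<in> \<Omega>} \<longleftrightarrow> (p, r) \<in> Q"
      unfolding Q(2) using \<phi>(2) that by blast
    then show ?thesis using \<phi> that by auto
  qed
  then have "b \<in> \<psi> ` ((W' \<inter> V') \<inter> Pair p -` Q)" using \<psi> b(2) by blast
  moreover have "\<psi> ` ((W' \<inter> V') \<inter> Pair p -` Q) \<subseteq> {b \<in> G. g ** b \<in> \<Omega>}"
    using mem chart_in_G[OF \<psi>(1)] by blast
  ultimately show "\<exists>Ta. openin T Ta \<and> b \<in> Ta \<and> Ta \<subseteq> {b \<in> G. g ** b \<in> \<Omega>}" by blast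
qed

text \<open>
  Continuity of \<open>(a, b) \<mapsto> a\<^sup>-\<^sup>1 b\<close> at the identity.
\<close>

lemma small_quotients:
  assumes \<Omega>: "openin T \<Omega>" "mat 1 \<in> \<Omega>"
  obtains \<Omega>' where "openin T \<Omega>'" "mat 1 \<in> \<Omega>'" "\<And>a b. a \<in> \<Omega>' \<Longrightarrow> b \<in> \<Omega>' \<Longrightarrow> matrix_inv a ** b \<in> \<Omega>"
proof -
  obtain V W \<phi> p where \<phi>: "immersed_param T V W \<phi>" "p \<in> W \<inter> V" "\<phi> p = mat 1"
    using chart_exists[OF group_laws(2)] .
  obtain V' W' \<psi> N \<sigma> where \<psi>: "immersed_param T V' W' \<psi>" and N: "open N" "p \<in> N" "smooth_on \<sigma> N"
    and fact0: "\<forall>y\<in>(W \<inter> V) \<inter> N. \<sigma> y \<in> W' \<inter> V' \<and> matrix_inv (\<phi> y) = \<psi> (\<sigma> y)"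
    using inverse_smooth[OF \<phi>(1), unfolded smooth_into_def, rule_format, OF \<phi>(2)] by (elim exE conjE) rule
  have fact: "\<sigma> y \<in> W' \<inter> V' \<and> matrix_inv (\<phi> y) = \<psi> (\<sigma> y)" if "y \<in> (W \<inter> V) \<inter> N" for y
    using fact0 that by blast
  have "openin (top_of_set ((W' \<inter> V') \<times> (W \<inter> V))) {z \<in> (W' \<inter> V') \<times> (W \<inter> V). (\<lambda>(p, q). \<psi> p ** \<phi> q) z \<in> \<Omega>}"
    by (rule smooth_into_open_preimage[OF mult_smooth[OF \<psi> \<phi>(1)] \<Omega>(1)])
  then obtain Q where Q: "open Q" "{z \<in> (W' \<inter> V') \<times> (W \<inter> V). (\<lambda>(p, q). \<psi> p ** \<phi> q) z \<in> \<Omega>} = ((W' \<inter> V') \<times> (W \<inter> V)) \<inter> Q"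
    unfolding openin_open by blast
  have inv1: "matrix_inv (mat 1 :: real ^ 'n ^ 'n) = mat 1"
    using matrix_inv_mult(2)[of "mat 1 :: real ^ 'n ^ 'n"] by (simp add: invertible_def)
  have "(\<sigma> p, p) \<in> {z \<in> (W' \<inter> V') \<times> (W \<inter> V). (\<lambda>(p, q). \<psi> p ** \<phi> q) z \<in> \<Omega>}"
  proof -
    have "\<psi> (\<sigma> p) = mat 1" "\<sigma> p \<in> W' \<inter> V'" using fact[of p] \<phi> N(2) inv1 by auto
    then show ?thesis using \<phi>(2,3) \<Omega>(2) by simp
  qed
  then have "(\<sigma> p, p) \<in> Q" unfolding Q(2) by blast
  then obtain A B where AB: "open A" "open B" "\<sigma> p \<in> A" "p \<in> B" "A \<times> B \<subseteq> Q"
    using Q(1) by (metis open_prod_elim mem_Sigma_iff)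
  have "open (N \<inter> \<sigma> -` A)"
    using smooth_on_continuous[OF N(3)] N(1) AB(1) by (simp add: continuous_on_open_vimage Int_commute)
  then have "open ((N \<inter> \<sigma> -` A) \<inter> B)" using AB(2) by blast
  define \<Omega>' where "\<Omega>' = \<phi> ` ((W \<inter> V) \<inter> ((N \<inter> \<sigma> -` A) \<inter> B))"
  have "openin T \<Omega>'" unfolding \<Omega>'_def
    by (intro chart_open_image[OF \<phi>(1)] openin_open_Int) fact
  moreover have "mat 1 \<in> \<Omega>'" unfolding \<Omega>'_def using \<phi> N(2) AB by (intro image_eqI[of _ _ p]) auto
  moreover have "matrix_inv a ** b \<in> \<Omega>" if "a \<in> \<Omega>'" "b \<in> \<Omega>'" for a b
  proof -
    obtain r where r: "r \<in> W \<inter> V" "r \<in> N" "\<sigma> r \<in> A" "a = \<phi> r" using \<open>a \<in> \<Omega>'\<close> unfolding \<Omega>'_def by blast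
    obtain q where q: "q \<in> W \<inter> V" "q \<in> B" "b = \<phi> q" using \<open>b \<in> \<Omega>'\<close> unfolding \<Omega>'_def by blast
    have "(\<sigma> r, q) \<in> ((W' \<inter> V') \<times> (W \<inter> V)) \<inter> Q" using fact[of r] r q AB(5) by blast
    then have "\<psi> (\<sigma> r) ** \<phi> q \<in> \<Omega>" unfolding Q(2)[symmetric] by simp
    then show ?thesis using fact[of r] r q by simp
  qed
  ultimately show thesis by (rule that)
qed

text \<open>
  The curve \<open>c\<close> is only continuous for \<open>T\<close> at 0, and differentiable as a matrix-valued curve. It can
  be written as \<open>\<phi> (q t)\<close> with \<open>q t \<rightarrow> p\<close>; as the derivative \<open>L\<close> of the chart is injective on \<open>V\<close>, the
  distance of \<open>q t\<close> to \<open>p\<close> is \<open>O(t)\<close>, and \<open>c t - 1\<close> differs from \<open>L (q t - p)\<close> by \<open>o(t)\<close>. So \<open>Y\<close> is a limit of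
  elements of \<open>L V\<close>.
\<close>

lemma velocity_in_chart_tangent:
  assumes \<phi>: "immersed_param T V W \<phi>" "p \<in> W \<inter> V" "\<phi> p = mat 1"
    and c: "\<And>\<Omega>. openin T \<Omega> \<Longrightarrow> mat 1 \<in> \<Omega> \<Longrightarrow> \<forall>\<^sub>F t in at 0. c t \<in> \<Omega>" "c 0 = mat 1"
      "(c has_vector_derivative Y) (at 0)"
  shows "Y \<in> frechet_derivative \<phi> (at p) ` V"
proof -
  define L where "L = frechet_derivative \<phi> (at p)"
  have V: "subspace V" and W: "open W" and L: "(\<phi> has_derivative L) (at p)" and inj: "inj_on L V"
    using \<phi> smooth_on_has_derivative unfolding immersed_param_def L_def by blast+
  have "linear L" using L has_derivative_linear by blast
  have "\<exists>B>0. \<forall>v\<in>V. norm (L v) \<ge> B * norm v"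
  proof (rule injective_imp_isometric[OF closed_subspace[OF V] V])
    show "bounded_linear L" using \<open>linear L\<close> linear_conv_bounded_linear by blast
    show "\<forall>v\<in>V. L v = 0 \<longrightarrow> v = 0"
      using inj linear_0[OF \<open>linear L\<close>] subspace_0[OF V] by (metis inj_onD)
  qed
  then obtain B where B: "B > 0" "\<And>v. v \<in> V \<Longrightarrow> B * norm v \<le> norm (L v)" by blast
  have LV: "subspace (L ` V)" using linear_subspace_image[OF \<open>linear L\<close> V] .
  obtain K :: "real ^ 'n ^ 'n \<Rightarrow> real ^ 'n ^ 'n" where K: "linear K" "\<And>v. K v = 0 \<longleftrightarrow> v \<in> L ` V"
    by (rule subspace_eq_kernel[OF LV]) blast
  have bK: "bounded_linear K" using K(1) linear_conv_bounded_linear by blast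
  obtain k where k: "k > 0" "\<And>v. norm (K v) \<le> k * norm v"
    using bounded_linear.pos_bounded[OF bK] by (metis mult.commute)
  define q where "q = (\<lambda>t. inv_into (W \<inter> V) \<phi> (c t))"
  have q_in: "\<forall>\<^sub>F t in at 0. q t \<in> W \<inter> V \<and> \<phi> (q t) = c t \<and> q t \<in> N" if "open N" "p \<in> N" for N
  proof -
    have "openin T (\<phi> ` ((W \<inter> V) \<inter> N))" using that(1) by (intro chart_open_image[OF \<phi>(1)] openin_open_Int)
    moreover have "mat 1 \<in> \<phi> ` ((W \<inter> V) \<inter> N)" using \<phi> that by force
    ultimately have "\<forall>\<^sub>F t in at 0. c t \<in> \<phi> ` ((W \<inter> V) \<inter> N)" by (rule c(1))
    then show ?thesis
    proof eventually_elim
      case (elim t)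
      then obtain r where "r \<in> W \<inter> V" "r \<in> N" "c t = \<phi> r" by blast
      then show ?case unfolding q_def using chart_inj[OF \<phi>(1)] by simp
    qed
  qed
  have main: "\<forall>\<^sub>F t in at 0. norm (K (c t) - K (c 0)) \<le> e * \<bar>t\<bar>" if e: "e > 0" for e
  proof -
    \<comment> \<open>the Lipschitz constant in \<open>dist (q t) p \<le> C |t|\<close>\<close>
    define C where "C = 2 / B * (norm Y + 1)"
    have C: "C > 0" unfolding C_def using B(1) by (simp add: add_nonneg_pos)
    define \<epsilon> where "\<epsilon> = min (B / 2) (e / (k * C))"
    have \<epsilon>: "\<epsilon> > 0" "\<epsilon> \<le> B / 2" "k * (\<epsilon> * C) \<le> e"
      unfolding \<epsilon>_def using B(1) e k(1) C by (auto simp: min_def field_simps)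
    obtain d where d: "d > 0" "\<And>y. norm (y - p) < d \<Longrightarrow> norm (\<phi> y - \<phi> p - L (y - p)) \<le> \<epsilon> * norm (y - p)"
      using L \<epsilon>(1) unfolding has_derivative_at_alt by blast
    have "\<forall>\<^sub>F t in at 0. q t \<in> W \<inter> V \<and> \<phi> (q t) = c t \<and> q t \<in> ball p d"
      using d(1) by (intro q_in) auto
    moreover obtain d' where d': "d' > 0" "\<And>t. norm (t - 0) < d' \<Longrightarrow> norm (c t - c 0 - (t - 0) *\<^sub>R Y) \<le> 1 * norm (t - 0)"
      using c(3) unfolding has_vector_derivative_def has_derivative_at_alt by (metis zero_less_one)
    have "\<forall>\<^sub>F t in at 0. norm (t - (0::real)) < d'"
      using d'(1) eventually_at[of "\<lambda>t. norm (t - (0::real)) < d'" 0 UNIV] by (auto simp: dist_norm)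
    ultimately show ?thesis
    proof eventually_elim
      case (elim t)
      define u where "u = q t - p"
      have u: "u \<in> V" unfolding u_def using elim \<phi>(2) V by (auto intro: subspace_diff)
      have rem: "norm (c t - mat 1 - L u) \<le> \<epsilon> * norm u"
        using d(2)[of "q t"] elim(1) \<phi>(3) unfolding u_def by (simp add: dist_norm norm_minus_commute)
      have "norm (c t - mat 1) \<le> norm (c t - mat 1 - t *\<^sub>R Y) + norm (t *\<^sub>R Y)"
        by (metis diff_add_cancel norm_triangle_ineq)
      also have "\<dots> \<le> (norm Y + 1) * \<bar>t\<bar>" using d'(2)[OF elim(2)] c(2) by (simp add: algebra_simps)
      finally have ct: "norm (c t - mat 1) \<le> (norm Y + 1) * \<bar>t\<bar>" .
      have "B * norm u \<le> norm (L u)" by (rule B(2)[OF u])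
      also have "\<dots> \<le> norm (c t - mat 1) + norm (c t - mat 1 - L u)"
        by (metis norm_triangle_sub norm_minus_commute add.commute)
      also have "\<dots> \<le> (norm Y + 1) * \<bar>t\<bar> + B / 2 * norm u"
        using ct rem \<epsilon>(2) by (intro add_mono order_trans[OF rem] mult_right_mono) auto
      finally have "B / 2 * norm u \<le> (norm Y + 1) * \<bar>t\<bar>" by simp
      then have uC: "norm u \<le> C * \<bar>t\<bar>" unfolding C_def using B(1) by (simp add: field_simps)
      have "K (L u) = 0" using K(2) u by blast
      then have "K (c t) - K (c 0) = K (c t - mat 1 - L u)"
        using K(1) c(2) by (simp add: linear_diff)
      then have "norm (K (c t) - K (c 0)) \<le> k * norm (c t - mat 1 - L u)" using k(2) by simp
      also have "\<dots> \<le> k * (\<epsilon> * (C * \<bar>t\<bar>))"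
        using k(1) \<epsilon>(1) by (intro mult_left_mono order_trans[OF rem] uC) auto
      also have "\<dots> \<le> e * \<bar>t\<bar>" using mult_right_mono[OF \<epsilon>(3), of "\<bar>t\<bar>"] by (simp add: mult.assoc)
      finally show ?case .
    qed
  qed
  have "((\<lambda>t. K (c t)) has_vector_derivative 0) (at 0)"
    unfolding has_vector_derivative_def has_derivative_at_alt
  proof (intro conjI allI impI)
    fix e :: real assume "e > 0"
    from main[OF this] obtain d where "d > 0" "\<And>t. t \<noteq> 0 \<Longrightarrow> dist t 0 < d \<Longrightarrow> norm (K (c t) - K (c 0)) \<le> e * \<bar>t\<bar>"
      unfolding eventually_at by auto
    then show "\<exists>d>0. \<forall>t. norm (t - 0) < d \<longrightarrow> norm (K (c t) - K (c 0) - (t - 0) *\<^sub>R 0) \<le> e * norm (t - 0)"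
      by (intro exI[of _ d]) (auto, metis abs_ge_zero abs_zero diff_self mult_zero_right norm_zero order_refl)
  qed simp
  moreover have "((\<lambda>t. K (c t)) has_vector_derivative K Y) (at 0)"
    using bounded_linear.has_vector_derivative[OF bK c(3)] .
  ultimately have "K Y = 0" using vector_derivative_unique_at by blast
  then show ?thesis using K(2) unfolding L_def by blast
qed

end

section \<open>Flatness of closed orbits\<close>

lemma has_vector_derivative_along_line:
  assumes "(h has_derivative L) (at p)"
  shows "((\<lambda>t. h (p + t *\<^sub>R w)) has_vector_derivative L w) (at 0)"
proof -
  have "((\<lambda>t. h (p + t *\<^sub>R w)) has_derivative (\<lambda>t. L (t *\<^sub>R w))) (at 0)"
    by (rule has_derivative_compose[of "\<lambda>t. p + t *\<^sub>R w" _ _ _ h])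
       (use assms in \<open>auto intro!: derivative_eq_intros\<close>)
  then show ?thesis
    unfolding has_vector_derivative_def
    using linear_scale[OF has_derivative_linear[OF assms]] by simp
qed

context lie_subgroup
begin

lemma chart_line_eventually:
  assumes \<phi>: "immersed_param T V W \<phi>" "p \<in> W \<inter> V" "w \<in> V" and \<Omega>: "openin T \<Omega>" "\<phi> p \<in> \<Omega>"
  shows "\<forall>\<^sub>F t in at 0. \<phi> (p + t *\<^sub>R w) \<in> \<Omega>"
proof -
  obtain Q where Q: "open Q" "{p \<in> W \<inter> V. \<phi> p \<in> \<Omega>} = (W \<inter> V) \<inter> Q"
    using chart_open_preimage[OF \<phi>(1) \<Omega>(1)] unfolding openin_open by blast
  have "\<forall>\<^sub>F t in at 0. p + t *\<^sub>R w \<in> (W \<inter> Q) \<inter> V"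
    using \<phi> Q \<Omega>(2) unfolding immersed_param_def by (intro subspace_Int_open_line) auto
  then show ?thesis by eventually_elim (use Q(2) in blast)
qed

text \<open>
  The Lie algebra is defined as a union over all charts; that one chart suffices makes it a vector
  space.
\<close>

lemma lie_algebra_eq_chart_tangent:
  assumes \<phi>: "immersed_param T V W \<phi>" "p \<in> W \<inter> V" "\<phi> p = mat 1"
  shows "lie_algebra T = frechet_derivative \<phi> (at p) ` V"
proof
  show "frechet_derivative \<phi> (at p) ` V \<subseteq> lie_algebra T"
    using \<phi> unfolding lie_algebra_def by blast
  show "lie_algebra T \<subseteq> frechet_derivative \<phi> (at p) ` V"
  proof
    fix X assume "X \<in> lie_algebra T"
    then obtain V' W' \<psi> q w where \<psi>: "immersed_param T V' W' \<psi>" "q \<in> W' \<inter> V'" "\<psi> q = mat 1"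
      and w: "w \<in> V'" "X = frechet_derivative \<psi> (at q) w"
      unfolding lie_algebra_def by blast
    have "(\<psi> has_derivative frechet_derivative \<psi> (at q)) (at q)"
      using \<psi> smooth_on_has_derivative unfolding immersed_param_def by blast
    from has_vector_derivative_along_line[OF this, of w]
    have "((\<lambda>t. \<psi> (q + t *\<^sub>R w)) has_vector_derivative X) (at 0)" unfolding w(2) .
    then show "X \<in> frechet_derivative \<phi> (at p) ` V"
      using chart_line_eventually[OF \<psi>(1,2) w(1)] \<psi>(3)
      by (intro velocity_in_chart_tangent[OF \<phi>, of "\<lambda>t. \<psi> (q + t *\<^sub>R w)"]) auto
  qed
qed

lemma lie_algebra_subspace: "subspace (lie_algebra T)"
proof -
  obtain V W \<phi> p where \<phi>: "immersed_param T V W \<phi>" "p \<in> W \<inter> V" "\<phi> p = mat 1"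
    using chart_exists[OF group_laws(2)] .
  then have "(\<phi> has_derivative frechet_derivative \<phi> (at p)) (at p)" "subspace V"
    using smooth_on_has_derivative unfolding immersed_param_def by blast+
  then show ?thesis
    unfolding lie_algebra_eq_chart_tangent[OF \<phi>] using has_derivative_linear linear_subspace_image by blast
qed

text \<open>
  The curve \<open>t \<mapsto> (\<phi> p)\<^sup>-\<^sup>1 \<phi> (p + t w)\<close> passes through the identity at \<open>t = 0\<close>.
\<close>

lemma chart_derivative_left_translate:
  assumes \<phi>: "immersed_param T V W \<phi>" "p \<in> W \<inter> V" and w: "w \<in> V"
  shows "\<exists>X\<in>lie_algebra T. frechet_derivative \<phi> (at p) w = \<phi> p ** X"
proof -
  obtain V0 W0 \<phi>0 p0 where \<phi>0: "immersed_param T V0 W0 \<phi>0" "p0 \<in> W0 \<inter> V0" "\<phi>0 p0 = mat 1"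
    using chart_exists[OF group_laws(2)] .
  define g where "g = matrix_inv (\<phi> p)"
  have G: "\<phi> p \<in> G" by (rule chart_in_G[OF \<phi>])
  have g: "g \<in> G" "g ** \<phi> p = mat 1" "\<phi> p ** g = mat 1"
    unfolding g_def using G group_laws matrix_inv_mult by blast+
  have L: "(\<phi> has_derivative frechet_derivative \<phi> (at p)) (at p)"
    using \<phi> smooth_on_has_derivative unfolding immersed_param_def by blast
  have "g ** frechet_derivative \<phi> (at p) w \<in> frechet_derivative \<phi>0 (at p0) ` V0"
  proof (rule velocity_in_chart_tangent[OF \<phi>0, of "\<lambda>t. g ** \<phi> (p + t *\<^sub>R w)"])
    have "bounded_linear (\<lambda>A. g ** A)" using linear_matrix_mult_left linear_conv_bounded_linear by blast
    from bounded_linear.has_vector_derivative[OF this has_vector_derivative_along_line[OF L]]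
    show "((\<lambda>t. g ** \<phi> (p + t *\<^sub>R w)) has_vector_derivative g ** frechet_derivative \<phi> (at p) w) (at 0)" .
    fix \<Omega> assume "openin T \<Omega>" "mat 1 \<in> \<Omega>"
    then have "\<forall>\<^sub>F t in at 0. \<phi> (p + t *\<^sub>R w) \<in> {b \<in> G. g ** b \<in> \<Omega>}"
      using G g by (intro chart_line_eventually[OF \<phi> w] open_left_translate) auto
    then show "\<forall>\<^sub>F t in at 0. g ** \<phi> (p + t *\<^sub>R w) \<in> \<Omega>" by eventually_elim simp
  qed (use g in simp)
  moreover have "frechet_derivative \<phi> (at p) w = \<phi> p ** (g ** frechet_derivative \<phi> (at p) w)"
    using g by (simp add: matrix_mul_assoc)
  ultimately show ?thesis unfolding lie_algebra_eq_chart_tangent[OF \<phi>0] by blast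
qed

text \<open>
  A curve in the group with velocity \<open>X\<close> at the identity moves \<open>x\<close> inside its orbit, along which \<open>f\<close> is
  constant.
\<close>

lemma subgradient_orthogonal_to_orbit:
  fixes f :: "real ^ 'n \<Rightarrow> real"
  assumes inv: "\<forall>g\<in>G. \<forall>x. f (g *v x) = f x"
    and X: "X \<in> lie_algebra T" and v: "v \<in> subdifferential f x"
  shows "v \<bullet> (X *v x) = 0"
proof -
  have regular: "v \<bullet> (X *v x) = 0" if "v \<in> regular_subdifferential f x" for v x
  proof -
    obtain V W \<phi> p w where \<phi>: "immersed_param T V W \<phi>" "p \<in> W \<inter> V" "\<phi> p = mat 1"
      and w: "w \<in> V" "X = frechet_derivative \<phi> (at p) w"
      using X unfolding lie_algebra_def by blast
    have L: "(\<phi> has_derivative frechet_derivative \<phi> (at p)) (at p)"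
      using \<phi> smooth_on_has_derivative unfolding immersed_param_def by blast
    define c where "c = (\<lambda>t. \<phi> (p + t *\<^sub>R w) *v x)"
    have "bounded_linear (\<lambda>A. A *v x)" for x :: "real ^ 'n"
      using linear_matrix_mult_vec linear_conv_bounded_linear by blast
    from bounded_linear.has_vector_derivative[OF this has_vector_derivative_along_line[OF L]]
    have c: "(c has_vector_derivative X *v x) (at 0)" unfolding c_def w(2) .
    have "openin T G" using topspace by (metis openin_topspace)
    then have "\<forall>\<^sub>F t in at 0. \<phi> (p + t *\<^sub>R w) \<in> G"
      using chart_in_G[OF \<phi>(1,2)] by (intro chart_line_eventually[OF \<phi>(1,2) w(1)])
    then have ev: "\<forall>\<^sub>F t in at 0. f x = f (c t)" unfolding c_def by eventually_elim (use inv in simp)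
    have c0: "c 0 = x" unfolding c_def using \<phi>(3) by simp
    with ev have "\<forall>\<^sub>F t in nhds 0. f x = f (c t)" by (simp add: eventually_nhds_conv_at)
    then have "((\<lambda>t. f (c t)) has_real_derivative 0) (at 0)"
      by (rule DERIV_cong_ev[OF refl _ refl, THEN iffD1]) simp
    from regular_subgradient_along_curve[OF _ c this] show ?thesis using that c0 by simp
  qed
  obtain Xs V where XV: "\<And>k::nat. V k \<in> regular_subdifferential f (Xs k)" "Xs \<longlonglongrightarrow> x" "V \<longlonglongrightarrow> v"
    using v unfolding subdifferential_def by blast
  have "bounded_linear (\<lambda>x. X *v x)" by simp
  from bounded_linear.tendsto[OF this XV(2)] have "(\<lambda>k. V k \<bullet> (X *v Xs k)) \<longlonglongrightarrow> v \<bullet> (X *v x)"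
    using XV(3) by (intro tendsto_inner)
  moreover have "(\<lambda>k. V k \<bullet> (X *v Xs k)) = (\<lambda>k. 0)" using regular[OF XV(1)] by auto
  ultimately show ?thesis by (simp add: LIMSEQ_const_iff)
qed

text \<open>
  The points \<open>\<phi> P z\<close> with \<open>P\<close> close to the centre of a chart form an almost flat set, whose secants
  are close to the space \<open>E\<close> of all \<open>X z\<close>. This is a form of the constant rank theorem. By
  \<open>chart_derivative_left_translate\<close>, the velocity of \<open>\<phi> (c t) z\<close> is \<open>\<phi> (c t) e\<close> with \<open>e \<in> E\<close>, so that its
  part outside \<open>E\<close> is much smaller than its projection \<open>prj\<close> to \<open>E\<close>. For a secant one needs a curve \<open>c\<close>
  between the parameters whose projected image moves on a straight line, since otherwise the
  projected velocities could cancel (the orbit map may have a large stabilizer). The map \<open>\<Psi>\<close> is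
  built such that \<open>D (\<Psi> P)\<close> is the projection of \<open>\<phi> P z\<close>; its derivative at the centre is the
  identity, and by the inverse function theorem line segments in its image can be lifted.
\<close>

lemma orbit_flat:
  fixes z :: "real ^ 'n"
  assumes \<theta>: "\<theta> > 0"
  shows "\<exists>\<Omega>. openin T \<Omega> \<and> mat 1 \<in> \<Omega> \<and> (\<forall>a\<in>\<Omega>. \<forall>b\<in>\<Omega>. \<exists>X\<in>lie_algebra T.
     norm (a *v z - b *v z - X *v z) \<le> \<theta> * norm (X *v z))"
proof -
  obtain V W \<phi> p0 where \<phi>: "immersed_param T V W \<phi>" "p0 \<in> W \<inter> V" "\<phi> p0 = mat 1"
    using chart_exists[OF group_laws(2)] .
  have V: "subspace V" and W: "open W" and smooth: "smooth_on \<phi> W"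
    using \<phi>(1) unfolding immersed_param_def by auto
  define L where "L = (\<lambda>p. frechet_derivative \<phi> (at p))"
  have L: "(\<phi> has_derivative L p) (at p)" if "p \<in> W" for p
    unfolding L_def by (rule smooth_on_has_derivative[OF smooth that])
  have linL: "linear (L p)" if "p \<in> W" for p using L[OF that] has_derivative_linear by blast
  obtain \<pi> :: "real ^ 'n ^ 'n \<Rightarrow> real ^ 'n ^ 'n" where \<pi>: "\<pi> ` UNIV \<subseteq> V" "linear \<pi>" "\<And>v. v \<in> V \<Longrightarrow> \<pi> v = v"
    using linear_exists_left_inverse_on[OF linear_id V] by auto
  have \<pi>V: "\<pi> d \<in> V" for d using \<pi>(1) by blast
  have b\<pi>: "bounded_linear \<pi>" using \<pi>(2) linear_conv_bounded_linear by blast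
  have bz: "bounded_linear (\<lambda>A. A *v z)" using linear_matrix_mult_vec linear_conv_bounded_linear by blast
  define E where "E = (\<lambda>X. X *v z) ` lie_algebra T"
  have subE: "subspace E" unfolding E_def by (rule linear_subspace_image[OF linear_matrix_mult_vec lie_algebra_subspace])
  define D where "D = (\<lambda>d. L p0 (\<pi> d) *v z)"
  have p0: "p0 \<in> W" "p0 \<in> V" using \<phi>(2) by auto
  have linD: "linear D" unfolding D_def
    using linear_compose[OF linear_compose[OF \<pi>(2) linL[OF p0(1)]] linear_matrix_mult_vec] by (simp add: o_def)
  have DE: "D d \<in> E" for d
    unfolding D_def E_def lie_algebra_eq_chart_tangent[OF \<phi>] L_def using \<pi>V by blast
  have ED: "e \<in> range D" if eE: "e \<in> E" for e
  proof -
    obtain w where "w \<in> V" "e = L p0 w *v z"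
      using eE unfolding E_def lie_algebra_eq_chart_tangent[OF \<phi>] L_def by blast
    then have "e = D w" unfolding D_def using \<pi>(3) by simp
    then show ?thesis by blast
  qed
  obtain J0 where J0: "linear J0" "\<And>e. e \<in> range D \<Longrightarrow> D (J0 e) = e"
    using linear_exists_right_inverse_on[OF linD subspace_UNIV] by auto
  \<comment> \<open>a right inverse of \<open>D\<close> with values in \<open>V\<close>, so that \<open>\<Psi>\<close> below maps \<open>V\<close> to itself\<close>
  define J where "J = (\<lambda>e. \<pi> (J0 e))"
  have J: "linear J" "\<And>e. e \<in> E \<Longrightarrow> D (J e) = e" "\<And>e. J e \<in> V"
    using linear_compose[OF J0(1) \<pi>(2)] J0(2) ED \<pi>V \<pi>(3) unfolding J_def by (auto simp: o_def D_def)
  have bJ: "bounded_linear J" using J(1) linear_conv_bounded_linear by blast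
  have bD: "bounded_linear D" using linD linear_conv_bounded_linear by blast
  obtain prj :: "real ^ 'n \<Rightarrow> real ^ 'n" where prj: "prj ` UNIV \<subseteq> E" "linear prj" "\<And>v. v \<in> E \<Longrightarrow> prj v = v"
    using linear_exists_left_inverse_on[OF linear_id subE] by auto
  have bprj: "bounded_linear prj" using prj(2) linear_conv_bounded_linear by blast
  obtain B where B: "B > 0" "\<And>v. norm (prj v) \<le> B * norm v"
    using bounded_linear.pos_bounded[OF bprj] by (metis mult.commute)
  \<comment> \<open>how close to the identity the group elements have to be\<close>
  define \<eta> where "\<eta> = min (1 / (2 * B)) (\<theta> / (2 * (1 + B)))"
  have "\<eta> \<le> 1 / (2 * B)" "\<eta> \<le> \<theta> / (2 * (1 + B))" unfolding \<eta>_def by auto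
  then have \<eta>: "\<eta> > 0" "B * \<eta> \<le> 1 / 2" "2 * (1 + B) * \<eta> \<le> \<theta>"
    using B(1) \<theta> by (simp add: \<eta>_def, simp_all add: pos_le_divide_eq mult_ac)
  define F where "F = (\<lambda>P. \<phi> (\<pi> P) *v z)"
  define \<Psi> where "\<Psi> = (\<lambda>P. P + J (prj (F P) - D P))"
  define \<Psi>' where "\<Psi>' = (\<lambda>P d. d + J (prj (L (\<pi> P) (\<pi> d) *v z) - D d))"
  \<comment> \<open>The inverse function theorem needs an open domain, so the chart is extended along \<open>\<pi>\<close>.\<close>
  define W' where "W' = \<pi> -` (W \<inter> \<phi> -` ball (mat 1) \<eta>)"
  have "open (W \<inter> \<phi> -` ball (mat 1) \<eta>)"
    using smooth_on_continuous[OF smooth] W by (simp add: continuous_on_open_vimage Int_commute)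
  then have W': "open W'"
    unfolding W'_def by (rule continuous_open_vimage) (rule linear_continuous_at[OF b\<pi>])
  have p0W': "p0 \<in> W'" unfolding W'_def using p0 \<pi>(3) \<phi>(3) \<eta>(1) by auto
  have F': "(F has_derivative (\<lambda>d. L (\<pi> P) (\<pi> d) *v z)) (at P)" if "P \<in> W'" for P
  proof -
    have "((\<lambda>P. \<phi> (\<pi> P)) has_derivative (\<lambda>d. L (\<pi> P) (\<pi> d))) (at P)"
      by (rule has_derivative_compose[OF bounded_linear_imp_has_derivative[OF b\<pi>] L])
         (use that in \<open>auto simp: W'_def\<close>)
    from bounded_linear.has_derivative[OF bz this] show ?thesis unfolding F_def .
  qed
  have \<Psi>': "(\<Psi> has_derivative \<Psi>' P) (at P)" if "P \<in> W'" for P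
    unfolding \<Psi>_def \<Psi>'_def
    by (intro has_derivative_add has_derivative_ident bounded_linear.has_derivative[OF bJ]
        has_derivative_diff bounded_linear.has_derivative[OF bprj] F' that bounded_linear_imp_has_derivative[OF bD])
  have bl: "bounded_linear (\<Psi>' P)" if "P \<in> W'" for P using \<Psi>'[OF that] has_derivative_bounded_linear by blast
  have contL: "continuous_on W' (\<lambda>P. L (\<pi> P) d)" for d
  proof (rule continuous_on_compose2[of W "\<lambda>p. L p d" W' \<pi>])
    show "continuous_on W (\<lambda>p. L p d)" unfolding L_def by (rule smooth_on_continuous_derivative[OF smooth])
    show "continuous_on W' \<pi>" using b\<pi> by (intro linear_continuous_on)
    show "\<pi> ` W' \<subseteq> W" unfolding W'_def by blast
  qed
  have cont: "continuous_on W' (\<lambda>P. Blinfun (\<Psi>' P))"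
  proof (rule continuous_on_blinfun_componentwise)
    fix i :: "real ^ 'n ^ 'n" assume "i \<in> Basis"
    have "continuous_on W' (\<lambda>P. \<Psi>' P i)"
      unfolding \<Psi>'_def
      by (intro continuous_intros bounded_linear.continuous_on[OF bJ] bounded_linear.continuous_on[OF bprj]
          bounded_linear.continuous_on[OF bz] contL)
    then show "continuous_on W' (\<lambda>P. blinfun_apply (Blinfun (\<Psi>' P)) i)"
      by (rule continuous_on_eq) (simp add: bounded_linear_Blinfun_apply[OF bl])
  qed
  have "\<Psi>' p0 = (\<lambda>d. d)"
  proof
    fix d
    have "prj (D d) = D d" using prj(3) DE by blast
    then show "\<Psi>' p0 d = d" unfolding \<Psi>'_def using \<pi>(3)[OF p0(2)] linear_0[OF J(1)] by (simp add: D_def)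
  qed
  then have invf: "id_blinfun o\<^sub>L Blinfun (\<Psi>' p0) = id_blinfun"
    by (intro blinfun_eqI) (simp add: bounded_linear_Blinfun_apply)
  have der: "(\<Psi> has_derivative blinfun_apply (Blinfun (\<Psi>' P))) (at P)" if "P \<in> W'" for P
    using \<Psi>'[OF that] by (simp add: bounded_linear_Blinfun_apply[OF bl[OF that]])
  have "\<exists>U' V' g g'. open U' \<and> U' \<subseteq> W' \<and> p0 \<in> U' \<and> open V' \<and> \<Psi> p0 \<in> V' \<and> homeomorphism U' V' \<Psi> g \<and>
      (\<forall>y\<in>V'. (g has_derivative (g' y)) (at y))"
  proof (rule inverse_function_theorem[OF W' der cont p0W' invf])
    fix U' V' g g'
    assume "open U'" "U' \<subseteq> W'" "p0 \<in> U'" "open V'" "\<Psi> p0 \<in> V'" "homeomorphism U' V' \<Psi> g"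
      and "\<And>y. y \<in> V' \<Longrightarrow> (g has_derivative g' y) (at y)"
    then show ?thesis
      by (intro exI[of _ U'] exI[of _ V'] exI[of _ g] exI[of _ g'] conjI ballI) simp_all
  qed
  then obtain U' V' g g' where ift: "open U'" "U' \<subseteq> W'" "p0 \<in> U'" "open V'" "\<Psi> p0 \<in> V'" "homeomorphism U' V' \<Psi> g"
    and ift_der: "\<forall>y\<in>V'. (g has_derivative (g' y)) (at y)"
    by (elim exE conjE) (rule that)
  obtain \<rho> where \<rho>: "\<rho> > 0" "ball (\<Psi> p0) \<rho> \<subseteq> V'" using ift(4,5) open_contains_ball by blast
  have "continuous_on U' \<Psi>" using ift(6) unfolding homeomorphism_def by blast
  then have openN: "open (U' \<inter> \<Psi> -` ball (\<Psi> p0) \<rho>)"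
    using ift(1) by (simp add: continuous_on_open_vimage Int_commute)
  define \<Omega> where "\<Omega> = \<phi> ` ((W \<inter> V) \<inter> (U' \<inter> \<Psi> -` ball (\<Psi> p0) \<rho>))"
  have "openin T \<Omega>" unfolding \<Omega>_def using openN by (intro chart_open_image[OF \<phi>(1)] openin_open_Int)
  moreover have "mat 1 \<in> \<Omega>" unfolding \<Omega>_def using \<phi> ift(3) \<rho>(1) by (intro image_eqI[of _ _ p0]) auto
  moreover have "\<exists>X\<in>lie_algebra T. norm (a *v z - b *v z - X *v z) \<le> \<theta> * norm (X *v z)"
    if "a \<in> \<Omega>" "b \<in> \<Omega>" for a b
  proof -
    obtain p where p: "p \<in> W \<inter> V" "p \<in> U'" "\<Psi> p \<in> ball (\<Psi> p0) \<rho>" "a = \<phi> p"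
      using \<open>a \<in> \<Omega>\<close> unfolding \<Omega>_def by blast
    obtain q where q: "q \<in> W \<inter> V" "q \<in> U'" "\<Psi> q \<in> ball (\<Psi> p0) \<rho>" "b = \<phi> q"
      using \<open>b \<in> \<Omega>\<close> unfolding \<Omega>_def by blast
    have \<Psi>V: "\<Psi> P \<in> V \<longleftrightarrow> P \<in> V" for P
    proof
      assume "\<Psi> P \<in> V"
      then have "\<Psi> P - J (prj (F P) - D P) \<in> V" using V J(3) subspace_diff by blast
      then show "P \<in> V" unfolding \<Psi>_def by simp
    qed (use V J(3) subspace_add in \<open>auto simp: \<Psi>_def\<close>)
    have D\<Psi>: "D (\<Psi> P) = prj (F P)" for P
    proof -
      have "prj (F P) - D P \<in> E" using prj(1) DE subE subspace_diff by blast
      then show ?thesis unfolding \<Psi>_def using J(2) by (simp add: linear_add[OF linD])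
    qed
    define \<Delta> where "\<Delta> = \<Psi> p - \<Psi> q"
    define seg where "seg = (\<lambda>t. \<Psi> q + t *\<^sub>R \<Delta>)"
    define c where "c = (\<lambda>t. g (seg t))"
    define y where "y = (\<lambda>t. \<phi> (c t) *v z)"
    define h where "h = D \<Delta>"
    have segV: "seg t \<in> V" for t
      unfolding seg_def \<Delta>_def using \<Psi>V p q V by (intro subspace_add subspace_scale subspace_diff) auto
    have \<Psi>c: "\<Psi> (c t) = seg t" "c t \<in> U'" "c t \<in> V" if "seg t \<in> V'" for t
    proof -
      show "\<Psi> (c t) = seg t" "c t \<in> U'" unfolding c_def using ift(6) that unfolding homeomorphism_def by auto
      then show "c t \<in> V" using \<Psi>V segV by metis
    qed
    have yF: "y t = F (c t)" if "seg t \<in> V'" for t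
      unfolding y_def F_def using \<pi>(3) \<Psi>c(3)[OF that] by simp
    have seg_der: "(seg has_vector_derivative \<Delta>) (at t)" for t
      unfolding seg_def by (auto intro!: derivative_eq_intros)
    have velocity: "\<exists>y'. (y has_vector_derivative y') (at t) \<and> norm (y' - h) \<le> \<theta> * norm h"
      if t: "t \<in> {0..1}" for t
    proof -
      have "seg t = (1 - t) *\<^sub>R \<Psi> q + t *\<^sub>R \<Psi> p" unfolding seg_def \<Delta>_def by (simp add: algebra_simps)
      then have "seg t \<in> ball (\<Psi> p0) \<rho>"
        using convexD[OF convex_ball q(3) p(3), of "1 - t" t] t by auto
      then have segt: "seg t \<in> V'" using \<rho>(2) by blast
      define u where "u = g' (seg t) \<Delta>"
      have "((g \<circ> seg) has_vector_derivative u) (at t)"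
        unfolding u_def
        by (rule vector_derivative_diff_chain_within[OF seg_der has_derivative_at_withinI[OF bspec[OF ift_der segt]]])
      then have c': "(c has_vector_derivative u) (at t)" unfolding c_def o_def .
      have "isCont seg t" using seg_der has_vector_derivative_continuous by blast
      then have ev: "\<forall>\<^sub>F s in at t. seg s \<in> V'"
        unfolding isCont_def using ift(4) segt by (rule topological_tendstoD)
      have u: "u \<in> V"
        by (rule derivative_in_subspace[OF V c']) (use ev \<Psi>c(3) segt in \<open>auto elim: eventually_mono\<close>)
      have ct: "c t \<in> W \<inter> V" "dist (mat 1) (\<phi> (c t)) < \<eta>"
        using \<Psi>c(2,3)[OF segt] ift(2) \<pi>(3)[OF \<Psi>c(3)[OF segt]] unfolding W'_def by auto
      obtain X where X: "X \<in> lie_algebra T" "L (c t) u = \<phi> (c t) ** X"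
        using chart_derivative_left_translate[OF \<phi>(1) ct(1) u] unfolding L_def by blast
      define e where "e = X *v z"
      have e: "e \<in> E" unfolding e_def E_def using X(1) by blast
      have "((\<phi> \<circ> c) has_vector_derivative L (c t) u) (at t)"
        using ct(1) by (intro vector_derivative_diff_chain_within[OF c' has_derivative_at_withinI[OF L]]) auto
      from bounded_linear.has_vector_derivative[OF bz this]
      have y': "(y has_vector_derivative \<phi> (c t) *v e) (at t)"
        unfolding y_def X(2) e_def by (simp add: o_def matrix_vector_mul_assoc)
      have "prj (\<phi> (c t) *v e) = h"
      proof (rule vector_derivative_unique_at)
        show "((\<lambda>s. D (seg s)) has_vector_derivative h) (at t)"
          unfolding h_def by (rule bounded_linear.has_vector_derivative[OF bD seg_der])
        have eq: "prj (y s) = D (seg s)" if "seg s \<in> V'" for s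
          using D\<Psi>[of "c s"] \<Psi>c(1)[OF that] yF[OF that] by simp
        have "((\<lambda>s. prj (y s)) has_vector_derivative prj (\<phi> (c t) *v e)) (at t)"
          by (rule bounded_linear.has_vector_derivative[OF bprj y'])
        then show "((\<lambda>s. D (seg s)) has_vector_derivative prj (\<phi> (c t) *v e)) (at t)"
          unfolding has_vector_derivative_def
          by (rule has_derivative_transform_eventually) (use ev eq segt in \<open>auto elim: eventually_mono\<close>)
      qed
      define d where "d = \<phi> (c t) *v e - e"
      have "d = (\<phi> (c t) - mat 1) *v e" unfolding d_def by (simp add: matrix_vector_mult_diff_rdistrib)
      then have "norm d \<le> norm (\<phi> (c t) - mat 1) * norm e" using norm_matrix_vector_le by metis
      also have "\<dots> \<le> \<eta> * norm e"
        using ct(2) by (intro mult_right_mono) (auto simp: dist_norm norm_minus_commute)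
      finally have d: "norm d \<le> \<eta> * norm e" .
      have prjd: "norm (prj d) \<le> B * (\<eta> * norm e)" using B(2)[of d] d B(1) by (meson mult_left_mono less_imp_le order_trans)
      have h_eq: "h = e + prj d"
        unfolding d_def using \<open>prj (\<phi> (c t) *v e) = h\<close> prj(3)[OF e] by (simp add: linear_diff[OF prj(2)])
      have "B * (\<eta> * norm e) \<le> 1 / 2 * norm e" using mult_right_mono[OF \<eta>(2), of "norm e"] by (simp add: mult.assoc)
      moreover have "norm e \<le> norm h + norm (prj d)" unfolding h_eq by (metis add_diff_cancel_right' norm_triangle_ineq4)
      ultimately have eh: "norm e \<le> 2 * norm h" using prjd by simp
      have "\<phi> (c t) *v e - h = d - prj d" unfolding h_eq d_def by simp
      then have "norm (\<phi> (c t) *v e - h) \<le> norm d + norm (prj d)" using norm_triangle_ineq4 by metis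
      also have "\<dots> \<le> (1 + B) * \<eta> * norm e" using d prjd by (simp add: algebra_simps)
      also have "\<dots> \<le> (1 + B) * \<eta> * (2 * norm h)" using eh B(1) \<eta>(1) by (intro mult_left_mono) auto
      also have "\<dots> \<le> \<theta> * norm h" using mult_right_mono[OF \<eta>(3), of "norm h"] by (simp add: algebra_simps)
      finally show ?thesis using y' by blast
    qed
    then obtain y' where y': "\<And>t. t \<in> {0..1} \<Longrightarrow> (y has_vector_derivative y' t) (at t)"
      "\<And>t. t \<in> {0..1} \<Longrightarrow> norm (y' t - h) \<le> \<theta> * norm h" by metis
    have "norm ((y 1 - 1 *\<^sub>R h) - (y 0 - 0 *\<^sub>R h)) \<le> \<theta> * norm h * norm (1 - 0 :: real)"
    proof (rule differentiable_bound[where S = "{0..1}" and f' = "\<lambda>t s. s *\<^sub>R (y' t - h)"])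
      fix t :: real assume t: "t \<in> {0..1}"
      have "((\<lambda>t. y t - t *\<^sub>R h) has_vector_derivative y' t - h) (at t)"
        using y'(1)[OF t] by (auto intro!: derivative_eq_intros)
      then show "((\<lambda>t. y t - t *\<^sub>R h) has_derivative (\<lambda>s. s *\<^sub>R (y' t - h))) (at t within {0..1})"
        unfolding has_vector_derivative_def by (rule has_derivative_at_withinI)
      show "onorm (\<lambda>s. s *\<^sub>R (y' t - h)) \<le> \<theta> * norm h"
        using y'(2)[OF t] by (intro onorm_le) (simp add: mult.commute mult_left_mono)
    qed auto
    moreover have "c 1 = p" "c 0 = q"
      unfolding c_def seg_def \<Delta>_def using ift(6) p(2) q(2) unfolding homeomorphism_def by auto
    ultimately have "norm (a *v z - b *v z - h) \<le> \<theta> * norm h" unfolding y_def using p(4) q(4) by (simp add: algebra_simps)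
    moreover have "h \<in> E" unfolding h_def by (rule DE)
    ultimately show ?thesis unfolding E_def by blast
  qed
  ultimately show ?thesis by blast
qed

lemma inverse_apply: "A \<in> G \<Longrightarrow> matrix_inv A *v (A *v x) = x"
  by (simp only: matrix_vector_mul_assoc matrix_inv_mult(2)[OF group_laws(1)] matrix_vector_mul_lid)

text \<open>
  Cover \<open>G\<close> by countably many translates of a small compact set \<open>K\<close>, which is possible since \<open>T\<close> is
  second countable. The orbit is then the union of countably many closed sets \<open>g K z\<close>, and as it is
  closed in a complete space, Baire's theorem makes one of them a neighbourhood in the orbit of
  some \<open>g k z\<close> with \<open>k \<in> K\<close>. Translating back, \<open>k\<^sup>-\<^sup>1 K z\<close> is a neighbourhood of \<open>z\<close>.
\<close>

lemma orbit_map_open_at_identity: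
  fixes z :: "real ^ 'n"
  assumes closed: "closed ((\<lambda>g. g *v z) ` G)" and \<Omega>: "openin T \<Omega>" "mat 1 \<in> \<Omega>"
  obtains \<delta> where "\<delta> > 0" "(\<lambda>g. g *v z) ` G \<inter> ball z \<delta> \<subseteq> (\<lambda>g. g *v z) ` \<Omega>"
proof -
  define M where "M = (\<lambda>g. g *v z) ` G"
  obtain \<Omega>' where \<Omega>': "openin T \<Omega>'" "mat 1 \<in> \<Omega>'" "\<And>a b. a \<in> \<Omega>' \<Longrightarrow> b \<in> \<Omega>' \<Longrightarrow> matrix_inv a ** b \<in> \<Omega>"
    using small_quotients[OF \<Omega>] by blast
  obtain V W \<phi> p where \<phi>: "immersed_param T V W \<phi>" "p \<in> W \<inter> V" "\<phi> p = mat 1"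
    using chart_exists[OF group_laws(2)] .
  have V: "subspace V" and W: "open W" and smooth: "smooth_on \<phi> W"
    using \<phi>(1) unfolding immersed_param_def by auto
  obtain Q where Q: "open Q" "{r \<in> W \<inter> V. \<phi> r \<in> \<Omega>'} = (W \<inter> V) \<inter> Q"
    using chart_open_preimage[OF \<phi>(1) \<Omega>'(1)] unfolding openin_open by blast
  have "p \<in> (W \<inter> V) \<inter> Q" unfolding Q(2)[symmetric] using \<phi>(2,3) \<Omega>'(2) by simp
  then have "open (W \<inter> Q)" "p \<in> W \<inter> Q" using W Q(1) by auto
  then obtain \<rho> where \<rho>: "\<rho> > 0" "cball p \<rho> \<subseteq> W \<inter> Q" using open_contains_cball by blast
  define K where "K = \<phi> ` (cball p \<rho> \<inter> V)"
  define K' where "K' = \<phi> ` ((W \<inter> V) \<inter> ball p \<rho>)"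
  have K'K: "K' \<subseteq> K" unfolding K'_def K_def by (intro image_mono) auto
  have K\<Omega>: "K \<subseteq> \<Omega>'" unfolding K_def using \<rho>(2) Q(2) by blast
  then have KG: "K \<subseteq> G" using openin_subset[OF \<Omega>'(1)] topspace by blast
  have "compact (cball p \<rho> \<inter> V)" using closed_subspace[OF V] by (intro compact_Int_closed) auto
  moreover have "continuous_on (cball p \<rho> \<inter> V) (\<lambda>r. \<phi> r *v z)"
  proof -
    have "continuous_on (cball p \<rho> \<inter> V) \<phi>"
      using smooth_on_continuous[OF smooth] by (rule continuous_on_subset) (use \<rho>(2) in blast)
    then show ?thesis
      using bounded_linear.continuous_on linear_matrix_mult_vec linear_conv_bounded_linear by blast
  qed
  ultimately have compK: "compact ((\<lambda>g. g *v z) ` K)"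
    unfolding K_def image_image by (rule compact_continuous_image[rotated])
  have K'open: "openin T K'" unfolding K'_def by (intro chart_open_image[OF \<phi>(1)] openin_open_Int) simp
  have K'1: "mat 1 \<in> K'" unfolding K'_def using \<phi> \<rho>(1) by (intro image_eqI[of _ _ p]) auto
  define \<U> where "\<U> = (\<lambda>g. {b \<in> G. matrix_inv g ** b \<in> K'}) ` G"
  have "openin T U" if "U \<in> \<U>" for U
    using that unfolding \<U>_def by (auto intro!: open_left_translate group_laws K'open)
  moreover have "\<Union>\<U> = topspace T"
    unfolding topspace \<U>_def using K'1 matrix_inv_mult(2)[OF group_laws(1)] by force
  ultimately obtain \<V> where \<V>: "countable \<V>" "\<V> \<subseteq> \<U>" "\<Union>\<V> = G"
    using second_countable_imp_Lindelof_space[OF countable] topspace unfolding Lindelof_space_def by metis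
  have "countable \<V> \<and> \<V> \<subseteq> (\<lambda>g. {b \<in> G. matrix_inv g ** b \<in> K'}) ` G" using \<V>(1,2) unfolding \<U>_def by simp
  from this[unfolded countable_subset_image] obtain C
    where C: "countable C" "C \<subseteq> G" "\<V> = (\<lambda>g. {b \<in> G. matrix_inv g ** b \<in> K'}) ` C" by (elim exE conjE) (rule that)
  define P where "P = (\<lambda>g :: real ^ 'n ^ 'n. (\<lambda>x. g *v x) ` (\<lambda>k. k *v z) ` K)"
  have closedP: "closed (P g)" for g
    unfolding P_def by (intro compact_imp_closed compact_continuous_image compK linear_continuous_on) simp
  have PM: "P g \<subseteq> M" if "g \<in> G" for g
    unfolding P_def M_def using that KG group_laws(3) by (auto simp: matrix_vector_mul_assoc)
  have cover: "M \<subseteq> (\<Union>g\<in>C. P g)"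
  proof
    fix y assume "y \<in> M"
    then obtain b where b: "b \<in> G" "y = b *v z" unfolding M_def by blast
    then obtain g where g: "g \<in> C" "matrix_inv g ** b \<in> K'" using \<V>(3) unfolding C(3) by blast
    have "g *v ((matrix_inv g ** b) *v z) = y"
      using matrix_inv_mult(1)[OF group_laws(1), of g] g(1) C(2) b(2)
      by (simp add: matrix_vector_mul_assoc matrix_mul_assoc subsetD)
    then have "y \<in> P g" unfolding P_def using g(2) K'K by blast
    then show "y \<in> (\<Union>g\<in>C. P g)" using g(1) by blast
  qed
  have zM: "z \<in> M" unfolding M_def using group_laws(2) by (intro image_eqI[of _ _ "mat 1"]) auto
  have "\<exists>g\<in>C. \<not> M \<subseteq> closure (M - P g)"
  proof (rule ccontr)
    assume dense: "\<not> ?thesis"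
    have "M \<subseteq> closure (\<Inter>((\<lambda>g. M - P g) ` C))"
    proof (rule Baire)
      show "closed M" using closed unfolding M_def .
      show "countable ((\<lambda>g. M - P g) ` C)" using C(1) by blast
      fix S assume "S \<in> (\<lambda>g. M - P g) ` C"
      then obtain g where "g \<in> C" "S = M - P g" by blast
      then show "openin (top_of_set M) S \<and> M \<subseteq> closure S"
        using dense closedP by (auto intro: openin_diff closedin_closed_Int simp: Diff_eq openin_open_Int open_Compl)
    qed
    moreover have "C \<noteq> {}" using cover zM by blast
    then have "\<Inter>((\<lambda>g. M - P g) ` C) = {}" using cover by blast
    ultimately show False using zM by simp
  qed
  then obtain g y where g: "g \<in> C" and y: "y \<in> M" "y \<notin> closure (M - P g)" by blast
  then obtain r where "r > 0" "\<forall>x\<in>M - P g. \<not> dist x y < r" unfolding closure_approachable by blast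
  then have r: "r > 0" "ball y r \<inter> (M - P g) = {}" by (auto simp: dist_commute)
  have gG: "g \<in> G" using g C(2) by blast
  have "y \<in> P g" using r y(1) by (auto simp: disjoint_iff)
  then obtain k where k: "k \<in> K" "y = g *v (k *v z)" unfolding P_def by blast
  have kG: "k \<in> G" using k KG by blast
  have "bounded_linear (\<lambda>x. g *v (k *v x))"
    by (rule bounded_linear_compose[of "(*v) g" "(*v) k"]) simp_all
  then have "isCont (\<lambda>x. g *v (k *v x)) z" by (rule linear_continuous_at)
  then obtain \<delta> where \<delta>: "\<delta> > 0" "\<And>x. dist x z < \<delta> \<Longrightarrow> dist (g *v (k *v x)) y < r"
    using r(1) unfolding continuous_at_eps_delta k(2) by blast
  have "M \<inter> ball z \<delta> \<subseteq> (\<lambda>g. g *v z) ` \<Omega>"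
  proof
    fix x assume x: "x \<in> M \<inter> ball z \<delta>"
    then obtain a where a: "a \<in> G" "x = a *v z" unfolding M_def by blast
    have "g *v (k *v x) = (g ** (k ** a)) *v z" unfolding a(2) by (simp add: matrix_vector_mul_assoc)
    then have "g *v (k *v x) \<in> M" unfolding M_def using group_laws(3) a(1) gG kG by blast
    moreover have "g *v (k *v x) \<in> ball y r" using \<delta>(2)[of x] x by (simp add: dist_commute)
    ultimately have "g *v (k *v x) \<in> P g" using r(2) by blast
    then obtain k' where k': "k' \<in> K" "g *v (k *v x) = g *v (k' *v z)" unfolding P_def by blast
    have "matrix_inv g *v (g *v (k *v x)) = matrix_inv g *v (g *v (k' *v z))" using k'(2) by simp
    then have "k *v x = k' *v z"
      unfolding inverse_apply[OF gG] .
    then have "matrix_inv k *v (k *v x) = matrix_inv k *v (k' *v z)" by simp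
    then have "x = (matrix_inv k ** k') *v z"
      unfolding inverse_apply[OF kG] by (simp add: matrix_vector_mul_assoc)
    moreover have "matrix_inv k ** k' \<in> \<Omega>" using \<Omega>'(3) k(1) k'(1) K\<Omega> by blast
    ultimately show "x \<in> (\<lambda>g. g *v z) ` \<Omega>" by blast
  qed
  then show thesis using that \<delta>(1) unfolding M_def by blast
qed

text \<open>
  If \<open>w\<close> is orthogonal to all \<open>X x\<close>, then it is almost orthogonal to all \<open>X z\<close>, as \<open>x\<close> is close to \<open>z\<close> and \<open>X\<close>
  can be chosen of norm \<open>O(|X z|)\<close>. The secant \<open>y' - y\<close> differs little from some \<open>X z\<close>.
\<close>

lemma secants_almost_tangent:
  fixes z :: "real ^ 'n"
  assumes closed: "closed ((\<lambda>g. g *v z) ` G)"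
  obtains \<epsilon> where "\<epsilon> > 0" "\<And>x w y y'. x \<in> ball z \<epsilon> \<Longrightarrow> (\<And>X. X \<in> lie_algebra T \<Longrightarrow> w \<bullet> (X *v x) = 0) \<Longrightarrow>
    y \<in> (\<lambda>g. g *v z) ` G \<inter> ball z \<epsilon> \<Longrightarrow> y' \<in> (\<lambda>g. g *v z) ` G \<inter> ball z \<epsilon> \<Longrightarrow>
    \<bar>w \<bullet> (y' - y)\<bar> \<le> 1 / 2 * norm w * norm (y' - y)"
proof -
  define \<theta> :: real where "\<theta> = 1 / 8"
  obtain \<Omega> where \<Omega>: "openin T \<Omega>" "mat 1 \<in> \<Omega>" and flat: "\<And>a b. a \<in> \<Omega> \<Longrightarrow> b \<in> \<Omega> \<Longrightarrow> \<exists>X\<in>lie_algebra T.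
     norm (a *v z - b *v z - X *v z) \<le> \<theta> * norm (X *v z)"
    using orbit_flat[of \<theta> z] unfolding \<theta>_def by auto
  obtain \<delta> where \<delta>: "\<delta> > 0" "(\<lambda>g. g *v z) ` G \<inter> ball z \<delta> \<subseteq> (\<lambda>g. g *v z) ` \<Omega>"
    using orbit_map_open_at_identity[OF closed \<Omega>] .
  obtain J where J: "J ` UNIV \<subseteq> lie_algebra T" "linear J"
    "\<And>e. e \<in> (\<lambda>X. X *v z) ` lie_algebra T \<Longrightarrow> J e *v z = e"
    using linear_exists_right_inverse_on[OF linear_matrix_mult_vec lie_algebra_subspace, of z] by blast
  have "bounded_linear J" using J(2) linear_conv_bounded_linear by blast
  then obtain B where B: "B > 0" "\<And>e. norm (J e) \<le> B * norm e"
    using bounded_linear.pos_bounded by (metis mult.commute)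
  define \<epsilon> where "\<epsilon> = min \<delta> (\<theta> / B)"
  have \<epsilon>: "\<epsilon> > 0" "\<epsilon> \<le> \<delta>" "B * \<epsilon> \<le> \<theta>"
    unfolding \<epsilon>_def \<theta>_def using \<delta>(1) B(1) by (auto simp: min_def field_simps)
  have "\<bar>w \<bullet> (y' - y)\<bar> \<le> 1 / 2 * norm w * norm (y' - y)"
    if x: "x \<in> ball z \<epsilon>" and w: "\<And>X. X \<in> lie_algebra T \<Longrightarrow> w \<bullet> (X *v x) = 0"
      and y: "y \<in> (\<lambda>g. g *v z) ` G \<inter> ball z \<epsilon>" "y' \<in> (\<lambda>g. g *v z) ` G \<inter> ball z \<epsilon>" for x w y y'
  proof -
    have "y \<in> (\<lambda>g. g *v z) ` \<Omega>" "y' \<in> (\<lambda>g. g *v z) ` \<Omega>" using y \<delta>(2) \<epsilon>(2) by auto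
    then obtain X where X: "X \<in> lie_algebra T" "norm (y' - y - X *v z) \<le> \<theta> * norm (X *v z)"
      using flat by blast
    define h where "h = X *v z"
    have Jh: "J h *v z = h" "J h \<in> lie_algebra T" using J X(1) unfolding h_def by blast+
    have "w \<bullet> h = w \<bullet> (J h *v (z - x))"
      using w[OF Jh(2)] Jh(1) by (simp add: matrix_vector_mult_diff_distrib inner_diff_right)
    then have "\<bar>w \<bullet> h\<bar> \<le> norm w * norm (J h *v (z - x))" by (simp add: Cauchy_Schwarz_ineq2)
    also have "norm (J h *v (z - x)) \<le> norm (J h) * norm (z - x)" by (rule norm_matrix_vector_le)
    also have "\<dots> \<le> (B * norm h) * \<epsilon>"
      using B x by (intro mult_mono) (auto simp: dist_norm)
    also have "\<dots> \<le> \<theta> * norm h" using mult_right_mono[OF \<epsilon>(3), of "norm h"] by (simp add: mult_ac)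
    finally have 1: "\<bar>w \<bullet> h\<bar> \<le> norm w * (\<theta> * norm h)" by (simp add: mult_left_mono)
    have 2: "\<bar>w \<bullet> (y' - y - h)\<bar> \<le> norm w * (\<theta> * norm h)"
      using X(2) unfolding h_def by (meson Cauchy_Schwarz_ineq2 mult_left_mono norm_ge_zero order_trans)
    have "norm h \<le> norm (y' - y) + norm (y' - y - h)"
      by (metis norm_triangle_sub norm_minus_commute add.commute)
    then have 3: "norm h \<le> 2 * norm (y' - y)" using X(2) norm_ge_zero[of "y' - y"] unfolding h_def \<theta>_def by linarith
    have "w \<bullet> (y' - y) = w \<bullet> h + w \<bullet> (y' - y - h)" by (simp add: inner_diff_right)
    then have "\<bar>w \<bullet> (y' - y)\<bar> \<le> norm w * (\<theta> * norm h) + norm w * (\<theta> * norm h)" using 1 2 by linarith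
    also have "\<dots> = 1 / 4 * norm w * norm h" unfolding \<theta>_def by simp
    also have "\<dots> \<le> 1 / 4 * norm w * (2 * norm (y' - y))" using 3 by (intro mult_left_mono) auto
    finally show ?thesis by simp
  qed
  then show thesis using that \<epsilon>(1) by blast
qed

end

section \<open>The conserved quantity\<close>

lemma orthogonal_projection_properties:
  fixes V :: "'a::euclidean_space set"
  assumes V: "subspace V"
  shows "orthogonal_projection V x \<in> V" "v \<in> V \<Longrightarrow> orthogonal_projection V x \<bullet> v = x \<bullet> v"
    and orthogonal_projection_unique: "p \<in> V \<Longrightarrow> (\<And>v. v \<in> V \<Longrightarrow> p \<bullet> v = x \<bullet> v) \<Longrightarrow> orthogonal_projection V x = p"
proof -
  have uniq: "p = p'" if "p \<in> V \<and> (\<forall>v\<in>V. orthogonal (x - p) v)" "p' \<in> V \<and> (\<forall>v\<in>V. orthogonal (x - p') v)" for p p'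
  proof -
    have "p - p' \<in> V" using that V subspace_diff by blast
    then have "orthogonal (x - p) (p - p')" "orthogonal (x - p') (p - p')" using that by blast+
    then have "(p - p') \<bullet> (p - p') = 0" by (simp add: orthogonal_def inner_diff_left inner_diff_right algebra_simps)
    then show ?thesis by simp
  qed
  obtain y w where yw: "y \<in> span V" "\<And>v. v \<in> span V \<Longrightarrow> orthogonal w v" "x = y + w"
    using orthogonal_subspace_decomp_exists[of V x] by metis
  have spanV: "span V = V" using V by (simp add: span_eq_iff)
  have ex: "y \<in> V \<and> (\<forall>v\<in>V. orthogonal (x - y) v)" using yw spanV by simp
  have "orthogonal_projection V x \<in> V \<and> (\<forall>v\<in>V. orthogonal (x - orthogonal_projection V x) v)"
    unfolding orthogonal_projection_def by (rule theI[of "\<lambda>p. p \<in> V \<and> (\<forall>v\<in>V. orthogonal (x - p) v)" y, OF ex]) (use uniq ex in blast)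
  then show "orthogonal_projection V x \<in> V" "v \<in> V \<Longrightarrow> orthogonal_projection V x \<bullet> v = x \<bullet> v"
    by (auto simp: orthogonal_def inner_diff_left)
  assume p: "p \<in> V" "\<And>v. v \<in> V \<Longrightarrow> p \<bullet> v = x \<bullet> v"
  then have "p \<in> V \<and> (\<forall>v\<in>V. orthogonal (x - p) v)" by (simp add: orthogonal_def inner_diff_left)
  then show "orthogonal_projection V x = p"
    unfolding orthogonal_projection_def using uniq by (intro the_equality) blast+
qed

lemma linear_orthogonal_projection:
  fixes V :: "'a::euclidean_space set"
  assumes V: "subspace V" shows "linear (orthogonal_projection V)"
proof (rule linearI)
  note P = orthogonal_projection_properties[OF V]
  show "orthogonal_projection V (x + y) = orthogonal_projection V x + orthogonal_projection V y" for x y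
    by (rule orthogonal_projection_unique[OF V]) (use P V in \<open>auto simp: inner_add_left intro: subspace_add\<close>)
  show "orthogonal_projection V (c *\<^sub>R x) = c *\<^sub>R orthogonal_projection V x" for c x
    by (rule orthogonal_projection_unique[OF V]) (use P V in \<open>auto intro: subspace_scale\<close>)
qed

context lie_subgroup
begin

lemma symmetric_part_subspace: "subspace (symmetric_part (lie_algebra T))"
proof -
  have "transpose (A + B) = transpose A + transpose B" "transpose (c *\<^sub>R A) = c *\<^sub>R transpose A"
    "transpose (0 :: real ^ 'n ^ 'n) = 0" for A B :: "real ^ 'n ^ 'n" and c
    by (simp_all add: transpose_def vec_eq_iff)
  then show ?thesis
    using lie_algebra_subspace unfolding symmetric_part_def subspace_def by auto
qed

lemma conserved_C_inner:
  assumes "X \<in> symmetric_part (lie_algebra T)"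
  shows "conserved_C T x \<bullet> X = x \<bullet> (X *v x)"
proof -
  have "conserved_C T x \<bullet> X = (\<chi> i j. x $ i * x $ j) \<bullet> X"
    unfolding conserved_C_def by (rule orthogonal_projection_properties(2)[OF symmetric_part_subspace assms])
  also have "\<dots> = x \<bullet> (X *v x)"
    by (simp add: inner_vec_def matrix_vector_mult_def sum_distrib_left mult_ac)
  finally show ?thesis .
qed

lemma conserved_C_mem: "conserved_C T x \<in> symmetric_part (lie_algebra T)"
  unfolding conserved_C_def by (rule orthogonal_projection_properties(1)[OF symmetric_part_subspace])

lemma continuous_conserved_C: "continuous_on UNIV (conserved_C T)"
proof -
  have "bounded_linear (orthogonal_projection (symmetric_part (lie_algebra T)))"
    using linear_orthogonal_projection[OF symmetric_part_subspace] linear_conv_bounded_linear by blast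
  moreover have "continuous_on UNIV (\<lambda>x :: real ^ 'n. (\<chi> i j. x $ i * x $ j))"
    by (intro continuous_intros)
  ultimately show ?thesis
    unfolding conserved_C_def[abs_def] by (rule bounded_linear.continuous_on)
qed

lemma conserved_C_zero: "conserved_C T 0 = 0"
  using conserved_C_inner[OF conserved_C_mem, of 0 0] by simp

text \<open>
  Both sides belong to the symmetric part of the Lie algebra and have the same inner product with
  each of its elements \<open>X\<close>, because \<open>x \<bullet> X v = v \<bullet> X x = 0\<close> by symmetry of \<open>X\<close> and orthogonality.
\<close>

lemma conserved_C_step:
  assumes orth: "\<And>X. X \<in> lie_algebra T \<Longrightarrow> v \<bullet> (X *v x) = 0"
  shows "conserved_C T (x - \<alpha> *\<^sub>R v) = conserved_C T x + \<alpha>\<^sup>2 *\<^sub>R conserved_C T v"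
proof -
  define d where "d = conserved_C T (x - \<alpha> *\<^sub>R v) - (conserved_C T x + \<alpha>\<^sup>2 *\<^sub>R conserved_C T v)"
  have "d \<bullet> X = 0" if X: "X \<in> symmetric_part (lie_algebra T)" for X
  proof -
    have X': "X \<in> lie_algebra T" "transpose X = X" using X unfolding symmetric_part_def by auto
    have "x \<bullet> (X *v v) = v \<bullet> (X *v x)" using X'(2) by (metis dot_lmul_matrix inner_commute vector_transpose_matrix)
    then show ?thesis
      unfolding d_def using orth[OF X'(1)]
      by (simp add: inner_diff_left inner_add_left conserved_C_inner[OF X] matrix_vector_mult_diff_distrib
          matrix_vector_mult_scaleR inner_diff_right power2_eq_square algebra_simps)
  qed
  moreover have "d \<in> symmetric_part (lie_algebra T)"
    unfolding d_def by (intro subspace_diff subspace_add subspace_scale symmetric_part_subspace conserved_C_mem)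
  ultimately have "d \<bullet> d = 0" by blast
  then show ?thesis unfolding d_def by simp
qed

end

section \<open>Trapped subgradient sequences\<close>

context lie_subgroup
begin

text \<open>
  Let \<open>y\<close> and \<open>y'\<close> be points of the orbit nearest to \<open>x\<close> and \<open>x + w\<close>. In \<open>w = (x + w - y') + (y' - y) + (y
  - x)\<close> the middle term is a secant of the orbit and contributes at most half of its length times
  \<open>|w|\<close> to \<open>w \<bullet> w\<close>; the outer terms are bounded by the distances to the orbit.
\<close>

lemma step_leaves_orbit:
  fixes z :: "real ^ 'n"
  defines "M \<equiv> (\<lambda>g. g *v z) ` G"
  assumes closed: "closed M"
  obtains \<epsilon> where "\<epsilon> > 0" "\<And>x w. x \<in> ball z \<epsilon> \<Longrightarrow> x + w \<in> ball z \<epsilon> \<Longrightarrow>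
    (\<And>X. X \<in> lie_algebra T \<Longrightarrow> w \<bullet> (X *v x) = 0) \<Longrightarrow> norm w / 3 - infdist x M \<le> infdist (x + w) M"
proof -
  obtain \<epsilon> where \<epsilon>: "\<epsilon> > 0" and secants: "\<And>x w y y'. x \<in> ball z \<epsilon> \<Longrightarrow> (\<And>X. X \<in> lie_algebra T \<Longrightarrow> w \<bullet> (X *v x) = 0) \<Longrightarrow>
    y \<in> M \<inter> ball z \<epsilon> \<Longrightarrow> y' \<in> M \<inter> ball z \<epsilon> \<Longrightarrow> \<bar>w \<bullet> (y' - y)\<bar> \<le> 1 / 2 * norm w * norm (y' - y)"
    using secants_almost_tangent[OF closed[unfolded M_def]] unfolding M_def by blast
  have zM: "z \<in> M" unfolding M_def using group_laws(2) by (intro image_eqI[of _ _ "mat 1"]) auto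
  have nearest: "\<exists>y\<in>M \<inter> ball z \<epsilon>. norm (y - x) = infdist x M" if x: "x \<in> ball z (\<epsilon> / 2)" for x
  proof -
    obtain y where y: "y \<in> M" "infdist x M = dist x y" using infdist_attains_inf[OF closed] zM by blast
    have "dist x y \<le> dist x z" using infdist_le[OF zM] y(2) by metis
    then have "dist z y < \<epsilon>" using x dist_triangle[of z y x] by (simp add: dist_commute)
    then show ?thesis using y by (auto simp: dist_norm norm_minus_commute)
  qed
  have "norm w / 3 - infdist x M \<le> infdist (x + w) M"
    if x: "x \<in> ball z (\<epsilon> / 2)" and xw: "x + w \<in> ball z (\<epsilon> / 2)"
      and w: "\<And>X. X \<in> lie_algebra T \<Longrightarrow> w \<bullet> (X *v x) = 0" for x w
  proof -
    obtain y where y: "y \<in> M \<inter> ball z \<epsilon>" "norm (y - x) = infdist x M" using nearest[OF x] by blast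
    obtain y' where y': "y' \<in> M \<inter> ball z \<epsilon>" "norm (y' - (x + w)) = infdist (x + w) M" using nearest[OF xw] by blast
    define d where "d = infdist x M + infdist (x + w) M"
    have d0: "d \<ge> 0" unfolding d_def by (simp add: infdist_nonneg)
    have r: "norm ((y' - y) - w) \<le> d"
      using norm_triangle_ineq4[of "y' - (x + w)" "y - x"] y(2) y'(2) unfolding d_def by (simp add: algebra_simps)
    have "norm (y' - y) \<le> norm w + norm ((y' - y) - w)" by (rule norm_triangle_sub)
    then have yy: "norm (y' - y) \<le> norm w + d" using r by simp
    have "x \<in> ball z \<epsilon>" using x \<epsilon> by auto
    then have s: "\<bar>w \<bullet> (y' - y)\<bar> \<le> 1 / 2 * norm w * norm (y' - y)" using secants w y(1) y'(1) by blast
    have "norm w * norm w = w \<bullet> (y' - y) - w \<bullet> ((y' - y) - w)"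
      by (simp add: inner_diff_right power2_norm_eq_inner[symmetric] power2_eq_square[symmetric])
    also have "\<dots> \<le> 1 / 2 * norm w * norm (y' - y) + norm w * norm ((y' - y) - w)"
      using s Cauchy_Schwarz_ineq2[of w "(y' - y) - w"] by linarith
    also have "\<dots> \<le> 1 / 2 * norm w * (norm w + d) + norm w * d"
      using yy r by (intro add_mono mult_left_mono) auto
    finally have "norm w * (norm w / 2) \<le> norm w * (3 / 2 * d)" by (simp add: field_simps)
    then have "norm w / 2 \<le> 3 / 2 * d" using d0 by (cases "w = 0") (auto simp: mult_le_cancel_left)
    then show ?thesis unfolding d_def by simp
  qed
  then show thesis using that[of "\<epsilon> / 2"] \<epsilon> by auto
qed

text \<open>
  The contradiction between conservation, which drives the sequence towards the orbit, and
  overshooting, which keeps it away.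
\<close>

lemma no_trapped_sequence_off_orbit:
  fixes f :: "real ^ 'n \<Rightarrow> real" and z :: "real ^ 'n"
  defines "M \<equiv> (\<lambda>g. g *v z) ` G"
  assumes f: "continuous_on UNIV f" and inv: "\<forall>g\<in>G. \<forall>x. f (g *v x) = f x"
    and closed: "closed M"
    and bounded: "\<And>x v. x \<in> cball z \<epsilon> \<Longrightarrow> v \<in> subdifferential f x \<Longrightarrow> norm v \<le> L"
    and pos: "\<And>x y u v. x \<in> cball z \<epsilon> - M \<Longrightarrow> y \<in> cball z \<epsilon> - M \<Longrightarrow> u \<in> subdifferential f x \<Longrightarrow>
       v \<in> subdifferential f y \<Longrightarrow> conserved_C T u \<bullet> conserved_C T v > 0"
    and subregular: "\<kappa> > 0" "\<eta> > 1" "\<And>x v. x \<in> cball z \<epsilon> \<Longrightarrow> v \<in> subdifferential f x \<Longrightarrow> infdist x M \<le> \<kappa> * norm v powr \<eta>"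
    and step: "\<And>x w. x \<in> cball z \<epsilon> \<Longrightarrow> x + w \<in> cball z \<epsilon> \<Longrightarrow>
      (\<And>X. X \<in> lie_algebra T \<Longrightarrow> w \<bullet> (X *v x) = 0) \<Longrightarrow> norm w / 3 - infdist x M \<le> infdist (x + w) M"
    and \<alpha>: "\<alpha> > 0" and X: "subgradient_sequence f \<alpha> X" "\<And>k. X k \<in> cball z \<epsilon>"
  shows "\<exists>k. X k \<in> M"
proof (rule ccontr)
  assume off: "\<nexists>k. X k \<in> M"
  have "\<forall>k. \<exists>v. v \<in> subdifferential f (X k) \<and> X (Suc k) = X k - \<alpha> *\<^sub>R v"
    using X(1) unfolding subgradient_sequence_def by blast
  then obtain v where v: "\<And>k. v k \<in> subdifferential f (X k)" "\<And>k. X (Suc k) = X k - \<alpha> *\<^sub>R v k" by metis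
  have zM: "z \<in> M" unfolding M_def using group_laws(2) by (intro image_eqI[of _ _ "mat 1"]) auto
  define a where "a = (\<lambda>k. infdist (X k) M)"
  define c where "c = (\<lambda>k. conserved_C T (v k))"
  have a_pos: "a k > 0" for k
    unfolding a_def using off closed zM infdist_nonneg[of "X k" M] in_closed_iff_infdist_zero[OF closed]
    by (metis empty_iff less_eq_real_def)
  have c_pos: "c i \<bullet> c j > 0" for i j unfolding c_def using pos v(1) X(2) off by blast
  have orth: "v k \<bullet> (Y *v X k) = 0" if "Y \<in> lie_algebra T" for k Y
    by (rule subgradient_orthogonal_to_orbit[OF inv that v(1)])
  have drift: "conserved_C T (X n) = conserved_C T (X 0) + \<alpha>\<^sup>2 *\<^sub>R (\<Sum>k<n. c k)" for n
  proof (induction n)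
    case (Suc n)
    then show ?case unfolding v(2) c_def using conserved_C_step[OF orth] by (simp add: scaleR_add_right)
  qed simp
  have "compact (conserved_C T ` cball z \<epsilon>)"
    using continuous_on_subset[OF continuous_conserved_C] by (intro compact_continuous_image) auto
  then have "bounded (conserved_C T ` cball z \<epsilon>)" by (rule compact_imp_bounded)
  then obtain R where "\<forall>y\<in>conserved_C T ` cball z \<epsilon>. norm y \<le> R"
    unfolding bounded_iff by (elim exE) (rule that)
  then have R: "norm (conserved_C T x) \<le> R" if "x \<in> cball z \<epsilon>" for x using that by simp
  have sum_le: "norm (\<Sum>k<n. c k) \<le> 2 * R / \<alpha>\<^sup>2" for n
  proof -
    have "norm (\<alpha>\<^sup>2 *\<^sub>R (\<Sum>k<n. c k)) = norm (conserved_C T (X n) - conserved_C T (X 0))" using drift[of n] by simp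
    also have "\<dots> \<le> 2 * R"
      using norm_triangle_ineq4[of "conserved_C T (X n)" "conserved_C T (X 0)"]
        R[OF X(2), of n] R[OF X(2), of 0] by linarith
    finally show ?thesis using \<alpha> by (simp add: field_simps)
  qed
  have squares: "(\<Sum>k<n. (norm (c k))\<^sup>2) \<le> (norm (\<Sum>k<n. c k))\<^sup>2" for n
  proof (induction n)
    case (Suc n)
    have "0 \<le> (\<Sum>k<n. c k) \<bullet> c n" unfolding inner_sum_left using c_pos by (intro sum_nonneg) (simp add: less_imp_le)
    then have "(norm (\<Sum>k<n. c k))\<^sup>2 + (norm (c n))\<^sup>2 \<le> (norm (\<Sum>k<Suc n. c k))\<^sup>2"
      by (simp add: power2_norm_eq_inner inner_add_left inner_add_right inner_commute)
    then show ?case using Suc by simp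
  qed simp
  have "summable (\<lambda>k. (norm (c k))\<^sup>2)"
  proof (rule summableI_nonneg_bounded)
    show "(\<Sum>k<n. (norm (c k))\<^sup>2) \<le> (2 * R / \<alpha>\<^sup>2)\<^sup>2" for n
      using squares[of n] power_mono[OF sum_le norm_ge_zero, of n 2] by linarith
  qed simp
  then have "(\<lambda>k. (norm (c k))\<^sup>2) \<longlonglongrightarrow> 0" by (rule summable_LIMSEQ_zero)
  from tendsto_real_sqrt[OF this] have c0: "(\<lambda>k. norm (c k)) \<longlonglongrightarrow> 0" by simp
  \<comment> \<open>Off the orbit, positivity with equal arguments forces \<open>C(u) \<noteq> 0\<close>; compactness makes this uniform.\<close>
  have away: "\<exists>b>0. \<forall>x\<in>cball z \<epsilon>. \<forall>u\<in>subdifferential f x. e \<le> infdist x M \<longrightarrow> b \<le> norm (conserved_C T u)"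
    if e: "e > 0" for e
  proof (rule ccontr)
    assume "\<not> ?thesis"
    then have small: "\<exists>x\<in>cball z \<epsilon>. \<exists>u\<in>subdifferential f x. e \<le> infdist x M \<and> norm (conserved_C T u) < b"
      if "b > 0" for b
      using that by (auto simp: not_le)
    have "\<forall>n. \<exists>p. fst p \<in> cball z \<epsilon> \<and> snd p \<in> subdifferential f (fst p) \<and> e \<le> infdist (fst p) M \<and>
        norm (conserved_C T (snd p)) < 1 / real (Suc n)"
    proof
      fix n
      obtain x u where "x \<in> cball z \<epsilon>" "u \<in> subdifferential f x" "e \<le> infdist x M"
        "norm (conserved_C T u) < 1 / real (Suc n)"
        using small[of "1 / real (Suc n)"] by auto
      then show "\<exists>p. fst p \<in> cball z \<epsilon> \<and> snd p \<in> subdifferential f (fst p) \<and> e \<le> infdist (fst p) M \<and>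
        norm (conserved_C T (snd p)) < 1 / real (Suc n)"
        by (intro exI[of _ "(x, u)"]) simp
    qed
    then obtain p where p: "\<And>n. fst (p n) \<in> cball z \<epsilon> \<and> snd (p n) \<in> subdifferential f (fst (p n)) \<and>
        e \<le> infdist (fst (p n)) M \<and> norm (conserved_C T (snd (p n))) < 1 / real (Suc n)" by metis
    define x where "x = (\<lambda>n. fst (p n))"
    define u where "u = (\<lambda>n. snd (p n))"
    have xu: "x n \<in> cball z \<epsilon>" "u n \<in> subdifferential f (x n)" "e \<le> infdist (x n) M"
      "norm (conserved_C T (u n)) < 1 / real (Suc n)" for n
      using p[of n] unfolding x_def u_def by auto
    have comp: "compact (cball z \<epsilon> \<times> cball (0 :: real ^ 'n) L)" by (intro compact_Times compact_cball)
    have "\<forall>n. (x n, u n) \<in> cball z \<epsilon> \<times> cball 0 L" using xu(1) bounded[OF xu(1,2)] by simp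
    with comp[unfolded compact_def, THEN spec, of "\<lambda>n. (x n, u n)"] obtain l s
      where l: "l \<in> cball z \<epsilon> \<times> cball 0 L" "strict_mono s" "((\<lambda>n. (x n, u n)) \<circ> s) \<longlonglongrightarrow> l"
      by auto
    obtain x0 u0 where l0: "l = (x0, u0)" by force
    have lim: "(\<lambda>n. x (s n)) \<longlonglongrightarrow> x0" "(\<lambda>n. u (s n)) \<longlonglongrightarrow> u0"
      using tendsto_fst[OF l(3)] tendsto_snd[OF l(3)] unfolding l0 by (simp_all add: o_def)
    have sub: "u0 \<in> subdifferential f x0" by (rule subdifferential_closed_graph[OF f xu(2) lim])
    have "(\<lambda>n. infdist (x (s n)) M) \<longlonglongrightarrow> infdist x0 M" by (rule tendsto_infdist[OF lim(1)])
    then have "e \<le> infdist x0 M" using xu(3) by (intro tendsto_lowerbound[where f = "\<lambda>n. infdist (x (s n)) M"]) (auto intro: always_eventually)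
    then have "x0 \<notin> M" using e by auto
    have "isCont (conserved_C T) u0" using continuous_conserved_C by (simp add: continuous_on_eq_continuous_at)
    from tendsto_norm[OF isCont_tendsto_compose[OF this lim(2)]]
    have "(\<lambda>n. norm (conserved_C T (u (s n)))) \<longlonglongrightarrow> norm (conserved_C T u0)" .
    moreover have "(\<lambda>n. norm (conserved_C T (u (s n)))) \<longlonglongrightarrow> 0"
    proof (rule tendsto_sandwich[OF _ _ tendsto_const])
      have "(\<lambda>k. 1 / real (Suc k)) \<longlonglongrightarrow> 0" using LIMSEQ_inverse_real_of_nat by (simp add: inverse_eq_divide)
      from LIMSEQ_subseq_LIMSEQ[OF this l(2)] show "(\<lambda>n. 1 / real (Suc (s n))) \<longlonglongrightarrow> 0" by (simp add: o_def)
    qed (use xu(4) in \<open>auto intro: always_eventually less_imp_le\<close>)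
    ultimately have "conserved_C T u0 = 0" using LIMSEQ_unique by fastforce
    moreover have "x0 \<in> cball z \<epsilon> - M" using l(1) l0 \<open>x0 \<notin> M\<close> by simp
    ultimately show False using pos[of x0 x0 u0 u0] sub by simp
  qed
  have a0: "a \<longlonglongrightarrow> 0"
  proof (rule order_tendstoI)
    fix e :: real assume "0 < e"
    then obtain b where b: "b > 0" "\<And>x u. x \<in> cball z \<epsilon> \<Longrightarrow> u \<in> subdifferential f x \<Longrightarrow> e \<le> infdist x M \<Longrightarrow> b \<le> norm (conserved_C T u)"
      using away by meson
    have "\<forall>\<^sub>F k in sequentially. norm (c k) < b" using c0 b(1) by (rule order_tendstoD)
    then show "\<forall>\<^sub>F k in sequentially. a k < e"
    proof eventually_elim
      case (elim k)
      then show ?case using b(2)[OF X(2) v(1), of k] unfolding a_def c_def by linarith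
    qed
  qed (use a_pos in \<open>auto intro: always_eventually less_trans\<close>)
  \<comment> \<open>the threshold for \<open>|v|\<close> below which \<open>6 \<kappa> |v|\<^sup>\<eta> \<le> \<alpha> |v|\<close>\<close>
  define b where "b = (\<alpha> / (6 * \<kappa>)) powr (1 / (\<eta> - 1))"
  have b: "b > 0" unfolding b_def using \<alpha> subregular(1) by simp
  have "\<forall>\<^sub>F k in sequentially. a k < \<alpha> * b / 6" using a0 \<alpha> b by (intro order_tendstoD) auto
  then have "\<forall>\<^sub>F k in sequentially. a k \<le> a (Suc k)"
  proof eventually_elim
    case (elim k)
    have sub: "a k \<le> \<kappa> * norm (v k) powr \<eta>" unfolding a_def by (rule subregular(3)[OF X(2) v(1)])
    have "6 * a k \<le> \<alpha> * norm (v k)"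
    proof (cases "norm (v k) < b")
      case True
      have v0: "norm (v k) > 0" using sub a_pos[of k] by (cases "v k = 0") auto
      have "norm (v k) powr (\<eta> - 1) \<le> b powr (\<eta> - 1)" using True subregular(2) by (intro powr_mono2) auto
      also have "\<dots> = \<alpha> / (6 * \<kappa>)" unfolding b_def powr_powr using subregular(1,2) \<alpha> by simp
      finally have "\<kappa> * (norm (v k) powr (\<eta> - 1) * norm (v k)) \<le> \<kappa> * (\<alpha> / (6 * \<kappa>) * norm (v k))"
        using subregular(1) by (intro mult_left_mono mult_right_mono) auto
      moreover have "norm (v k) powr (\<eta> - 1) * norm (v k) = norm (v k) powr \<eta>"
        using v0 by (simp add: powr_diff)
      ultimately show ?thesis using sub subregular(1) by simp
    next
      case False
      then have "\<alpha> * b \<le> \<alpha> * norm (v k)" using \<alpha> by simp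
      then show ?thesis using elim by simp
    qed
    moreover have "norm (- (\<alpha> *\<^sub>R v k)) / 3 - infdist (X k) M \<le> infdist (X k + - (\<alpha> *\<^sub>R v k)) M"
      using X(2)[of k] X(2)[of "Suc k"] v(2)[of k] orth by (intro step) auto
    ultimately show ?case unfolding a_def v(2) using \<alpha> by simp
  qed
  then obtain K where K: "\<And>k. k \<ge> K \<Longrightarrow> a k \<le> a (Suc k)" unfolding eventually_sequentially by blast
  have mono: "a K \<le> a (K + n)" for n
  proof (induction n)
    case (Suc n) then show ?case using K[of "K + n"] by simp
  qed simp
  have "\<forall>\<^sub>F k in sequentially. a k < a K" using a0 a_pos by (intro order_tendstoD)
  then obtain N where "\<And>k. k \<ge> N \<Longrightarrow> a k < a K" unfolding eventually_sequentially by blast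
  from this[of "K + N"] mono[of N] show False by simp
qed

text \<open>
  By homogeneity, an orbit with an interior point is open; being closed as well, it is the whole
  space and contains 0. But the orbit of 0 is a single point.
\<close>

lemma closed_orbit_has_empty_interior:
  fixes z :: "real ^ 'n"
  assumes closed: "closed ((\<lambda>g. g *v z) ` G)"
  shows "interior ((\<lambda>g. g *v z) ` G) = {}"
proof (rule ccontr)
  define M where "M = (\<lambda>g. g *v z) ` G"
  assume "interior ((\<lambda>g. g *v z) ` G) \<noteq> {}"
  then obtain U y where U: "open U" "y \<in> U" "U \<subseteq> M" unfolding M_def interior_def by blast
  have invariant: "g *v x \<in> M" if "g \<in> G" "x \<in> M" for g x
    using that group_laws(3) unfolding M_def by (auto simp: matrix_vector_mul_assoc)
  obtain a where a: "a \<in> G" "y = a *v z" using U unfolding M_def by blast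
  have "open M"
  proof (subst open_subopen, rule ballI)
    fix x assume "x \<in> M"
    then obtain b where b: "b \<in> G" "x = b *v z" unfolding M_def by blast
    define h where "h = a ** matrix_inv b"
    have h: "h \<in> G" unfolding h_def using a b group_laws by blast
    have "h *v x = y"
      unfolding h_def b(2) a(2) matrix_vector_mul_assoc[symmetric] inverse_apply[OF b(1)] ..
    have "open ((*v) h -` U)" by (rule continuous_open_vimage[OF U(1)]) (rule linear_continuous_at, simp)
    moreover have "x \<in> (*v) h -` U" using \<open>h *v x = y\<close> U(2) by simp
    moreover have "(*v) h -` U \<subseteq> M"
    proof
      fix x assume "x \<in> (*v) h -` U"
      then have "h *v x \<in> M" using U(3) by blast
      from invariant[OF group_laws(4)[OF h] this] show "x \<in> M" unfolding inverse_apply[OF h] .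
    qed
    ultimately show "\<exists>T. open T \<and> x \<in> T \<and> T \<subseteq> M" by blast
  qed
  then have "M = UNIV" using clopen[of M] closed U unfolding M_def by blast
  then obtain b where b: "b \<in> G" "0 = b *v z" unfolding M_def by blast
  then have "z = 0" using inverse_apply[OF b(1), of z] by simp
  then have "M \<subseteq> {0}" unfolding M_def by auto
  moreover have "axis undefined 1 \<noteq> (0 :: real ^ 'n)" by (simp add: axis_eq_0_iff)
  ultimately show False using \<open>M = UNIV\<close> by blast
qed

end

theorem theorem8:
  fixes S :: "nat \<Rightarrow> real list set set"
    and f :: "real ^ 'n \<Rightarrow> real"
    and G :: "(real ^ 'n ^ 'n) set"
    and T :: "(real ^ 'n ^ 'n) topology"
    and xbar :: "real ^ 'n"
    and \<eta> :: real
  assumes "ominimal_structure S"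
    and "definable_fun S f"
    and "locally_Lipschitz f"
    and "lie_subgroup_GL G T"
    and "\<forall>g\<in>G. \<forall>x. f (g *v x) = f x"
    and "connected_component_set {x. f x = f xbar} xbar = (\<lambda>g. g *v xbar) ` G"
    and "\<eta> > 1"
    and "metrically_subregular \<eta> (subdifferential f) xbar 0"
    and "\<exists>\<delta>>0. \<forall>x \<in> ball xbar \<delta> - (\<lambda>g. g *v xbar) ` G.
           \<forall>y \<in> ball xbar \<delta> - (\<lambda>g. g *v xbar) ` G.
             \<forall>u \<in> subdifferential f x. \<forall>v \<in> subdifferential f y.
               conserved_C T u \<bullet> conserved_C T v > 0"
  shows "strongly_unstable f xbar"
proof -
  interpret ominimal S by unfold_locales fact
  interpret lie_subgroup G T by unfold_locales fact
  have df: "definable_function f" by (rule definable_function_if_definable_fun) fact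
  have contf: "continuous_on UNIV f" by (rule locally_Lipschitz_continuous) fact
  define M where "M = (\<lambda>g. g *v xbar) ` G"
  have "closed {x. f x = f xbar}"
    using continuous_closed_preimage[OF contf closed_UNIV closed_singleton[of "f xbar"]]
    by (simp add: vimage_def)
  then have closedM: "closed M" unfolding M_def assms(6)[symmetric] by (rule closed_connected_component)
  have M_level: "f x = f xbar" if "x \<in> M" for x
    using that connected_component_subset[of "{x. f x = f xbar}" xbar] unfolding M_def assms(6)[symmetric] by blast
  have zM: "xbar \<in> M" unfolding M_def using group_laws(2) by (intro image_eqI[of _ _ "mat 1"]) auto
  obtain \<delta> where \<delta>: "\<delta> > 0" and pos: "\<And>x y u v. x \<in> ball xbar \<delta> - M \<Longrightarrow> y \<in> ball xbar \<delta> - M \<Longrightarrow>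
      u \<in> subdifferential f x \<Longrightarrow> v \<in> subdifferential f y \<Longrightarrow> conserved_C T u \<bullet> conserved_C T v > 0"
    using assms(9) unfolding M_def by blast
  have critical: "x \<in> M" if "x \<in> ball xbar \<delta>" "0 \<in> subdifferential f x" for x
    using pos[of x x 0 0] that by (cases "x \<in> M") (auto simp: conserved_C_zero)
  obtain \<kappa> r where \<kappa>: "\<kappa> > 0" "r > 0" and subreg: "\<And>x. x \<in> cball xbar r \<Longrightarrow> subdifferential f x \<noteq> {} \<Longrightarrow>
      infdist x {z. 0 \<in> subdifferential f z} \<le> \<kappa> * infdist 0 (subdifferential f x) powr \<eta>"
    and zcrit: "0 \<in> subdifferential f xbar"
    using assms(8) unfolding metrically_subregular_def by blast
  obtain \<rho> L where \<rho>: "\<rho> > 0" "L-lipschitz_on (ball xbar \<rho>) f"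
    using assms(3) unfolding locally_Lipschitz_def by blast
  obtain \<epsilon>0 where \<epsilon>0: "\<epsilon>0 > 0" and step: "\<And>x w. x \<in> ball xbar \<epsilon>0 \<Longrightarrow> x + w \<in> ball xbar \<epsilon>0 \<Longrightarrow>
    (\<And>X. X \<in> lie_algebra T \<Longrightarrow> w \<bullet> (X *v x) = 0) \<Longrightarrow> norm w / 3 - infdist x M \<le> infdist (x + w) M"
    using step_leaves_orbit[of xbar, folded M_def, OF closedM] by blast
  \<comment> \<open>At most half of \<open>\<delta>\<close>, so that \<open>xbar\<close> is at least as close to a point of the ball as any critical point outside \<open>ball xbar \<delta>\<close>.\<close>
  define \<epsilon> where "\<epsilon> = Min {\<delta>, r, \<rho>, \<epsilon>0} / 2"
  have \<epsilon>: "\<epsilon> > 0" "2 * \<epsilon> \<le> \<delta>" "\<epsilon> < r" "\<epsilon> < \<rho>" "\<epsilon> < \<epsilon>0"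
    unfolding \<epsilon>_def using \<delta> \<kappa>(2) \<rho>(1) \<epsilon>0 by (auto simp: min_def)
  have subregular: "infdist x M \<le> \<kappa> * norm v powr \<eta>"
    if x: "x \<in> cball xbar \<epsilon>" and v: "v \<in> subdifferential f x" for x v
  proof -
    have "infdist x M \<le> dist x y" if "0 \<in> subdifferential f y" for y
    proof (cases "y \<in> ball xbar \<delta>")
      case True
      then show ?thesis using critical that infdist_le by blast
    next
      case False
      have "infdist x M \<le> dist x xbar" using zM by (rule infdist_le)
      moreover have "dist xbar y \<le> dist xbar x + dist x y" by (rule dist_triangle)
      ultimately show ?thesis using False x \<epsilon>(2) by (simp add: dist_commute)
    qed
    then have "infdist x M \<le> (INF y\<in>{z. 0 \<in> subdifferential f z}. dist x y)"
      using zcrit by (intro cINF_greatest) auto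
    also have "\<dots> = infdist x {z. 0 \<in> subdifferential f z}"
      using zcrit by (intro infdist_notempty[symmetric]) blast
    also have "\<dots> \<le> \<kappa> * infdist 0 (subdifferential f x) powr \<eta>"
      using x v \<epsilon>(3) by (intro subreg) auto
    also have "infdist 0 (subdifferential f x) \<le> norm v" using infdist_le[OF v, of 0] by simp
    then have "\<kappa> * infdist 0 (subdifferential f x) powr \<eta> \<le> \<kappa> * norm v powr \<eta>"
      using \<kappa>(1) assms(7) by (intro mult_left_mono powr_mono2) (auto simp: infdist_nonneg)
    finally show ?thesis .
  qed
  have trapped: "\<exists>k. X k \<in> M"
    if \<alpha>: "\<alpha> > 0" and X: "subgradient_sequence f \<alpha> X" "\<And>k. X k \<in> cball xbar \<epsilon>" for \<alpha> X
  proof (rule no_trapped_sequence_off_orbit[of f xbar, folded M_def, OF contf assms(5)])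
    show "closed M" by (rule closedM)
    show "norm v \<le> L" if "x \<in> cball xbar \<epsilon>" "v \<in> subdifferential f x" for x v
      using subdifferential_bounded[OF \<rho>(2) _ that(2)] that(1) \<epsilon>(4) by auto
    show "conserved_C T u \<bullet> conserved_C T v > 0"
      if "x \<in> cball xbar \<epsilon> - M" "y \<in> cball xbar \<epsilon> - M" "u \<in> subdifferential f x" "v \<in> subdifferential f y" for x y u v
      using pos[OF _ _ that(3,4)] that(1,2) \<epsilon> by auto
    show "norm w / 3 - infdist x M \<le> infdist (x + w) M"
      if "x \<in> cball xbar \<epsilon>" "x + w \<in> cball xbar \<epsilon>" "\<And>X. X \<in> lie_algebra T \<Longrightarrow> w \<bullet> (X *v x) = 0" for x w
      using step[OF _ _ that(3)] that(1,2) \<epsilon> by auto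
  qed (use \<kappa> assms(7) subregular \<alpha> X in auto)
  \<comment> \<open>\<open>M\<close> itself is replaced near \<open>xbar\<close> by a larger set that is visibly definable.\<close>
  define N where "N = {x. f x = f xbar \<and> norm (x - xbar) \<le> \<epsilon>}"
  have "negligible N"
  proof (rule definable_negligible_if_interior_empty)
    show "definable (\<lambda>e. vec_of e \<in> N)"
      unfolding N_def mem_Collect_eq by (intro definable_intros definable_term_function[OF df])
    have "interior N \<subseteq> M"
    proof
      fix x assume x: "x \<in> interior N"
      have "f y = f x" if "y \<in> interior N" for y
      proof -
        have "y \<in> N" "x \<in> N" using that x interior_subset by blast+
        then show ?thesis by (simp add: N_def)
      qed
      then have "0 \<in> subdifferential f x" by (rule zero_subgradient_at_local_constancy[OF open_interior x])
      moreover have "x \<in> ball xbar \<delta>"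
        using x interior_subset[of N] \<epsilon>(1,2) by (auto simp: N_def dist_norm norm_minus_commute)
      ultimately show "x \<in> M" by (rule critical[rotated])
    qed
    then have "interior N \<subseteq> interior M" by (simp add: interior_maximal)
    then show "interior N = {}" using closed_orbit_has_empty_interior closedM unfolding M_def by blast
  qed
  define bad where "bad = {\<alpha>. \<not> (\<forall>N. negligible N \<longrightarrow> negligible {x. \<exists>v\<in>subdifferential f x. x - \<alpha> *\<^sub>R v \<in> N})}"
  have "finite bad" unfolding bad_def by (rule null_preimages_of_subgradient_step[OF df])
  moreover have "AE x in lebesgue. x \<in> cball xbar \<epsilon> \<longrightarrow>
      (\<forall>X. X 0 = x \<and> subgradient_sequence f \<alpha> X \<longrightarrow> (\<exists>k. X k \<notin> cball xbar \<epsilon>))"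
    if \<alpha>: "\<alpha> > 0" "\<alpha> \<notin> bad" for \<alpha>
  proof -
    define P where "P = (\<lambda>A. {x. \<exists>v\<in>subdifferential f x. x - \<alpha> *\<^sub>R v \<in> A})"
    have negl: "negligible ((P ^^ j) N)" for j
    proof (induction j)
      case (Suc j)
      then show ?case using \<alpha>(2) unfolding bad_def P_def by simp
    qed (simp add: \<open>negligible N\<close>)
    have reach: "X k \<in> (P ^^ j) N" if seq: "subgradient_sequence f \<alpha> X" and hit: "X (k + j) \<in> N" for X k j
      using hit
    proof (induction j arbitrary: k)
      case (Suc j)
      then have "X (Suc k) \<in> (P ^^ j) N" by simp
      moreover obtain v where "v \<in> subdifferential f (X k)" "X (Suc k) = X k - \<alpha> *\<^sub>R v"
        using seq unfolding subgradient_sequence_def by blast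
      ultimately show ?case unfolding P_def by auto
    qed simp
    have "negligible (\<Union>(range (\<lambda>j. (P ^^ j) N)))"
      using negl by (intro negligible_countable_Union) auto
    then have "(\<Union>j. (P ^^ j) N) \<in> null_sets lebesgue" by (simp add: negligible_iff_null_sets)
    then show ?thesis
    proof (rule AE_I')
      show "{x \<in> space lebesgue. \<not> (x \<in> cball xbar \<epsilon> \<longrightarrow>
          (\<forall>X. X 0 = x \<and> subgradient_sequence f \<alpha> X \<longrightarrow> (\<exists>k. X k \<notin> cball xbar \<epsilon>)))} \<subseteq> (\<Union>j. (P ^^ j) N)"
      proof
        fix x assume "x \<in> {x \<in> space lebesgue. \<not> (x \<in> cball xbar \<epsilon> \<longrightarrow>
          (\<forall>X. X 0 = x \<and> subgradient_sequence f \<alpha> X \<longrightarrow> (\<exists>k. X k \<notin> cball xbar \<epsilon>)))}"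
        then obtain X where X: "X 0 = x" "subgradient_sequence f \<alpha> X" "\<And>k. X k \<in> cball xbar \<epsilon>" by blast
        obtain k where k: "X k \<in> M" using trapped[OF \<alpha>(1) X(2,3)] by blast
        then have "X k \<in> N" using M_level[OF k] X(3)[of k] by (simp add: N_def dist_norm norm_minus_commute)
        then have "x \<in> (P ^^ k) N" using reach[OF X(2), of 0 k] X(1) by simp
        then show "x \<in> (\<Union>j. (P ^^ j) N)" by blast
      qed
    qed
  qed
  then have "{\<alpha>. \<alpha> > 0 \<and> \<not> (AE x in lebesgue. x \<in> cball xbar \<epsilon> \<longrightarrow>
      (\<forall>X. X 0 = x \<and> subgradient_sequence f \<alpha> X \<longrightarrow> (\<exists>k. X k \<notin> cball xbar \<epsilon>)))} \<subseteq> bad" by blast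
  ultimately show ?thesis unfolding strongly_unstable_def using \<epsilon>(1) finite_subset by blast
qed

end
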